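(* Let $\mathbb X$ be a category. The free skew monoidal category $\mathbf{Fsk}(\mathbb X)$ on $\mathbb X$ has the following description. An object is an object $(\mathbf m,u,S)$ of $\mathbf{Fsk}$ equipped with a $u$-indexed family $X=(X_i)_{i\in u}$ of objects of $\mathbb X$. A morphism from $(\mathbf m,u,S,X)$ to $(\mathbf n,v,T,Y)$ consists of a morphism $\varphi\colon(\mathbf m,u,S)\to(\mathbf n,v,T)$ in $\mathbf{Fsk}$, along with a $u$-indexed family $x=(x_i)_{i\in u}$ of morphisms in $\mathbb X$, where $x_i\colon X_i\to Y_{\varphi(i)}$. (Composition is componentwise: $(\psi,y)\circ(\varphi,x)=(\psi\varphi,(y_{\varphi(i)}x_i)_{i\in u})$.)
   Context: **Skew monoidal categories.** A (left) skew monoidal category is a category $\mathcal C$ with an object $I$, a functor $\otimes\colon\mathcal C\times\mathcal C\to\mathcal C$, and natural families (not necessarily invertible) $\alpha_{X,Y,Z}\colon (X\otimes Y)\otimes Z\to X\otimes(Y\otimes Z)$, $\lambda_X\colon I\otimes X\to X$, $\rho_X\colon X\to X\otimes I$ such that (1) $(1_W\otimes\alpha_{X,Y,Z})\circ\alpha_{W,X\otimes Y,Z}\circ(\alpha_{W,X,Y}\otimes 1_Z)=\alpha_{W,X,Y\otimes Z}\circ\alpha_{W\otimes X,Y,Z}$; (2) $\lambda_{X\otimes Y}\circ\alpha_{I,X,Y}=\lambda_X\otimes 1_Y$; (3) $(1_X\otimes\lambda_Y)\circ\alpha_{X,I,Y}\circ(\rho_X\otimes 1_Y)=1_{X\otimes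 Y}$; (4) $\alpha_{X,Y,I}\circ\rho_{X\otimes Y}=1_X\otimes\rho_Y$; (5) $\lambda_I\circ\rho_I=1_I$. **Free skew monoidal category on $\mathbb X$.** A skew monoidal category $\mathbf{Fsk}(\mathbb X)$ with a functor $J\colon\mathbb X\to\mathbf{Fsk}(\mathbb X)$ such that for every skew monoidal category $\mathcal C$ and functor $C\colon\mathbb X\to\mathcal C$ there is a unique functor $F\colon\mathbf{Fsk}(\mathbb X)\to\mathcal C$ which strictly preserves the skew monoidal structure and satisfies $FJ=C$. It is determined up to isomorphism. **The category $\mathbf{Fsk}$.** Write $\mathbf m=\{0,\dots,m-1\}$ with its usual order. An order-preserving surjection $\sigma\colon\mathbf m\to\mathbf n$ has right adjoint $\sigma^*(j)=\max\{i:\sigma(i)\le j\}$; an order-preserving injection $\delta$ between non-empty ordinals with $\delta(0)=0$ has right adjoint $\delta^*(j)=\max\{i:\delta(i)\le j\}$. A left bracketing function (lbf) on $\mathbf m$ ($m\ge1$) is a function $\ell\colon\mathbf m\to\mathbf m$ with (i) $\ell(j)\le j$ for all $j$; (ii) $\ell(j)\le i\le j$ implies $\ell(j)\le\ell(i)$; (iii) $\ell(m-1)=m-1$. $\mathrm{Tam}_m$ is the poset of lbfs on $\mathbf m$ under pointwise order; for $S\in\mathrm{Tam}_m$, $\ell_S$ denotes the lbf, and $r_S\colon\mathbf m\to\mathbf m$ is the function with $r_S(0)=0$, $r_S(m-1)=m-1$, and, for $0<i<m-1$, $r_S(i)=\min\{j:\ell_S(j)<i\le j\}$ (with $\min\varnothing=m-1$).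 Objects of $\mathbf{Fsk}$ are triples $(\mathbf m,u,S)$ with $m\ge1$, $u\subseteq\mathbf m$, $S\in\mathrm{Tam}_m$. A shrink morphism $(\mathbf m,u,S)\to(\mathbf n,v,T)$ is an order-preserving surjection $\sigma\colon\mathbf m\to\mathbf n$ such that (a) $\sigma^*$ induces a bijection from $v$ to $u$; (b) if $\sigma(j)=\sigma(j+1)$ then $\sigma\ell_S(j)=\sigma(j)$; (c) $\ell_T=\sigma\ell_S\sigma^*$. An $\mathbf{Fsk}$-surjection $(\mathbf m,u,S)\to(\mathbf n,v,T)$ is an order-preserving surjection which is a shrink morphism $(\mathbf m,u,L)\to(\mathbf n,v,T)$ for some $L\ge S$ in $\mathrm{Tam}_m$. A swell morphism $(\mathbf n,v,T)\to(\mathbf m,u,S)$ is an order-preserving injection $\delta\colon\mathbf n\to\mathbf m$ with $\delta(0)=0$ such that (a) $\delta$ induces a bijection from $v$ to $u$; (b) if $j<\delta(k)\le r_S(j)$ then $j\in\mathrm{im}(\delta)$; (c) $r_T=\delta^*r_S\delta$. An $\mathbf{Fsk}$-injection $(\mathbf n,v,T)\to(\mathbf m,u,S)$ is such a $\delta$ which is a swell morphism $(\mathbf n,v,T)\to(\mathbf m,u,S')$ for some $S'\le S$ in $\mathrm{Tam}_m$. A morphism $(\mathbf m,u,S)\to(\mathbf n,v,T)$ of $\mathbf{Fsk}$ is an order-preserving function $\varphi\colon\mathbf m\to\mathbf n$ which can be written as $\delta\sigma$ with $\sigma\colon(\mathbf m,u,S)\to(\mathbf p,w,R)$ an $\mathbf{Fsk}$-surjection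 and $\delta\colon(\mathbf p,w,R)\to(\mathbf n,v,T)$ an $\mathbf{Fsk}$-injection. Composition is composition of functions. Such a $\varphi$ restricts to a bijection $u\to v$. The tensor product of $\mathbf{Fsk}$ is $(\mathbf m,u,S)\otimes(\mathbf n,v,T)=(\mathbf{m+n},u\star v,S\star T)$ with $u\star v=u\cup\{m+j:j\in v\}$ and $\ell_{S\star T}(i)=\ell_S(i)$ for $i<m-1$, $\ell_{S\star T}(m-1)=0$, $\ell_{S\star T}(i)=m+\ell_T(i-m)$ for $i\ge m$; on morphisms it is ordinal sum. The unit is $(\mathbf 1,\varnothing,* )$, where $*$ is the unique element of $\mathrm{Tam}_1$; $\alpha$ has identity functions as components, $\lambda$ at $(\mathbf m,u,S)$ is the surjection $\mathbf{m+1}\to\mathbf m$ identifying $0$ and $1$, and $\rho$ at $(\mathbf m,u,S)$ is the injection $\mathbf m\to\mathbf{m+1}$ whose image omits $m$. $\mathbf{Fsk}$ is the free skew monoidal category on one object, the generator being $(\mathbf 1,\mathbf 1,* )$. *)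

theory Defs
  imports Main "HOL-Library.FuncSet"
begin

section \<open>Categories, functors, skew monoidal categories\<close>

text \<open>\<open>Comp C g f\<close> is the composite \<open>g \<circ> f\<close>. The operations of a category are total HOL functions;
  only their values on objects, arrows and composable pairs matter.\<close>

record ('o, 'a) cat =
  Ob :: "'o set"
  Arr :: "'a set"
  Dom :: "'a \<Rightarrow> 'o"
  Cod :: "'a \<Rightarrow> 'o"
  Ident :: "'o \<Rightarrow> 'a"
  Comp :: "'a \<Rightarrow> 'a \<Rightarrow> 'a"

definition cat_hom :: "('o, 'a, 'z) cat_scheme \<Rightarrow> 'o \<Rightarrow> 'o \<Rightarrow> 'a set" where
  "cat_hom C A B = {f \<in> Arr C. Dom C f = A \<and> Cod C f = B}"

locale category =
  fixes C :: "('o, 'a, 'z) cat_scheme"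
  assumes Dom_in: "f \<in> Arr C \<Longrightarrow> Dom C f \<in> Ob C"
    and Cod_in: "f \<in> Arr C \<Longrightarrow> Cod C f \<in> Ob C"
    and Ident_in: "A \<in> Ob C \<Longrightarrow> Ident C A \<in> cat_hom C A A"
    and Comp_in: "\<lbrakk>f \<in> cat_hom C A B; g \<in> cat_hom C B D\<rbrakk> \<Longrightarrow> Comp C g f \<in> cat_hom C A D"
    and Comp_Ident: "f \<in> cat_hom C A B \<Longrightarrow> Comp C f (Ident C A) = f"
    and Ident_Comp: "f \<in> cat_hom C A B \<Longrightarrow> Comp C (Ident C B) f = f"
    and Comp_assoc: "\<lbrakk>f \<in> cat_hom C A B; g \<in> cat_hom C B D; h \<in> cat_hom C D E\<rbrakk>
          \<Longrightarrow> Comp C (Comp C h g) f = Comp C h (Comp C g f)"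

record ('o, 'a, 'p, 'b) ftor =
  on_ob :: "'o \<Rightarrow> 'p"
  on_arr :: "'a \<Rightarrow> 'b"

text \<open>The two maps of a functor are required to be extensional (undefined off the objects,
  respectively arrows, of the source), so that equality of functors is HOL equality.\<close>

definition is_functor ::
  "('o, 'a, 'y) cat_scheme \<Rightarrow> ('p, 'b, 'z) cat_scheme \<Rightarrow> ('o, 'a, 'p, 'b) ftor \<Rightarrow> bool" where
  "is_functor C D F \<longleftrightarrow>
     on_ob F \<in> Ob C \<rightarrow>\<^sub>E Ob D \<and>
     on_arr F \<in> Arr C \<rightarrow>\<^sub>E Arr D \<and>
     (\<forall>f\<in>Arr C. Dom D (on_arr F f) = on_ob F (Dom C f) \<and> Cod D (on_arr F f) = on_ob F (Cod C f)) \<and>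
     (\<forall>A\<in>Ob C. on_arr F (Ident C A) = Ident D (on_ob F A)) \<and>
     (\<forall>f\<in>Arr C. \<forall>g\<in>Arr C. Cod C f = Dom C g \<longrightarrow>
        on_arr F (Comp C g f) = Comp D (on_arr F g) (on_arr F f))"

definition ftor_comp ::
  "('o, 'a, 'z) cat_scheme \<Rightarrow> ('p, 'b, 'q, 'c) ftor \<Rightarrow> ('o, 'a, 'p, 'b) ftor \<Rightarrow> ('o, 'a, 'q, 'c) ftor"
where
  "ftor_comp C G F =
     \<lparr>on_ob = compose (Ob C) (on_ob G) (on_ob F), on_arr = compose (Arr C) (on_arr G) (on_arr F)\<rparr>"

record ('o, 'a) skew_cat = "('o, 'a) cat" +
  Unit :: "'o"
  Tens :: "'o \<Rightarrow> 'o \<Rightarrow> 'o"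
  TensA :: "'a \<Rightarrow> 'a \<Rightarrow> 'a"
  Assoc :: "'o \<Rightarrow> 'o \<Rightarrow> 'o \<Rightarrow> 'a"
  LUnit :: "'o \<Rightarrow> 'a"
  RUnit :: "'o \<Rightarrow> 'a"

locale skew_monoidal_category = category C
  for C :: "('o, 'a, 'z) skew_cat_scheme" +
  assumes Unit_in: "Unit C \<in> Ob C"
    and Tens_in: "\<lbrakk>A \<in> Ob C; B \<in> Ob C\<rbrakk> \<Longrightarrow> Tens C A B \<in> Ob C"
    and TensA_in: "\<lbrakk>f \<in> cat_hom C A A'; g \<in> cat_hom C B B'\<rbrakk>
          \<Longrightarrow> TensA C f g \<in> cat_hom C (Tens C A B) (Tens C A' B')"
    and TensA_Ident: "\<lbrakk>A \<in> Ob C; B \<in> Ob C\<rbrakk>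
          \<Longrightarrow> TensA C (Ident C A) (Ident C B) = Ident C (Tens C A B)"
    and TensA_Comp: "\<lbrakk>f \<in> cat_hom C A A'; f' \<in> cat_hom C A' A'';
            g \<in> cat_hom C B B'; g' \<in> cat_hom C B' B''\<rbrakk>
          \<Longrightarrow> TensA C (Comp C f' f) (Comp C g' g) = Comp C (TensA C f' g') (TensA C f g)"
    and Assoc_in: "\<lbrakk>X \<in> Ob C; Y \<in> Ob C; Z \<in> Ob C\<rbrakk>
          \<Longrightarrow> Assoc C X Y Z \<in> cat_hom C (Tens C (Tens C X Y) Z) (Tens C X (Tens C Y Z))"
    and LUnit_in: "X \<in> Ob C \<Longrightarrow> LUnit C X \<in> cat_hom C (Tens C (Unit C) X) X"
    and RUnit_in: "X \<in> Ob C \<Longrightarrow> RUnit C X \<in> cat_hom C X (Tens C X (Unit C))"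
    and Assoc_natural: "\<lbrakk>f \<in> cat_hom C X X'; g \<in> cat_hom C Y Y'; h \<in> cat_hom C Z Z'\<rbrakk>
          \<Longrightarrow> Comp C (Assoc C X' Y' Z') (TensA C (TensA C f g) h)
            = Comp C (TensA C f (TensA C g h)) (Assoc C X Y Z)"
    and LUnit_natural: "f \<in> cat_hom C X X'
          \<Longrightarrow> Comp C (LUnit C X') (TensA C (Ident C (Unit C)) f) = Comp C f (LUnit C X)"
    and RUnit_natural: "f \<in> cat_hom C X X'
          \<Longrightarrow> Comp C (RUnit C X') f = Comp C (TensA C f (Ident C (Unit C))) (RUnit C X)"
    and pentagon: "\<lbrakk>W \<in> Ob C; X \<in> Ob C; Y \<in> Ob C; Z \<in> Ob C\<rbrakk>
          \<Longrightarrow> Comp C (TensA C (Ident C W) (Assoc C X Y Z))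
                (Comp C (Assoc C W (Tens C X Y) Z) (TensA C (Assoc C W X Y) (Ident C Z)))
            = Comp C (Assoc C W X (Tens C Y Z)) (Assoc C (Tens C W X) Y Z)"
    and LUnit_Assoc: "\<lbrakk>X \<in> Ob C; Y \<in> Ob C\<rbrakk>
          \<Longrightarrow> Comp C (LUnit C (Tens C X Y)) (Assoc C (Unit C) X Y)
            = TensA C (LUnit C X) (Ident C Y)"
    and LUnit_Assoc_RUnit: "\<lbrakk>X \<in> Ob C; Y \<in> Ob C\<rbrakk>
          \<Longrightarrow> Comp C (TensA C (Ident C X) (LUnit C Y))
                (Comp C (Assoc C X (Unit C) Y) (TensA C (RUnit C X) (Ident C Y)))
            = Ident C (Tens C X Y)"
    and Assoc_RUnit: "\<lbrakk>X \<in> Ob C; Y \<in> Ob C\<rbrakk>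
          \<Longrightarrow> Comp C (Assoc C X Y (Unit C)) (RUnit C (Tens C X Y))
            = TensA C (Ident C X) (RUnit C Y)"
    and LUnit_RUnit: "Comp C (LUnit C (Unit C)) (RUnit C (Unit C)) = Ident C (Unit C)"

definition strict_skew_functor ::
  "('o, 'a, 'y) skew_cat_scheme \<Rightarrow> ('p, 'b, 'z) skew_cat_scheme \<Rightarrow> ('o, 'a, 'p, 'b) ftor \<Rightarrow> bool"
where
  "strict_skew_functor C D F \<longleftrightarrow>
     is_functor C D F \<and>
     on_ob F (Unit C) = Unit D \<and>
     (\<forall>A\<in>Ob C. \<forall>B\<in>Ob C. on_ob F (Tens C A B) = Tens D (on_ob F A) (on_ob F B)) \<and>
     (\<forall>f\<in>Arr C. \<forall>g\<in>Arr C. on_arr F (TensA C f g) = TensA D (on_arr F f) (on_arr F g)) \<and>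
     (\<forall>A\<in>Ob C. \<forall>B\<in>Ob C. \<forall>E\<in>Ob C.
        on_arr F (Assoc C A B E) = Assoc D (on_ob F A) (on_ob F B) (on_ob F E)) \<and>
     (\<forall>A\<in>Ob C. on_arr F (LUnit C A) = LUnit D (on_ob F A)) \<and>
     (\<forall>A\<in>Ob C. on_arr F (RUnit C A) = RUnit D (on_ob F A))"

text \<open>HOL cannot quantify over types inside a formula, so the universal property is stated for the
  skew monoidal categories with objects in \<open>'c\<close> and arrows in \<open>'d\<close>; a theorem in which \<open>'c\<close> and \<open>'d\<close>
  are free type variables asserts it for all of them.\<close>

definition free_skew_monoidal_on ::
  "'c itself \<Rightarrow> 'd itself \<Rightarrow> ('o, 'a) cat \<Rightarrow> ('p, 'b) skew_cat \<Rightarrow> ('o, 'a, 'p, 'b) ftor \<Rightarrow> bool"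
where
  "free_skew_monoidal_on _ _ X M J \<longleftrightarrow>
     skew_monoidal_category M \<and> is_functor X M J \<and>
     (\<forall>(C :: ('c, 'd) skew_cat) G. skew_monoidal_category C \<and> is_functor X C G \<longrightarrow>
        (\<exists>!F. strict_skew_functor M C F \<and> ftor_comp X F J = G))"


section \<open>The category Fsk\<close>

text \<open>The ordinal \<open>m\<close> is \<open>{..<m}\<close>, and functions between ordinals are extensional (\<open>\<rightarrow>\<^sub>E\<close>). An element
  of the Tamari poset is represented by its left bracketing function.\<close>

definition Tam :: "nat \<Rightarrow> (nat \<Rightarrow> nat) set" where
  "Tam m = {l \<in> {..<m} \<rightarrow>\<^sub>E {..<m}.
     (\<forall>j<m. l j \<le> j) \<and>
     (\<forall>j<m. \<forall>i. l j \<le> i \<and> i \<le> j \<longrightarrow> l j \<le> l i) \<and>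
     l (m - 1) = m - 1}"

definition Tam_le :: "nat \<Rightarrow> (nat \<Rightarrow> nat) \<Rightarrow> (nat \<Rightarrow> nat) \<Rightarrow> bool" where
  "Tam_le m S T \<longleftrightarrow> (\<forall>j<m. S j \<le> T j)"

definition rbf :: "nat \<Rightarrow> (nat \<Rightarrow> nat) \<Rightarrow> nat \<Rightarrow> nat" where
  "rbf m l i =
     (if i = 0 then 0
      else if i < m - 1 then
        (let K = {j. j < m \<and> l j < i \<and> i \<le> j} in if K = {} then m - 1 else Min K)
      else m - 1)"

text \<open>The right adjoint of an order-preserving function with domain the ordinal \<open>m\<close>.\<close>

definition radj :: "nat \<Rightarrow> (nat \<Rightarrow> nat) \<Rightarrow> nat \<Rightarrow> nat" where
  "radj m f j = Max {i. i < m \<and> f i \<le> j}"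

definition ord_surj :: "nat \<Rightarrow> nat \<Rightarrow> (nat \<Rightarrow> nat) \<Rightarrow> bool" where
  "ord_surj m n \<sigma> \<longleftrightarrow> \<sigma> \<in> {..<m} \<rightarrow>\<^sub>E {..<n} \<and> mono_on {..<m} \<sigma> \<and> \<sigma> ` {..<m} = {..<n}"

definition ord_inj0 :: "nat \<Rightarrow> nat \<Rightarrow> (nat \<Rightarrow> nat) \<Rightarrow> bool" where
  "ord_inj0 n m \<delta> \<longleftrightarrow>
     \<delta> \<in> {..<n} \<rightarrow>\<^sub>E {..<m} \<and> mono_on {..<n} \<delta> \<and> inj_on \<delta> {..<n} \<and> \<delta> 0 = 0"

type_synonym fsk_ob = "nat \<times> nat set \<times> (nat \<Rightarrow> nat)"

definition Fsk_Ob :: "fsk_ob set" where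
  "Fsk_Ob = {(m, u, S). 1 \<le> m \<and> u \<subseteq> {..<m} \<and> S \<in> Tam m}"

fun shrink :: "fsk_ob \<Rightarrow> fsk_ob \<Rightarrow> (nat \<Rightarrow> nat) \<Rightarrow> bool" where
  "shrink (m, u, S) (n, v, T) \<sigma> \<longleftrightarrow>
     ord_surj m n \<sigma> \<and>
     bij_betw (radj m \<sigma>) v u \<and>
     (\<forall>j. j + 1 < m \<and> \<sigma> j = \<sigma> (j + 1) \<longrightarrow> \<sigma> (S j) = \<sigma> j) \<and>
     (\<forall>j<n. T j = \<sigma> (S (radj m \<sigma> j)))"

fun Fsk_surj :: "fsk_ob \<Rightarrow> fsk_ob \<Rightarrow> (nat \<Rightarrow> nat) \<Rightarrow> bool" where
  "Fsk_surj (m, u, S) B \<sigma> \<longleftrightarrow> (\<exists>L\<in>Tam m. Tam_le m S L \<and> shrink (m, u, L) B \<sigma>)"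

fun swell :: "fsk_ob \<Rightarrow> fsk_ob \<Rightarrow> (nat \<Rightarrow> nat) \<Rightarrow> bool" where
  "swell (n, v, T) (m, u, S) \<delta> \<longleftrightarrow>
     ord_inj0 n m \<delta> \<and>
     bij_betw \<delta> v u \<and>
     (\<forall>j<m. \<forall>k<n. j < \<delta> k \<and> \<delta> k \<le> rbf m S j \<longrightarrow> j \<in> \<delta> ` {..<n}) \<and>
     (\<forall>j<n. rbf n T j = radj n \<delta> (rbf m S (\<delta> j)))"

fun Fsk_inj :: "fsk_ob \<Rightarrow> fsk_ob \<Rightarrow> (nat \<Rightarrow> nat) \<Rightarrow> bool" where
  "Fsk_inj A (m, u, S) \<delta> \<longleftrightarrow> (\<exists>S'\<in>Tam m. Tam_le m S' S \<and> swell A (m, u, S') \<delta>)"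

definition Fsk_hom :: "fsk_ob \<Rightarrow> fsk_ob \<Rightarrow> (nat \<Rightarrow> nat) set" where
  "Fsk_hom A B = {\<phi>. \<exists>P\<in>Fsk_Ob. \<exists>\<sigma> \<delta>.
     Fsk_surj A P \<sigma> \<and> Fsk_inj P B \<delta> \<and> \<phi> = compose {..<fst A} \<delta> \<sigma>}"

definition star_set :: "nat \<Rightarrow> nat set \<Rightarrow> nat set \<Rightarrow> nat set" where
  "star_set m u v = u \<union> {m + j |j. j \<in> v}"

definition star_lbf :: "nat \<Rightarrow> nat \<Rightarrow> (nat \<Rightarrow> nat) \<Rightarrow> (nat \<Rightarrow> nat) \<Rightarrow> nat \<Rightarrow> nat" where
  "star_lbf m n S T =
     (\<lambda>i\<in>{..<m + n}. if i < m - 1 then S i else if i = m - 1 then 0 else m + T (i - m))"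

fun Fsk_tens :: "fsk_ob \<Rightarrow> fsk_ob \<Rightarrow> fsk_ob" where
  "Fsk_tens (m, u, S) (n, v, T) = (m + n, star_set m u v, star_lbf m n S T)"

definition Fsk_unit :: fsk_ob where
  "Fsk_unit = (1, {}, \<lambda>i\<in>{..<1}. 0)"

definition Fsk_gen :: fsk_ob where
  "Fsk_gen = (1, {..<1}, \<lambda>i\<in>{..<1}. 0)"

text \<open>Ordinal sum of functions with domains \<open>m\<close> and \<open>n\<close>, the first having codomain \<open>m'\<close>.\<close>

definition ord_sum :: "nat \<Rightarrow> nat \<Rightarrow> nat \<Rightarrow> (nat \<Rightarrow> nat) \<Rightarrow> (nat \<Rightarrow> nat) \<Rightarrow> nat \<Rightarrow> nat" where
  "ord_sum m n m' \<phi> \<psi> = (\<lambda>i\<in>{..<m + n}. if i < m then \<phi> i else m' + \<psi> (i - m))"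


section \<open>The category Fsk(X)\<close>

text \<open>Objects and arrows of Fsk(X). An arrow \<open>(A, B, \<phi>, x)\<close> carries its source and target; families
  indexed by \<open>u\<close> are extensional functions on \<open>u\<close>.\<close>

type_synonym 'o fskx_ob = "fsk_ob \<times> (nat \<Rightarrow> 'o)"
type_synonym ('o, 'a) fskx_arr = "'o fskx_ob \<times> 'o fskx_ob \<times> (nat \<Rightarrow> nat) \<times> (nat \<Rightarrow> 'a)"

definition FskX_Ob :: "('o, 'a) cat \<Rightarrow> 'o fskx_ob set" where
  "FskX_Ob \<X> = {((m, u, S), X). (m, u, S) \<in> Fsk_Ob \<and> X \<in> u \<rightarrow>\<^sub>E Ob \<X>}"

definition FskX_Arr :: "('o, 'a) cat \<Rightarrow> ('o, 'a) fskx_arr set" where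
  "FskX_Arr \<X> = {(((m, u, S), X), ((n, v, T), Y), \<phi>, x).
     ((m, u, S), X) \<in> FskX_Ob \<X> \<and> ((n, v, T), Y) \<in> FskX_Ob \<X> \<and>
     \<phi> \<in> Fsk_hom (m, u, S) (n, v, T) \<and>
     x \<in> (\<Pi>\<^sub>E i\<in>u. cat_hom \<X> (X i) (Y (\<phi> i)))}"

fun FskX_Ident :: "('o, 'a) cat \<Rightarrow> 'o fskx_ob \<Rightarrow> ('o, 'a) fskx_arr" where
  "FskX_Ident \<X> ((m, u, S), X) =
     (((m, u, S), X), ((m, u, S), X), (\<lambda>i\<in>{..<m}. i), (\<lambda>i\<in>u. Ident \<X> (X i)))"

fun FskX_Comp :: "('o, 'a) cat \<Rightarrow> ('o, 'a) fskx_arr \<Rightarrow> ('o, 'a) fskx_arr \<Rightarrow> ('o, 'a) fskx_arr" where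
  "FskX_Comp \<X> (_, C, \<psi>, y) (((m, u, S), X), _, \<phi>, x) =
     (((m, u, S), X), C, compose {..<m} \<psi> \<phi>, (\<lambda>i\<in>u. Comp \<X> (y (\<phi> i)) (x i)))"

text \<open>Juxtaposition of a \<open>u\<close>-indexed and a \<open>v\<close>-indexed family, where \<open>u\<close> is a subset of the
  ordinal \<open>m\<close>.\<close>

definition star_fam :: "nat \<Rightarrow> nat set \<Rightarrow> nat set \<Rightarrow> (nat \<Rightarrow> 'x) \<Rightarrow> (nat \<Rightarrow> 'x) \<Rightarrow> nat \<Rightarrow> 'x" where
  "star_fam m u v X Y = (\<lambda>i\<in>star_set m u v. if i < m then X i else Y (i - m))"

fun FskX_Tens :: "'o fskx_ob \<Rightarrow> 'o fskx_ob \<Rightarrow> 'o fskx_ob" where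
  "FskX_Tens ((m, u, S), X) ((n, v, T), Y) =
     (Fsk_tens (m, u, S) (n, v, T), star_fam m u v X Y)"

fun FskX_TensA :: "('o, 'a) fskx_arr \<Rightarrow> ('o, 'a) fskx_arr \<Rightarrow> ('o, 'a) fskx_arr" where
  "FskX_TensA (((m, u, S), X), ((m', u', S'), X'), \<phi>, x) (((n, v, T), Y), B', \<psi>, y) =
     (FskX_Tens ((m, u, S), X) ((n, v, T), Y),
      FskX_Tens ((m', u', S'), X') B',
      ord_sum m n m' \<phi> \<psi>,
      star_fam m u v x y)"

definition FskX_Unit :: "'o fskx_ob" where
  "FskX_Unit = (Fsk_unit, \<lambda>i\<in>{}. undefined)"

text \<open>The constraints lie over those of Fsk, with families of identities. That of the associator is
  indexed by the objects of the family of \<open>(A \<otimes> B) \<otimes> E\<close>, which is also that of \<open>A \<otimes> (B \<otimes> E)\<close>. For the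
  left unit, \<open>i - 1\<close> is truncated subtraction, so \<open>0\<close> and \<open>1\<close> are identified.\<close>

definition FskX_Assoc ::
  "('o, 'a) cat \<Rightarrow> 'o fskx_ob \<Rightarrow> 'o fskx_ob \<Rightarrow> 'o fskx_ob \<Rightarrow> ('o, 'a) fskx_arr" where
  "FskX_Assoc \<X> A B E =
     (case FskX_Tens (FskX_Tens A B) E of ((q, w, R), Z) \<Rightarrow>
       (((q, w, R), Z), FskX_Tens A (FskX_Tens B E),
        (\<lambda>i\<in>{..<q}. i), (\<lambda>i\<in>w. Ident \<X> (Z i))))"

fun FskX_LUnit :: "('o, 'a) cat \<Rightarrow> 'o fskx_ob \<Rightarrow> ('o, 'a) fskx_arr" where
  "FskX_LUnit \<X> ((m, u, S), X) =
     (FskX_Tens FskX_Unit ((m, u, S), X), ((m, u, S), X),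
      (\<lambda>i\<in>{..<m + 1}. i - 1), (\<lambda>i\<in>star_set 1 {} u. Ident \<X> (X (i - 1))))"

fun FskX_RUnit :: "('o, 'a) cat \<Rightarrow> 'o fskx_ob \<Rightarrow> ('o, 'a) fskx_arr" where
  "FskX_RUnit \<X> ((m, u, S), X) =
     (((m, u, S), X), FskX_Tens ((m, u, S), X) FskX_Unit,
      (\<lambda>i\<in>{..<m}. i), (\<lambda>i\<in>u. Ident \<X> (X i)))"

definition FskX :: "('o, 'a) cat \<Rightarrow> ('o fskx_ob, ('o, 'a) fskx_arr) skew_cat" where
  "FskX \<X> =
     \<lparr>Ob = FskX_Ob \<X>,
      Arr = FskX_Arr \<X>,
      Dom = (\<lambda>(A, B, \<phi>, x). A),
      Cod = (\<lambda>(A, B, \<phi>, x). B),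
      Ident = FskX_Ident \<X>,
      Comp = FskX_Comp \<X>,
      Unit = FskX_Unit,
      Tens = FskX_Tens,
      TensA = FskX_TensA,
      Assoc = FskX_Assoc \<X>,
      LUnit = FskX_LUnit \<X>,
      RUnit = FskX_RUnit \<X>\<rparr>"

text \<open>The functor \<open>J\<close> sends \<open>A\<close> to the generator of Fsk equipped with the one-element family \<open>A\<close>.\<close>

definition FskX_J_ob :: "'o \<Rightarrow> 'o fskx_ob" where
  "FskX_J_ob A = (Fsk_gen, \<lambda>i\<in>{..<1}. A)"

definition FskX_J :: "('o, 'a) cat \<Rightarrow> ('o, 'a, 'o fskx_ob, ('o, 'a) fskx_arr) ftor" where
  "FskX_J \<X> =
     \<lparr>on_ob = (\<lambda>A\<in>Ob \<X>. FskX_J_ob A),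
      on_arr = (\<lambda>f\<in>Arr \<X>. (FskX_J_ob (Dom \<X> f), FskX_J_ob (Cod \<X> f),
                            (\<lambda>i\<in>{..<1}. i), (\<lambda>i\<in>{..<1}. f)))\<rparr>"

end

theory Submission
  imports Defs
begin

text \<open>An order-preserving \<open>\<phi>\<close> with \<open>\<phi> 0 = 0\<close> is a morphism of Fsk from \<open>(m, u, S)\<close> to \<open>(n, v, T)\<close> if and
  only if it maps \<open>u\<close> onto \<open>v\<close>, every element of \<open>u\<close> is the largest one of its fibre, and \<open>\<phi> (S j) \<le> T k\<close>
  whenever \<open>\<phi> j \<le> k < \<phi> (j + 1)\<close>. These conditions are stable under composition and ordinal sum, whence
  the skew monoidal structure of Fsk(X).

  For the universal property, view an object as a binary tree whose leaves are units or objects of X.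
  In any skew monoidal category under X, a map of trees which is composed of structure maps and arrows of X
  has a normal form, as in the focused sequent calculus for skew monoidal categories: first contract a unit
  in the leftmost position (\<open>\<lambda>\<close>), possibly repeatedly; then, if the target is \<open>B \<otimes> C\<close>, split the source
  \<open>D \<rightarrow> Q \<otimes> E\<close> by inserting a unit (\<open>\<rho>\<close> and \<open>\<alpha>\<close>) and continue with \<open>Q \<rightarrow> B\<close> and \<open>E \<rightarrow> C\<close>. Normal
  forms contain the generators and are closed under composition. In Fsk(X) every arrow has exactly one normal
  form, since its underlying function determines each step: a unit is contracted when \<open>\<phi> 1 = 0\<close>, and
  otherwise \<open>Q\<close> consists of the leaves mapped into \<open>B\<close>. Normal forms in the product of Fsk(X) with a skew
  monoidal category \<open>C\<close> under X therefore form the graph of a function from the arrows of Fsk(X) to those of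
  \<open>C\<close>, which is the required functor.\<close>

section \<open>Normal forms of structural maps\<close>

text \<open>The obstacle: an arrow of Fsk(X) is a function with a family and remembers no
  derivation, so its image in \<open>C\<close> must not depend on how it is built from structure
  maps. Not all diagrams of structure maps commute: at the unit, \<rho> after \<lambda> is an
  endomorphism of \<open>I \<otimes> I\<close> other than the identity, with a constant underlying
  function. So the underlying function itself has to steer the normal form. Normal forms are a
  relation between trees and arrows of a model, not terms, and no equality of terms has to be
  axiomatized. In their closure proof each coherence axiom has one place: \<open>pentagon\<close>
  and \<open>Assoc_RUnit\<close> reassociate nested splittings, \<open>LUnit_Assoc\<close> and
  \<open>LUnit_RUnit\<close> cancel \<lambda> against a splitting whose head is a unit,
  \<open>LUnit_Assoc_RUnit\<close> normalizes a tensor product. Contractions can be put before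
  splittings by naturality alone. Morphisms of Fsk are defined by a factorization, which says
  nothing about composites; this is why an inequality criterion is proved first.\<close>

lemma cat_homD:
  assumes "f \<in> cat_hom C A B"
  shows "f \<in> Arr C" "Dom C f = A" "Cod C f = B"
  using assms by (auto simp: cat_hom_def)

lemma cat_homI: "f \<in> Arr C \<Longrightarrow> Dom C f = A \<Longrightarrow> Cod C f = B \<Longrightarrow> f \<in> cat_hom C A B"
  by (simp add: cat_hom_def)

lemma (in category) hom_Ob: "f \<in> cat_hom C A B \<Longrightarrow> A \<in> Ob C \<and> B \<in> Ob C"
  using Dom_in Cod_in by (auto simp: cat_hom_def)

lemma is_functor_hom:
  assumes "is_functor C D F" "f \<in> cat_hom C A B"
  shows "on_arr F f \<in> cat_hom D (on_ob F A) (on_ob F B)"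
  using assms by (auto simp: is_functor_def cat_hom_def)

lemma is_functor_Ident: "is_functor C D F \<Longrightarrow> A \<in> Ob C \<Longrightarrow> on_arr F (Ident C A) = Ident D (on_ob F A)"
  by (auto simp: is_functor_def)

lemma is_functor_Comp:
  assumes "is_functor C D F" "f \<in> cat_hom C A B" "g \<in> cat_hom C B E"
  shows "on_arr F (Comp C g f) = Comp D (on_arr F g) (on_arr F f)"
  using assms by (auto simp: is_functor_def cat_hom_def)

lemma is_functor_Ob: "is_functor C D F \<Longrightarrow> A \<in> Ob C \<Longrightarrow> on_ob F A \<in> Ob D"
  by (auto simp: is_functor_def)

datatype 'o tree = Unt | Leaf 'o | Node "'o tree" "'o tree"

text \<open>\<open>M\<close> is kept abstract because the intended instance is not \<open>C\<close>
  but the product of Fsk(X) with \<open>C\<close>: a normal form is to be evaluated in both factors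
  at once.\<close>

locale skew_model = X: category \<X> + skew_monoidal_category M
  for \<X> :: "('o, 'a) cat" and M :: "('p, 'b) skew_cat" +
  fixes G :: "('o, 'a, 'p, 'b) ftor"
  assumes G: "is_functor \<X> M G"
begin

abbreviation comp_M (infixr "\<cdot>" 70) where "g \<cdot> f \<equiv> Comp M g f"
abbreviation tens_M (infixr "\<otimes>" 75) where "f \<otimes> g \<equiv> TensA M f g"
abbreviation hom where "hom \<equiv> cat_hom M"

primrec ev :: "'o tree \<Rightarrow> 'p" where
  "ev Unt = Unit M"
| "ev (Leaf A) = on_ob G A"
| "ev (Node s t) = Tens M (ev s) (ev t)"

definition ok :: "'o tree \<Rightarrow> bool" where
  "ok t \<longleftrightarrow> set_tree t \<subseteq> Ob \<X>"

lemma ok_simps [simp]: "ok Unt" "ok (Leaf A) \<longleftrightarrow> A \<in> Ob \<X>" "ok (Node s t) \<longleftrightarrow> ok s \<and> ok t"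
  by (auto simp: ok_def)

abbreviation idt where "idt t \<equiv> Ident M (ev t)"

lemma ev_Ob: "ok t \<Longrightarrow> ev t \<in> Ob M"
  by (induction t) (auto simp: Unit_in Tens_in is_functor_Ob[OF G])

lemma idt_hom: "ok t \<Longrightarrow> idt t \<in> hom (ev t) (ev t)"
  by (simp add: Ident_in ev_Ob)

text \<open>A leftmost unit is contracted: \<open>((I \<otimes> A) \<otimes> Q\<^sub>1) \<otimes> \<dots> \<rightarrow> (A \<otimes> Q\<^sub>1) \<otimes> \<dots>\<close>.\<close>

inductive lstep :: "'o tree \<Rightarrow> 'o tree \<Rightarrow> 'b \<Rightarrow> bool" where
  lstep_unit: "ok A \<Longrightarrow> lstep (Node Unt A) A (LUnit M (ev A))"
| lstep_node: "lstep P P' l \<Longrightarrow> ok Q \<Longrightarrow> lstep (Node P Q) (Node P' Q) (l \<otimes> idt Q)"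

text \<open>A node of the left spine is made the root:
  \<open>((P \<otimes> Q\<^sub>1) \<otimes> Q\<^sub>2) \<otimes> \<dots> \<rightarrow> P \<otimes> (((I \<otimes> Q\<^sub>1) \<otimes> Q\<^sub>2) \<otimes> \<dots>)\<close>.\<close>

inductive spl :: "'o tree \<Rightarrow> 'o tree \<Rightarrow> 'o tree \<Rightarrow> 'b \<Rightarrow> bool" where
  spl_unit: "ok P \<Longrightarrow> spl P P Unt (RUnit M (ev P))"
| spl_node: "spl D P E k \<Longrightarrow> ok Q \<Longrightarrow>
    spl (Node D Q) P (Node E Q) (Assoc M (ev P) (ev E) (ev Q) \<cdot> (k \<otimes> idt Q))"

text \<open>The flag is \<open>True\<close> for the focused normal forms, which do not start with a contraction.\<close>

inductive NF :: "bool \<Rightarrow> 'o tree \<Rightarrow> 'o tree \<Rightarrow> 'b \<Rightarrow> bool" where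
  NF_unit: "NF True Unt Unt (idt Unt)"
| NF_leaf: "f \<in> cat_hom \<X> A B \<Longrightarrow> NF True (Leaf A) (Leaf B) (on_arr G f)"
| NF_tens: "NF True P B f \<Longrightarrow> spl D P E k \<Longrightarrow> NF False E C h \<Longrightarrow> NF True D (Node B C) ((f \<otimes> h) \<cdot> k)"
| NF_switch: "NF True D B f \<Longrightarrow> NF False D B f"
| NF_pass: "lstep D D' l \<Longrightarrow> NF False D' B f \<Longrightarrow> NF False D B (f \<cdot> l)"

text \<open>Generated arrows are taken by value instead of as terms. The trees stay as indices
  because \<open>ev\<close> may identify different trees, while normal forms recurse on
  trees.\<close>

inductive den :: "'o tree \<Rightarrow> 'o tree \<Rightarrow> 'b \<Rightarrow> bool" where
  den_id: "ok A \<Longrightarrow> den A A (idt A)"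
| den_comp: "den A B f \<Longrightarrow> den B C g \<Longrightarrow> den A C (g \<cdot> f)"
| den_tens: "den A B f \<Longrightarrow> den C E g \<Longrightarrow> den (Node A C) (Node B E) (f \<otimes> g)"
| den_assoc: "ok A \<Longrightarrow> ok B \<Longrightarrow> ok C \<Longrightarrow>
    den (Node (Node A B) C) (Node A (Node B C)) (Assoc M (ev A) (ev B) (ev C))"
| den_lunit: "ok A \<Longrightarrow> den (Node Unt A) A (LUnit M (ev A))"
| den_runit: "ok A \<Longrightarrow> den A (Node A Unt) (RUnit M (ev A))"
| den_leaf: "f \<in> cat_hom \<X> A B \<Longrightarrow> den (Leaf A) (Leaf B) (on_arr G f)"

lemma den_hom: "den A B f \<Longrightarrow> ok A \<and> ok B \<and> f \<in> hom (ev A) (ev B)"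
proof (induction rule: den.induct)
  case (den_comp A B f C g)
  then show ?case using Comp_in by blast
next
  case (den_tens A B f C E g)
  then show ?case using TensA_in by simp
next
  case (den_leaf f A B)
  then show ?case using is_functor_hom[OF G] X.hom_Ob by simp
qed (simp_all add: idt_hom ev_Ob Assoc_in LUnit_in RUnit_in)

lemma lstep_den: "lstep D D' l \<Longrightarrow> den D D' l"
  by (induction rule: lstep.induct) (auto intro: den.intros)

lemma spl_den: "spl D P E k \<Longrightarrow> den D (Node P E) k"
proof (induction rule: spl.induct)
  case (spl_node D P E k Q)
  then show ?case using den_hom[OF spl_node.IH] by (auto intro!: den_comp[OF den_tens[OF _ den_id]] den_assoc)
qed (auto intro: den_runit)

lemma NF_den: "NF b D B f \<Longrightarrow> den D B f"
  by (induction rule: NF.induct) (auto intro: den.intros lstep_den spl_den simp del: ev.simps)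

lemmas lstep_hom = den_hom[OF lstep_den]
lemmas spl_hom = den_hom[OF spl_den]
lemmas NF_hom = den_hom[OF NF_den]

section \<open>Exchanging contractions and splittings\<close>

lemma tens_id: "ok A \<Longrightarrow> ok B \<Longrightarrow> idt A \<otimes> idt B = idt (Node A B)"
  by (simp add: TensA_Ident ev_Ob)

lemma interchange_id:
  assumes "f \<in> hom A B" "g \<in> hom B C" "ok Q"
  shows "(g \<otimes> idt Q) \<cdot> (f \<otimes> idt Q) = (g \<cdot> f) \<otimes> idt Q"
  using TensA_Comp[OF assms(1,2) idt_hom[OF assms(3)] idt_hom[OF assms(3)]]
    Comp_Ident[OF idt_hom[OF assms(3)]] by simp

text \<open>Only the unit at the bottom of the left spine can be contracted; the two rules never
  overlap because \<open>Unt\<close> by itself has no step.\<close>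

lemma lstep_det: "lstep D D' l \<Longrightarrow> lstep D D'' l' \<Longrightarrow> D'' = D' \<and> l' = l"
proof (induction arbitrary: D'' l' rule: lstep.induct)
  case (lstep_unit A)
  from lstep_unit(2) show ?case
  proof (cases rule: lstep.cases)
    case (lstep_node P' k)
    from lstep_node(3) show ?thesis by (cases rule: lstep.cases)
  qed auto
next
  case (lstep_node P P' l Q)
  from lstep_node.prems show ?case
  proof (cases rule: lstep.cases)
    case lstep_unit
    with lstep_node.hyps(1) show ?thesis by (auto elim: lstep.cases)
  next
    case (lstep_node P'' k)
    then show ?thesis using lstep_node.IH by blast
  qed
qed

text \<open>The head of a splitting lies on the left spine, so contracting its leftmost unit is
  contracting that of \<open>D\<close>. Commutation is naturality of \<rho> at the bottom and
  naturality of \<alpha> at each further node.\<close>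

lemma lstep_spl:
  assumes "spl D P E k" "lstep P P' l"
  shows "\<exists>D' l' k'. lstep D D' l' \<and> spl D' P' E k' \<and> (l \<otimes> idt E) \<cdot> k = k' \<cdot> l'"
  using assms
proof (induction rule: spl.induct)
  case (spl_unit P)
  then show ?case
    using RUnit_natural[of l "ev P" "ev P'"] lstep_hom[OF spl_unit(2)] spl.spl_unit by fastforce
next
  case (spl_node D P E k Q)
  from spl_node.IH[OF spl_node.prems] obtain D' l' k' where IH: "lstep D D' l'" "spl D' P' E k'"
    "(l \<otimes> idt E) \<cdot> k = k' \<cdot> l'" by blast
  let ?Q = "idt Q"
  have l: "l \<in> hom (ev P) (ev P')" and l': "l' \<in> hom (ev D) (ev D')"
    using lstep_hom spl_node.prems IH by blast+
  have k: "k \<in> hom (ev D) (Tens M (ev P) (ev E))" and k': "k' \<in> hom (ev D') (Tens M (ev P') (ev E))"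
    and o: "ok E" "ok P" "ok P'"
    using spl_hom spl_node.hyps IH by fastforce+
  note Q = idt_hom[OF \<open>ok Q\<close>] and E = idt_hom[OF \<open>ok E\<close>]
  note obs = ev_Ob[OF \<open>ok P\<close>] ev_Ob[OF \<open>ok P'\<close>] ev_Ob[OF \<open>ok E\<close>] ev_Ob[OF \<open>ok Q\<close>]
  let ?a = "Assoc M (ev P) (ev E) (ev Q)" and ?a' = "Assoc M (ev P') (ev E) (ev Q)"
  have a: "?a \<in> hom (Tens M (Tens M (ev P) (ev E)) (ev Q)) (Tens M (ev P) (Tens M (ev E) (ev Q)))"
    and a': "?a' \<in> hom (Tens M (Tens M (ev P') (ev E)) (ev Q)) (Tens M (ev P') (Tens M (ev E) (ev Q)))"
    using Assoc_in obs by blast+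
  note kQ = TensA_in[OF k Q] and k'Q = TensA_in[OF k' Q] and l'Q = TensA_in[OF l' Q]
  note lEQ = TensA_in[OF TensA_in[OF l E] Q]
  have "(l \<otimes> idt (Node E Q)) \<cdot> ?a \<cdot> (k \<otimes> ?Q) = ((l \<otimes> (idt E \<otimes> ?Q)) \<cdot> ?a) \<cdot> (k \<otimes> ?Q)"
    using Comp_assoc[OF kQ a TensA_in[OF l TensA_in[OF E Q]]] tens_id o spl_node.hyps(2) by simp
  also have "\<dots> = (?a' \<cdot> ((l \<otimes> idt E) \<otimes> ?Q)) \<cdot> (k \<otimes> ?Q)"
    using Assoc_natural[OF l E Q] by simp
  also have "\<dots> = ?a' \<cdot> ((l \<otimes> idt E) \<cdot> k) \<otimes> ?Q"
    using Comp_assoc[OF kQ lEQ a'] interchange_id[OF k TensA_in[OF l E] spl_node.hyps(2)] by simp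
  also have "\<dots> = ?a' \<cdot> (k' \<otimes> ?Q) \<cdot> (l' \<otimes> ?Q)"
    using interchange_id[OF l' k' spl_node.hyps(2)] IH(3) by simp
  also have "\<dots> = (?a' \<cdot> (k' \<otimes> ?Q)) \<cdot> (l' \<otimes> ?Q)"
    using Comp_assoc[OF l'Q k'Q a'] by simp
  finally show ?case
    using lstep_node[OF IH(1) spl_node.hyps(2)] spl.spl_node[OF IH(2) spl_node.hyps(2)] by blast
qed

text \<open>The rule \<open>NF_tens\<close> asks for a focused first premise. Leading contractions
  of an arbitrary one are moved in front of the splitting by \<open>lstep_spl\<close>.\<close>

lemma NF_tens_general:
  assumes "NF b P B f" "spl D P E k" "NF False E C h"
  shows "NF False D (Node B C) ((f \<otimes> h) \<cdot> k)"
  using assms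
proof (induction b P B f arbitrary: D k rule: NF.induct)
  case (NF_pass P P' l B f)
  obtain D' l' k' where s: "lstep D D' l'" "spl D' P' E k'" "(l \<otimes> idt E) \<cdot> k = k' \<cdot> l'"
    using lstep_spl NF_pass.prems(1) NF_pass.hyps(1) by blast
  have l: "l \<in> hom (ev P) (ev P')" and l': "l' \<in> hom (ev D) (ev D')"
    using lstep_hom NF_pass.hyps s by blast+
  have k: "k \<in> hom (ev D) (Tens M (ev P) (ev E))" and k': "k' \<in> hom (ev D') (Tens M (ev P') (ev E))"
    and o: "ok E"
    using spl_hom NF_pass.prems s by fastforce+
  have f: "f \<in> hom (ev P') (ev B)" and h: "h \<in> hom (ev E) (ev C)"
    using NF_hom NF_pass.hyps NF_pass.prems by blast+
  note E = idt_hom[OF o]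
  have "((f \<cdot> l) \<otimes> h) \<cdot> k = ((f \<otimes> h) \<cdot> (l \<otimes> idt E)) \<cdot> k"
    using TensA_Comp[OF l f E h] Comp_Ident[OF h] by simp
  also have "\<dots> = (f \<otimes> h) \<cdot> (k' \<cdot> l')"
    using Comp_assoc[OF k TensA_in[OF l E] TensA_in[OF f h]] s(3) by simp
  also have "\<dots> = ((f \<otimes> h) \<cdot> k') \<cdot> l'"
    using Comp_assoc[OF l' k' TensA_in[OF f h]] by simp
  finally show ?case
    using NF.NF_pass[OF s(1) NF_pass.IH[OF s(2) NF_pass.prems(2)]] by simp
qed (auto intro: NF.intros simp del: ev.simps)

text \<open>Leading contractions are performed before anything composed on top, so closure under
  composition with \<open>g\<close> has to be checked on focused forms only.\<close>

lemma NF_post: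
  assumes f: "NF False D A f" and g: "g \<in> hom (ev A) (ev B)"
    and focused: "\<And>D f. NF True D A f \<Longrightarrow> NF False D B (g \<cdot> f)"
  shows "NF False D B (g \<cdot> f)"
  using f g focused
proof (induction False D A f rule: NF.induct)
  case (NF_pass D D' l A f)
  have "g \<cdot> (f \<cdot> l) = (g \<cdot> f) \<cdot> l"
    using Comp_assoc[of l "ev D" "ev D'" f "ev A" g "ev B"] lstep_hom[OF NF_pass.hyps(1)]
      NF_hom[OF NF_pass.hyps(2)] NF_pass.prems(1) by simp
  then show ?case
    using NF.NF_pass[OF NF_pass.hyps(1) NF_pass.hyps(3)[OF NF_pass.prems]] by simp
qed auto

text \<open>Splitting off \<open>P\<close> and then \<open>P2\<close> from \<open>P\<close> is
  exchanged for splitting off \<open>P2\<close> at once and then \<open>E2\<close> from the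
  remainder. If the outer splitting is trivial this is \<open>Assoc_RUnit\<close> with naturality of
  \<rho>; each further node costs one pentagon.\<close>

lemma spl_spl:
  assumes "spl D P E k" "spl P P2 E2 k2"
  shows "\<exists>E3 k3 k4. spl D P2 E3 k3 \<and> spl E3 E2 E k4 \<and>
    (idt P2 \<otimes> k4) \<cdot> k3 = Assoc M (ev P2) (ev E2) (ev E) \<cdot> (k2 \<otimes> idt E) \<cdot> k"
  using assms
proof (induction rule: spl.induct)
  case (spl_unit P)
  have k2: "k2 \<in> hom (ev P) (Tens M (ev P2) (ev E2))" and o: "ok P2" "ok E2"
    using spl_hom[OF spl_unit(2)] by auto
  note obs = ev_Ob[OF o(1)] ev_Ob[OF o(2)]
  let ?T = "Tens M (ev P2) (ev E2)"
  have "Assoc M (ev P2) (ev E2) (Unit M) \<cdot> (k2 \<otimes> idt Unt) \<cdot> RUnit M (ev P)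
      = Assoc M (ev P2) (ev E2) (Unit M) \<cdot> RUnit M ?T \<cdot> k2"
    using RUnit_natural[OF k2] by simp
  also have "\<dots> = (Assoc M (ev P2) (ev E2) (Unit M) \<cdot> RUnit M ?T) \<cdot> k2"
    using Comp_assoc[OF k2 RUnit_in Assoc_in[OF obs Unit_in]] Tens_in obs by simp
  also have "\<dots> = (idt P2 \<otimes> RUnit M (ev E2)) \<cdot> k2"
    using Assoc_RUnit[OF obs] by simp
  finally show ?case
    using spl_unit(2) spl.spl_unit[OF o(2)] by (metis ev.simps(1))
next
  case (spl_node D P E k Q)
  obtain E3 k3 k4 where IH: "spl D P2 E3 k3" "spl E3 E2 E k4"
    "(idt P2 \<otimes> k4) \<cdot> k3 = Assoc M (ev P2) (ev E2) (ev E) \<cdot> (k2 \<otimes> idt E) \<cdot> k"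
    using spl_node.IH[OF spl_node.prems] by blast
  have oQ: "ok Q" and o: "ok P2" "ok E2" "ok E" "ok E3" "ok P"
    and k: "k \<in> hom (ev D) (Tens M (ev P) (ev E))"
    and k2: "k2 \<in> hom (ev P) (Tens M (ev P2) (ev E2))"
    and k3: "k3 \<in> hom (ev D) (Tens M (ev P2) (ev E3))"
    and k4: "k4 \<in> hom (ev E3) (Tens M (ev E2) (ev E))"
    using spl_hom[OF spl_node.hyps(1)] spl_hom[OF spl_node.prems] spl_hom[OF IH(1)] spl_hom[OF IH(2)]
      spl_node.hyps(2) by auto
  let ?p = "ev P2" and ?e2 = "ev E2" and ?e = "ev E" and ?q = "ev Q" and ?e3 = "ev E3"
  let ?T = "Tens M" and ?A = "Assoc M"
  have obs: "?p \<in> Ob M" "?e2 \<in> Ob M" "?e \<in> Ob M" "?q \<in> Ob M" "?e3 \<in> Ob M" "ev P \<in> Ob M"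
    "?T ?p ?e2 \<in> Ob M" "?T ?e ?q \<in> Ob M" "?T ?e2 ?e \<in> Ob M"
    using ev_Ob o oQ Tens_in by auto
  note Q = idt_hom[OF oQ] and Eh = idt_hom[OF o(3)] and p = idt_hom[OF o(1)]
  note kQ = TensA_in[OF k Q] and k2E = TensA_in[OF k2 Eh] and k3Q = TensA_in[OF k3 Q]
    and k4Q = TensA_in[OF k4 Q] and pk4 = TensA_in[OF p k4]
  note k2EQ = TensA_in[OF k2E Q] and k2EQ' = TensA_in[OF k2 TensA_in[OF Eh Q]] and pk4Q = TensA_in[OF pk4 Q]
  note a1 = Assoc_in[OF obs(1,2,3)]
  \<comment> \<open>Naturality of \<alpha> brings \<open>k2\<close> next to \<open>k\<close>, the
    pentagon trades two associators for three, and the induction hypothesis then applies inside the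
    tensor with \<open>idt Q\<close>.\<close>
  have "?A ?p ?e2 (?T ?e ?q) \<cdot> (k2 \<otimes> idt (Node E Q)) \<cdot> ?A (ev P) ?e ?q \<cdot> (k \<otimes> idt Q)
     = ?A ?p ?e2 (?T ?e ?q) \<cdot> ((k2 \<otimes> (idt E \<otimes> idt Q)) \<cdot> ?A (ev P) ?e ?q) \<cdot> (k \<otimes> idt Q)"
    using Comp_assoc[OF kQ Assoc_in[OF obs(6,3,4)] k2EQ'] tens_id[OF o(3) oQ] by simp
  also have "\<dots> = ?A ?p ?e2 (?T ?e ?q) \<cdot> (?A (?T ?p ?e2) ?e ?q \<cdot> ((k2 \<otimes> idt E) \<otimes> idt Q)) \<cdot> (k \<otimes> idt Q)"
    using Assoc_natural[OF k2 Eh Q] by simp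
  also have "\<dots> = ?A ?p ?e2 (?T ?e ?q) \<cdot> ?A (?T ?p ?e2) ?e ?q \<cdot> ((k2 \<otimes> idt E) \<otimes> idt Q) \<cdot> (k \<otimes> idt Q)"
    using Comp_assoc[OF kQ k2EQ Assoc_in[OF obs(7,3,4)]] by simp
  also have "\<dots> = (?A ?p ?e2 (?T ?e ?q) \<cdot> ?A (?T ?p ?e2) ?e ?q) \<cdot> ((k2 \<otimes> idt E) \<cdot> k) \<otimes> idt Q"
    using Comp_assoc[OF TensA_in[OF Comp_in[OF k k2E] Q] Assoc_in[OF obs(7,3,4)] Assoc_in[OF obs(1,2,8)]]
      interchange_id[OF k k2E oQ] by simp
  also have "\<dots> = ((idt P2 \<otimes> ?A ?e2 ?e ?q) \<cdot> ?A ?p (?T ?e2 ?e) ?q \<cdot> (?A ?p ?e2 ?e \<otimes> idt Q))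
      \<cdot> ((k2 \<otimes> idt E) \<cdot> k) \<otimes> idt Q"
    using pentagon[OF obs(1,2,3,4)] by simp
  also have "\<dots> = (idt P2 \<otimes> ?A ?e2 ?e ?q) \<cdot> ?A ?p (?T ?e2 ?e) ?q \<cdot> (?A ?p ?e2 ?e \<otimes> idt Q)
      \<cdot> ((k2 \<otimes> idt E) \<cdot> k) \<otimes> idt Q"
    using Comp_assoc[OF TensA_in[OF Comp_in[OF k k2E] Q] TensA_in[OF a1 Q] Assoc_in[OF obs(1,9,4)]]
      Comp_assoc[OF TensA_in[OF Comp_in[OF k k2E] Q] Comp_in[OF TensA_in[OF a1 Q] Assoc_in[OF obs(1,9,4)]]
        TensA_in[OF p Assoc_in[OF obs(2,3,4)]]] by simp
  also have "\<dots> = (idt P2 \<otimes> ?A ?e2 ?e ?q) \<cdot> ?A ?p (?T ?e2 ?e) ?q \<cdot> ((idt P2 \<otimes> k4) \<otimes> idt Q) \<cdot> (k3 \<otimes> idt Q)"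
    using interchange_id[OF Comp_in[OF k k2E] a1 oQ] interchange_id[OF k3 pk4 oQ] IH(3) by simp
  also have "\<dots> = (idt P2 \<otimes> ?A ?e2 ?e ?q) \<cdot> (?A ?p (?T ?e2 ?e) ?q \<cdot> ((idt P2 \<otimes> k4) \<otimes> idt Q)) \<cdot> (k3 \<otimes> idt Q)"
    using Comp_assoc[OF k3Q pk4Q Assoc_in[OF obs(1,9,4)]] by simp
  also have "\<dots> = (idt P2 \<otimes> ?A ?e2 ?e ?q) \<cdot> ((idt P2 \<otimes> (k4 \<otimes> idt Q)) \<cdot> ?A ?p ?e3 ?q) \<cdot> (k3 \<otimes> idt Q)"
    using Assoc_natural[OF p k4 Q] by simp
  also have "\<dots> = (idt P2 \<otimes> ?A ?e2 ?e ?q) \<cdot> (idt P2 \<otimes> (k4 \<otimes> idt Q)) \<cdot> ?A ?p ?e3 ?q \<cdot> (k3 \<otimes> idt Q)"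
    using Comp_assoc[OF k3Q Assoc_in[OF obs(1,5,4)] TensA_in[OF p k4Q]] by simp
  also have "\<dots> = ((idt P2 \<otimes> ?A ?e2 ?e ?q) \<cdot> (idt P2 \<otimes> (k4 \<otimes> idt Q))) \<cdot> ?A ?p ?e3 ?q \<cdot> (k3 \<otimes> idt Q)"
    using Comp_assoc[OF Comp_in[OF k3Q Assoc_in[OF obs(1,5,4)]] TensA_in[OF p k4Q] TensA_in[OF p Assoc_in[OF obs(2,3,4)]]]
    by simp
  also have "\<dots> = (idt P2 \<otimes> (?A ?e2 ?e ?q \<cdot> (k4 \<otimes> idt Q))) \<cdot> ?A ?p ?e3 ?q \<cdot> (k3 \<otimes> idt Q)"
    using TensA_Comp[OF p p k4Q Assoc_in[OF obs(2,3,4)]] Comp_Ident[OF p] by simp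
  finally show ?case
    using spl.spl_node[OF IH(1) oQ] spl.spl_node[OF IH(2) oQ] by auto
qed

text \<open>The head can be \<open>Unt\<close> only if the leftmost leaf of \<open>D\<close> is that
  unit. The splitting puts a new unit in its place, so the remainder is \<open>D\<close> again, and
  \<lambda> undoes the splitting: \<open>LUnit_RUnit\<close> at the bottom,
  \<open>LUnit_Assoc\<close> at each further node.\<close>

lemma spl_Unt:
  assumes "spl D Unt E k"
  shows "E = D \<and> LUnit M (ev E) \<cdot> k = idt E"
  using assms
proof (induction D "Unt :: 'o tree" E k rule: spl.induct)
  case spl_unit
  then show ?case using LUnit_RUnit by simp
next
  case (spl_node D E k Q)
  have k: "k \<in> hom (ev D) (Tens M (Unit M) (ev E))" and o: "ok E"
    using spl_hom[OF spl_node.hyps(1)] by auto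
  note obs = ev_Ob[OF o] ev_Ob[OF spl_node.hyps(3)] and Q = idt_hom[OF spl_node.hyps(3)]
  have "LUnit M (ev (Node E Q)) \<cdot> Assoc M (ev Unt) (ev E) (ev Q) \<cdot> (k \<otimes> idt Q)
      = (LUnit M (Tens M (ev E) (ev Q)) \<cdot> Assoc M (Unit M) (ev E) (ev Q)) \<cdot> (k \<otimes> idt Q)"
    using Comp_assoc[OF TensA_in[OF k Q] Assoc_in[OF Unit_in obs] LUnit_in] Tens_in obs by simp
  also have "\<dots> = (LUnit M (ev E) \<otimes> idt Q) \<cdot> (k \<otimes> idt Q)"
    using LUnit_Assoc[OF obs] by simp
  also have "\<dots> = idt (Node E Q)"
    using interchange_id[OF k LUnit_in[OF obs(1)] spl_node.hyps(3)] conjunct2[OF spl_node.hyps(2)] tens_id[OF o spl_node.hyps(3)] by simp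
  finally show ?case using spl_node.hyps(2) by simp
qed

section \<open>Closure of normal forms under composition with generators\<close>

lemma focused_NodeE:
  assumes "NF True D (Node B C) f"
  obtains (tens) P f1 E k h
  where "f = (f1 \<otimes> h) \<cdot> k" "NF True P B f1" "spl D P E k" "NF False E C h"
  using assms by (cases rule: NF.cases) auto

lemma focused_LeafE:
  assumes "NF True D (Leaf B) f"
  obtains (leaf) f' A where "D = Leaf A" "f = on_arr G f'" "f' \<in> cat_hom \<X> A B"
  using assms by (cases rule: NF.cases) auto

lemma focused_UntE:
  assumes "NF True D Unt f"
  obtains (unit) "D = Unt" "f = idt Unt"
  using assms by (cases rule: NF.cases) auto

text \<open>Elimination of composition, by induction on the generated arrow on top. After
  \<open>NF_post\<close>, a tensor product as middle object forces \<open>f\<close> to end in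
  \<open>NF_tens\<close>, and the generator acts on the premises of that rule.\<close>

lemma den_NF: "den A B g \<Longrightarrow> NF False D A f \<Longrightarrow> NF False D B (g \<cdot> f)"
proof (induction arbitrary: D f rule: den.induct)
  case (den_id A)
  then show ?case using NF_hom[OF den_id(2)] Ident_Comp[of f "ev D" "ev A"] by simp
next
  case (den_comp A B g C g')
  have "(g' \<cdot> g) \<cdot> f = g' \<cdot> (g \<cdot> f)"
    using Comp_assoc[of f "ev D" "ev A" g "ev B" g' "ev C"] den_hom[OF den_comp(1)] den_hom[OF den_comp(2)]
      NF_hom[OF den_comp.prems] by simp
  then show ?case using den_comp by simp
next
  case (den_tens A B g C E g')
  have g: "g \<in> hom (ev A) (ev B)" "g' \<in> hom (ev C) (ev E)"
    using den_hom den_tens.hyps by blast+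
  show ?case
  proof (rule NF_post[OF den_tens.prems])
    show "g \<otimes> g' \<in> hom (ev (Node A C)) (ev (Node B E))" using TensA_in[OF g] by simp
    fix D f assume "NF True D (Node A C) f"
    then show "NF False D (Node B E) ((g \<otimes> g') \<cdot> f)"
    proof (cases rule: focused_NodeE)
      case tens: (tens P f1 F k h)
      have k: "k \<in> hom (ev D) (Tens M (ev P) (ev F))" and f1: "f1 \<in> hom (ev P) (ev A)" and h: "h \<in> hom (ev F) (ev C)"
        using spl_hom[OF tens(3)] NF_hom[OF tens(2)] NF_hom[OF tens(4)] by auto
      have "(g \<otimes> g') \<cdot> (f1 \<otimes> h) \<cdot> k = ((g \<cdot> f1) \<otimes> (g' \<cdot> h)) \<cdot> k"
        using Comp_assoc[OF k TensA_in[OF f1 h] TensA_in[OF g]] TensA_Comp[OF f1 g(1) h g(2)] by simp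
      then show ?thesis
        using NF_tens_general[OF den_tens.IH(1)[OF NF_switch[OF tens(2)]] tens(3) den_tens.IH(2)[OF tens(4)]] tens(1) by simp
    qed
  qed
next
  case (den_assoc A B C)
  note obs = ev_Ob[OF den_assoc(1)] ev_Ob[OF den_assoc(2)] ev_Ob[OF den_assoc(3)]
  let ?a = "Assoc M (ev A) (ev B) (ev C)"
  have a: "?a \<in> hom (ev (Node (Node A B) C)) (ev (Node A (Node B C)))" using Assoc_in[OF obs] by simp
  show ?case
  proof (rule NF_post[OF den_assoc.prems a])
    fix D f assume "NF True D (Node (Node A B) C) f"
    then show "NF False D (Node A (Node B C)) (?a \<cdot> f)"
    proof (cases rule: focused_NodeE)
      case tens: (tens P f1 E k h)
      from tens(2) show ?thesis
      proof (cases rule: focused_NodeE)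
        case inner: (tens P2 f2 E2 k2 h2)
        \<comment> \<open>The source is split at the end of \<open>A \<otimes> B\<close> and its
          head again at the end of \<open>A\<close>. The new target asks for the opposite
          order.\<close>
        obtain E3 k3 k4 where s: "spl D P2 E3 k3" "spl E3 E2 E k4"
          and eq: "(idt P2 \<otimes> k4) \<cdot> k3 = Assoc M (ev P2) (ev E2) (ev E) \<cdot> (k2 \<otimes> idt E) \<cdot> k"
          using spl_spl[OF tens(3) inner(3)] by blast
        have k: "k \<in> hom (ev D) (Tens M (ev P) (ev E))" "k2 \<in> hom (ev P) (Tens M (ev P2) (ev E2))"
            "k3 \<in> hom (ev D) (Tens M (ev P2) (ev E3))" "k4 \<in> hom (ev E3) (Tens M (ev E2) (ev E))"
          and o: "ok E" "ok P2" "ok E2"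
          using spl_hom[OF tens(3)] spl_hom[OF inner(3)] spl_hom[OF s(1)] spl_hom[OF s(2)] by auto
        have h: "f2 \<in> hom (ev P2) (ev A)" "h2 \<in> hom (ev E2) (ev B)" "h \<in> hom (ev E) (ev C)"
          using NF_hom[OF inner(2)] NF_hom[OF inner(4)] NF_hom[OF tens(4)] by auto
        note E = idt_hom[OF o(1)] and P2 = idt_hom[OF o(2)]
        note fh = TensA_in[OF h(1,2)]
        have "f = (((f2 \<otimes> h2) \<otimes> h) \<cdot> (k2 \<otimes> idt E)) \<cdot> k"
          using TensA_Comp[OF k(2) fh E h(3)] Comp_Ident[OF h(3)] tens(1) inner(1) by simp
        also have "\<dots> = ((f2 \<otimes> h2) \<otimes> h) \<cdot> (k2 \<otimes> idt E) \<cdot> k"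
          using Comp_assoc[OF k(1) TensA_in[OF k(2) E] TensA_in[OF fh h(3)]] .
        finally have "?a \<cdot> f = (?a \<cdot> ((f2 \<otimes> h2) \<otimes> h)) \<cdot> (k2 \<otimes> idt E) \<cdot> k"
          using Comp_assoc[OF Comp_in[OF k(1) TensA_in[OF k(2) E]] TensA_in[OF fh h(3)] Assoc_in[OF obs]] by simp
        also have "\<dots> = ((f2 \<otimes> (h2 \<otimes> h)) \<cdot> Assoc M (ev P2) (ev E2) (ev E)) \<cdot> (k2 \<otimes> idt E) \<cdot> k"
          using Assoc_natural[OF h] by simp
        also have "\<dots> = (f2 \<otimes> (h2 \<otimes> h)) \<cdot> (idt P2 \<otimes> k4) \<cdot> k3"
          using Comp_assoc[OF Comp_in[OF k(1) TensA_in[OF k(2) E]] Assoc_in TensA_in[OF h(1) TensA_in[OF h(2,3)]]]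
            ev_Ob o eq by simp
        also have "\<dots> = (f2 \<otimes> ((h2 \<otimes> h) \<cdot> k4)) \<cdot> k3"
          using Comp_assoc[OF k(3) TensA_in[OF P2 k(4)] TensA_in[OF h(1) TensA_in[OF h(2,3)]]]
            TensA_Comp[OF P2 h(1) k(4) TensA_in[OF h(2,3)]] Comp_Ident[OF h(1)] by simp
        finally show ?thesis
          using NF_switch[OF NF_tens[OF inner(2) s(1) NF_tens_general[OF inner(4) s(2) tens(4)]]] by simp
      qed
    qed
  qed
next
  case (den_lunit A)
  note oA = ev_Ob[OF den_lunit(1)]
  show ?case
  proof (rule NF_post[OF den_lunit.prems])
    show "LUnit M (ev A) \<in> hom (ev (Node Unt A)) (ev A)" using LUnit_in[OF oA] by simp
    fix D f assume "NF True D (Node Unt A) f"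
    then show "NF False D A (LUnit M (ev A) \<cdot> f)"
    proof (cases rule: focused_NodeE)
      case tens: (tens P f1 E k h)
      \<comment> \<open>A focused form into \<open>Unt\<close> is an identity, so the head is a
        unit; \<lambda> cancels against the splitting and only \<open>h\<close> remains.\<close>
      have P: "P = Unt" "f1 = idt Unt" using tens(2) by (auto elim: focused_UntE)
      then have E: "E = D" "LUnit M (ev E) \<cdot> k = idt E" using spl_Unt tens(3) by auto
      have k: "k \<in> hom (ev D) (Tens M (Unit M) (ev E))" and h: "h \<in> hom (ev E) (ev A)" and o: "ok E"
        using spl_hom[OF tens(3)] NF_hom[OF tens(4)] P by auto
      note I = Ident_in[OF Unit_in]
      have "LUnit M (ev A) \<cdot> f = (LUnit M (ev A) \<cdot> (Ident M (Unit M) \<otimes> h)) \<cdot> k"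
        using Comp_assoc[OF k TensA_in[OF I h] LUnit_in[OF oA]] tens(1) P by simp
      also have "\<dots> = (h \<cdot> LUnit M (ev E)) \<cdot> k" using LUnit_natural[OF h] by simp
      also have "\<dots> = h"
        using Comp_assoc[OF k LUnit_in[OF ev_Ob[OF o]] h] E Comp_Ident[OF h] by simp
      finally show ?thesis using tens(4) E by simp
    qed
  qed
next
  case (den_runit A)
  have o: "ok D" and f: "f \<in> hom (ev D) (ev A)" using NF_hom[OF den_runit(2)] by auto
  \<comment> \<open>By naturality, \<rho> moves to the source, where it is the trivial splitting
    with remainder \<open>Unt\<close>.\<close>
  have "RUnit M (ev A) \<cdot> f = (f \<otimes> idt Unt) \<cdot> RUnit M (ev D)"
    using RUnit_natural[OF f] by simp
  then show ?case using NF_tens_general[OF den_runit(2) spl_unit[OF o] NF_switch[OF NF_unit]] by simp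
next
  case (den_leaf g A B)
  show ?case
  proof (rule NF_post[OF den_leaf.prems])
    show "on_arr G g \<in> hom (ev (Leaf A)) (ev (Leaf B))" using is_functor_hom[OF G den_leaf(1)] by simp
    fix D f assume "NF True D (Leaf A) f"
    then show "NF False D (Leaf B) (on_arr G g \<cdot> f)"
    proof (cases rule: focused_LeafE)
      case leaf: (leaf f' A')
      then show ?thesis
        using NF_switch[OF NF_leaf[OF X.Comp_in[OF _ den_leaf(1)]]] is_functor_Comp[OF G _ den_leaf(1)] leaf by simp
    qed
  qed
qed

text \<open>Splitting \<open>Node A C\<close> at \<open>A\<close> leaves the remainder
  \<open>Node Unt C\<close>. The inserted unit is contracted again before \<open>h\<close>, and
  \<open>LUnit_Assoc_RUnit\<close> says that insertion and contraction cancel.\<close>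

lemma NF_tensor:
  assumes f: "NF False A B f" and h: "NF False C E h"
  shows "NF False (Node A C) (Node B E) (f \<otimes> h)"
proof -
  have f': "f \<in> hom (ev A) (ev B)" "h \<in> hom (ev C) (ev E)" and o: "ok A" "ok C"
    using NF_hom f h by blast+
  note obs = ev_Ob[OF o(1)] ev_Ob[OF o(2)]
  note C = idt_hom[OF o(2)] and A = idt_hom[OF o(1)]
  let ?k = "Assoc M (ev A) (ev Unt) (ev C) \<cdot> (RUnit M (ev A) \<otimes> idt C)"
  note k = Comp_in[OF TensA_in[OF RUnit_in[OF obs(1)] C] Assoc_in[OF obs(1) Unit_in obs(2)]]
  have "(f \<otimes> (h \<cdot> LUnit M (ev C))) \<cdot> ?k = ((f \<otimes> h) \<cdot> (idt A \<otimes> LUnit M (ev C))) \<cdot> ?k"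
    using TensA_Comp[OF A f'(1) LUnit_in[OF obs(2)] f'(2)] Comp_Ident[OF f'(1)] by simp
  also have "\<dots> = (f \<otimes> h) \<cdot> idt (Node A C)"
    using Comp_assoc[OF k TensA_in[OF A LUnit_in[OF obs(2)]] TensA_in[OF f']] LUnit_Assoc_RUnit[OF obs] by simp
  also have "\<dots> = f \<otimes> h" using Comp_Ident[OF TensA_in[OF f']] by simp
  finally show ?thesis
    using NF_tens_general[OF f spl_node[OF spl_unit[OF o(1)] o(2)] NF_pass[OF lstep_unit[OF o(2)] h]] by simp
qed

lemma NF_idt: "ok A \<Longrightarrow> NF False A A (idt A)"
proof (induction A)
  case Unt
  then show ?case using NF_switch[OF NF_unit] by simp
next
  case (Leaf A)
  then show ?case using NF_switch[OF NF_leaf[OF X.Ident_in]] is_functor_Ident[OF G] by simp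
next
  case (Node A B)
  then show ?case using NF_tensor[of A A "idt A" B B "idt B"] tens_id by simp
qed

lemma NF_iff_den: "NF False A B f \<longleftrightarrow> den A B f"
proof
  assume "den A B f"
  then show "NF False A B f"
    using den_NF[OF _ NF_idt] den_hom Comp_Ident by metis
qed (rule NF_den)

end

section \<open>The morphisms of Fsk\<close>

text \<open>The condition \<open>\<phi> j \<le> k < \<phi> (Suc j)\<close> says that the right
  adjoint of \<phi> sends \<open>k\<close> to \<open>j\<close>, so the last clause is the inequality
  \<open>\<phi> S \<phi>\<^sup>* \<le> T\<close>. It leaves out \<open>j = m - 1\<close>, where
  \<open>S j = j\<close> is a convention.\<close>

definition skew_map :: "fsk_ob \<Rightarrow> fsk_ob \<Rightarrow> (nat \<Rightarrow> nat) \<Rightarrow> bool" where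
  "skew_map = (\<lambda>(m, u, S) (n, v, T) \<phi>.
     \<phi> \<in> {..<m} \<rightarrow>\<^sub>E {..<n} \<and> mono_on {..<m} \<phi> \<and> \<phi> 0 = 0 \<and> \<phi> ` u = v \<and>
     (\<forall>i\<in>u. Suc i < m \<longrightarrow> \<phi> i < \<phi> (Suc i)) \<and>
     (\<forall>j k. Suc j < m \<longrightarrow> \<phi> j \<le> k \<longrightarrow> k < \<phi> (Suc j) \<longrightarrow> \<phi> (S j) \<le> T k))"

section \<open>Inequalities for bracketing functions and right adjoints\<close>

lemma TamD:
  assumes "l \<in> Tam m"
  shows "j < m \<Longrightarrow> l j < m" "j < m \<Longrightarrow> l j \<le> j"
    "\<lbrakk>j < m; l j \<le> i; i \<le> j\<rbrakk> \<Longrightarrow> l j \<le> l i" "l (m - 1) = m - 1"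
  using assms unfolding Tam_def by (auto simp: PiE_def Pi_def)

text \<open>Turns the minimum in \<open>rbf\<close> into an existence statement, so that right
  bracketing functions can be compared through bounds. The disjunct \<open>m - 1 \<le> k\<close>
  absorbs the default value; the top index is never a witness, since
  \<open>l (m - 1) = m - 1\<close>.\<close>

lemma rbf_le_iff:
  assumes l: "l \<in> Tam m" and i: "0 < i" "i < m"
  shows "rbf m l i \<le> k \<longleftrightarrow> m - 1 \<le> k \<or> (\<exists>j\<le>k. i \<le> j \<and> j < m \<and> l j < i)"
proof (cases "i < m - 1")
  case False
  then have "i = m - 1" using i by simp
  moreover have "j = m - 1" if "m - 1 \<le> j" "j < m" for j using that by simp
  ultimately show ?thesis using TamD(4)[OF l] i by (auto simp: rbf_def)
next
  case True
  define K where "K = {j. j < m \<and> l j < i \<and> i \<le> j}"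
  have fin: "finite K" unfolding K_def by auto
  have K: "j < m - 1" if "j \<in> K" for j
    using that TamD(4)[OF l] by (cases "j = m - 1") (auto simp: K_def)
  have r: "rbf m l i = (if K = {} then m - 1 else Min K)"
    using True i unfolding rbf_def K_def Let_def by simp
  show ?thesis
  proof (cases "K = {}")
    case True
    then have "\<not> (\<exists>j\<le>k. i \<le> j \<and> j < m \<and> l j < i)" by (auto simp: K_def)
    then show ?thesis using r True by auto
  next
    case False
    then have "Min K \<le> k \<longleftrightarrow> (\<exists>j\<in>K. j \<le> k)" using fin by (simp add: Min_le_iff)
    moreover have "Min K < m - 1" using K fin False by simp
    ultimately show ?thesis using r False by (auto simp: K_def)
  qed
qed

lemma rbf_less: "\<lbrakk>l \<in> Tam m; i < m\<rbrakk> \<Longrightarrow> rbf m l i < m"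
  using rbf_le_iff[of l m i "m - 1"] by (cases "i = 0") (auto simp: rbf_def)

text \<open>The adjunction. By \<open>f 0 = 0\<close> the set under \<open>Max\<close> contains
  \<open>0\<close>, so \<open>Max\<close> is a genuine value.\<close>

lemma radj:
  assumes "mono_on {..<m} f" "f 0 = 0" "0 < m"
  shows radj_less: "radj m f j < m" and le_radj_iff: "i < m \<Longrightarrow> i \<le> radj m f j \<longleftrightarrow> f i \<le> j"
proof -
  let ?A = "{i. i < m \<and> f i \<le> j}"
  have fin: "finite ?A" and ne: "0 \<in> ?A" using assms by auto
  then have M: "radj m f j \<in> ?A" unfolding radj_def by (intro Max_in) auto
  then show "radj m f j < m" by simp
  assume i: "i < m"
  show "i \<le> radj m f j \<longleftrightarrow> f i \<le> j"
  proof
    assume "i \<le> radj m f j"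
    then have "f i \<le> f (radj m f j)" using M i assms(1) by (auto simp: mono_on_def)
    then show "f i \<le> j" using M by simp
  next
    assume "f i \<le> j"
    then show "i \<le> radj m f j" unfolding radj_def using i fin by (intro Max_ge) auto
  qed
qed

lemma radj_eqI:
  assumes "mono_on {..<m} f" "f 0 = 0" "i < m" "f i \<le> j" "Suc i < m \<Longrightarrow> j < f (Suc i)"
  shows "radj m f j = i"
proof -
  have "0 < m" using assms(3) by simp
  note r = radj_less[OF assms(1,2) this] le_radj_iff[OF assms(1,2) this]
  have "i \<le> radj m f j" using r(2)[OF assms(3)] assms(4) by simp
  moreover have "\<not> Suc i \<le> radj m f j"
    using r(2)[of "Suc i" j] r(1)[of j] assms(5) by (meson le_less_trans not_le)
  ultimately show ?thesis by simp
qed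

lemma ord_surj_0: "ord_surj m n \<sigma> \<Longrightarrow> 0 < n \<Longrightarrow> \<sigma> 0 = 0 \<and> 0 < m"
proof -
  assume s: "ord_surj m n \<sigma>" and n: "0 < n"
  then have "0 \<in> \<sigma> ` {..<m}" unfolding ord_surj_def by simp
  then obtain i where i: "i < m" "\<sigma> i = 0" by auto
  then have "\<sigma> 0 \<le> \<sigma> i" using s i mono_onD[of "{..<m}" \<sigma> 0 i] unfolding ord_surj_def by simp
  with i show ?thesis by auto
qed

lemma radj_surj:
  assumes "ord_surj m n \<sigma>" "k < n"
  shows "\<sigma> (radj m \<sigma> k) = k"
proof -
  have z: "\<sigma> 0 = 0" "0 < m" and mono: "mono_on {..<m} \<sigma>"
    using ord_surj_0[OF assms(1)] assms(2) assms(1) by (auto simp: ord_surj_def)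
  note r = radj_less[OF mono z] le_radj_iff[OF mono z]
  have "k \<in> \<sigma> ` {..<m}" using assms unfolding ord_surj_def by simp
  then obtain i where i: "i < m" "\<sigma> i = k" by auto
  have "i \<le> radj m \<sigma> k" using r(2)[OF i(1)] i(2) by simp
  then have "k \<le> \<sigma> (radj m \<sigma> k)" using mono i r(1) by (auto simp: mono_on_def)
  moreover have "\<sigma> (radj m \<sigma> k) \<le> k" using r(1)[of k] r(2)[of "radj m \<sigma> k" k] by simp
  ultimately show ?thesis by simp
qed

text \<open>The bracketing inequalities compose: \<open>\<psi> \<phi> S \<phi>\<^sup>*
  \<psi>\<^sup>* \<le> \<psi> T \<psi>\<^sup>* \<le> R\<close>.\<close>

lemma skew_map_comp:
  assumes f: "skew_map (m, u, S) (n, v, T) \<phi>" and g: "skew_map (n, v, T) (p, w, R) \<psi>"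
    and S: "S \<in> Tam m" and T: "T \<in> Tam n" and u: "u \<subseteq> {..<m}" and v: "v \<subseteq> {..<n}"
  shows "skew_map (m, u, S) (p, w, R) (compose {..<m} \<psi> \<phi>)"
proof (cases "m = 0")
  case True
  then show ?thesis using assms by (auto simp: skew_map_def compose_def)
next
  case False
  let ?c = "compose {..<m} \<psi> \<phi>"
  have f': "\<And>i. i < m \<Longrightarrow> \<phi> i < n" "\<And>i j. \<lbrakk>i \<le> j; j < m\<rbrakk> \<Longrightarrow> \<phi> i \<le> \<phi> j"
    "\<phi> 0 = 0" "\<phi> ` u = v" "\<And>i. \<lbrakk>i \<in> u; Suc i < m\<rbrakk> \<Longrightarrow> \<phi> i < \<phi> (Suc i)"
    "\<And>j k. \<lbrakk>Suc j < m; \<phi> j \<le> k; k < \<phi> (Suc j)\<rbrakk> \<Longrightarrow> \<phi> (S j) \<le> T k"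
    using f by (auto simp: skew_map_def PiE_def Pi_def mono_on_def)
  have g': "\<And>i. i < n \<Longrightarrow> \<psi> i < p" "\<And>i j. \<lbrakk>i \<le> j; j < n\<rbrakk> \<Longrightarrow> \<psi> i \<le> \<psi> j"
    "\<psi> 0 = 0" "\<psi> ` v = w" "\<And>i. \<lbrakk>i \<in> v; Suc i < n\<rbrakk> \<Longrightarrow> \<psi> i < \<psi> (Suc i)"
    "\<And>j k. \<lbrakk>Suc j < n; \<psi> j \<le> k; k < \<psi> (Suc j)\<rbrakk> \<Longrightarrow> \<psi> (T j) \<le> R k"
    using g by (auto simp: skew_map_def PiE_def Pi_def mono_on_def)
  have n: "0 < n" using f'(1)[of 0] False by simp
  have monoc: "mono_on {..<n} \<psi>" using g by (auto simp: skew_map_def)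
  have c: "?c i = \<psi> (\<phi> i)" if "i < m" for i using that by (simp add: compose_def)
  show ?thesis unfolding skew_map_def case_prod_conv
  proof (intro conjI allI impI ballI)
    show "?c \<in> {..<m} \<rightarrow>\<^sub>E {..<p}" using f'(1) g'(1) by (auto simp: compose_def)
    show "mono_on {..<m} ?c" using f'(1,2) g'(2) c by (auto simp: mono_on_def)
    show "?c 0 = 0" using f'(3) g'(3) False by (simp add: compose_def)
    have "?c ` u = (\<lambda>i. \<psi> (\<phi> i)) ` u" using u c by (intro image_cong) auto
    then show "?c ` u = w" using f'(4) g'(4) by (simp add: image_image[symmetric])
  next
    fix i assume i: "i \<in> u" "Suc i < m"
    have "\<phi> i < \<phi> (Suc i)" "\<phi> (Suc i) < n" "\<phi> i \<in> v" using f' i by auto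
    then have "\<psi> (\<phi> i) < \<psi> (Suc (\<phi> i))" "\<psi> (Suc (\<phi> i)) \<le> \<psi> (\<phi> (Suc i))"
      using g'(5)[of "\<phi> i"] g'(2)[of "Suc (\<phi> i)" "\<phi> (Suc i)"] by auto
    then show "?c i < ?c (Suc i)" using i c by simp
  next
    fix j k assume j: "Suc j < m" "?c j \<le> k" "k < ?c (Suc j)"
    \<comment> \<open>The adjunction places \<open>?q\<close> between \<open>\<phi> j\<close> and
      \<open>\<phi> (Suc j)\<close>, hence below the top of \<open>n\<close>, so both bracketing
      clauses apply.\<close>
    let ?q = "radj n \<psi> k"
    note r = radj_less[OF monoc g'(3) n] le_radj_iff[OF monoc g'(3) n]
    have a: "\<phi> j \<le> ?q" using j c r(2)[of "\<phi> j" k] f'(1)[of j] by simp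
    have b: "?q < \<phi> (Suc j)" using j c r(2)[of "\<phi> (Suc j)" k] f'(1)[of "Suc j"] by simp
    then have q: "Suc ?q < n" using f'(1)[of "Suc j"] j by simp
    have "\<phi> (S j) \<le> T ?q" using f'(6)[OF j(1) a b] .
    then have "\<psi> (\<phi> (S j)) \<le> \<psi> (T ?q)" using g'(2) TamD(1)[OF T] q by simp
    also have "\<dots> \<le> R k"
    proof (rule g'(6)[OF q])
      show "\<psi> ?q \<le> k" using r(1)[of k] r(2)[of ?q k] by simp
      show "k < \<psi> (Suc ?q)" using r(2)[OF q, of k] by simp
    qed
    finally show "?c (S j) \<le> R k" using c TamD(1)[OF S, of j] j by simp
  qed
qed

text \<open>A shrink morphism satisfies \<open>T = \<sigma> L \<sigma>\<^sup>*\<close>, and passing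
  from \<open>L\<close> down to \<open>S\<close> leaves an inequality. The elements of
  \<open>u\<close> are values of the right adjoint, that is, greatest elements of fibres.\<close>

lemma skew_map_if_Fsk_surj:
  assumes "Fsk_surj (m, u, S) (n, v, T) \<sigma>" "S \<in> Tam m" "T \<in> Tam n" "1 \<le> n" "u \<subseteq> {..<m}" "v \<subseteq> {..<n}"
  shows "skew_map (m, u, S) (n, v, T) \<sigma>"
proof -
  obtain L where L: "L \<in> Tam m" "Tam_le m S L" and s: "ord_surj m n \<sigma>"
    and b: "bij_betw (radj m \<sigma>) v u" and T: "\<And>j. j < n \<Longrightarrow> T j = \<sigma> (L (radj m \<sigma> j))"
    using assms(1) by auto
  have z: "\<sigma> 0 = 0" "0 < m" using ord_surj_0[OF s] assms(4) by auto
  have mono: "mono_on {..<m} \<sigma>" and ex: "\<sigma> \<in> {..<m} \<rightarrow>\<^sub>E {..<n}" using s by (auto simp: ord_surj_def)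
  have u: "u = radj m \<sigma> ` v" using b by (simp add: bij_betw_def)
  show ?thesis unfolding skew_map_def case_prod_conv
  proof (intro conjI allI impI ballI mono ex z(1))
    show "\<sigma> ` u = v" unfolding u image_image using radj_surj[OF s] assms(6) by force
  next
    fix i assume i: "i \<in> u" "Suc i < m"
    then obtain k where k: "k \<in> v" "i = radj m \<sigma> k" using u by auto
    then have "\<sigma> i = k" using radj_surj[OF s] assms(6) by auto
    then show "\<sigma> i < \<sigma> (Suc i)" using le_radj_iff[OF mono z i(2), of k] k by simp
  next
    fix j k assume j: "Suc j < m" "\<sigma> j \<le> k" "k < \<sigma> (Suc j)"
    have r: "radj m \<sigma> k = j" using j by (intro radj_eqI mono z) auto
    have k: "k < n" using j ex by (fastforce simp: PiE_def Pi_def)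
    have "S j \<le> L j" "L j < m" using L j TamD[OF L(1)] by (auto simp: Tam_le_def)
    then have "\<sigma> (S j) \<le> \<sigma> (L j)" using mono by (auto simp: mono_on_def)
    then show "\<sigma> (S j) \<le> T k" using T[OF k] r by simp
  qed
qed

lemma skew_map_if_Fsk_inj:
  assumes "Fsk_inj (n, v, T) (m, u, S) \<delta>" "S \<in> Tam m" "T \<in> Tam n" "1 \<le> n" "u \<subseteq> {..<m}" "v \<subseteq> {..<n}"
  shows "skew_map (n, v, T) (m, u, S) \<delta>"
proof -
  obtain S' where S': "S' \<in> Tam m" "Tam_le m S' S" and d: "ord_inj0 n m \<delta>" and b: "bij_betw \<delta> v u"
    and T: "\<And>j. j < n \<Longrightarrow> rbf n T j = radj n \<delta> (rbf m S' (\<delta> j))"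
    using assms(1) by auto
  have mono: "mono_on {..<n} \<delta>" and ex: "\<delta> \<in> {..<n} \<rightarrow>\<^sub>E {..<m}" and z: "\<delta> 0 = 0" "0 < n"
    and inj: "inj_on \<delta> {..<n}"
    using d assms by (auto simp: ord_inj0_def)
  have monoD': "\<delta> i \<le> \<delta> j" if "i \<le> j" "j < n" for i j
    using mono that by (auto simp: mono_on_def)
  have str: "\<delta> i < \<delta> j" if "i < j" "j < n" for i j
  proof -
    have "\<delta> i \<le> \<delta> j" using mono that by (auto simp: mono_on_def)
    moreover have "\<delta> i \<noteq> \<delta> j" using inj that by (auto simp: inj_on_def)
    ultimately show ?thesis by simp
  qed
  show ?thesis unfolding skew_map_def case_prod_conv
  proof (intro conjI allI impI ballI mono ex z(1))
    show "\<delta> ` v = u" using b by (simp add: bij_betw_def)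
    show "\<delta> i < \<delta> (Suc i)" if "Suc i < n" for i using str that by simp
  next
    fix j k assume j: "Suc j < n" "\<delta> j \<le> k" "k < \<delta> (Suc j)"
    have k: "k < m" using j ex by (fastforce simp: PiE_def Pi_def)
    have i: "T j \<le> j" using TamD(2)[OF assms(3)] j by simp
    then have \<delta>i: "\<delta> (T j) \<le> k" "\<delta> (T j) < m"
      using monoD'[of "T j" j] ex j i by (auto simp: PiE_def Pi_def)
    \<comment> \<open>The swell conditions speak of right bracketing. Were \<open>S' k\<close>
      smaller, \<open>k\<close> would witness \<open>rbf m S' (\<delta> (T j)) \<le> k\<close>,
      whence \<open>rbf n T (T j) \<le> j\<close>. The witness \<open>j'\<close> of the latter lies
      between \<open>T j\<close> and \<open>j\<close> but has \<open>T j' < T j\<close>, against the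
      nesting condition on \<open>T\<close>.\<close>
    have "\<delta> (T j) \<le> S' k"
    proof (rule ccontr)
      assume lt: "\<not> \<delta> (T j) \<le> S' k"
      then have i0: "0 < T j" using z by (cases "T j") auto
      have "0 < \<delta> (T j)" using lt by simp
      then have "rbf m S' (\<delta> (T j)) \<le> k"
        using rbf_le_iff[OF S'(1) _ \<delta>i(2), of k] lt \<delta>i k not_le by blast
      then have "\<not> Suc j \<le> radj n \<delta> (rbf m S' (\<delta> (T j)))"
        using le_radj_iff[OF mono z j(1)] j by simp
      then have "rbf n T (T j) \<le> j" using T[of "T j"] i j by simp
      then obtain j' where "j' \<le> j" "T j \<le> j'" "T j' < T j"
        using rbf_le_iff[OF assms(3) i0, of j] i j by auto
      then show False using TamD(3)[OF assms(3), of j j'] j by simp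
    qed
    then show "\<delta> (T j) \<le> S k" using S'(2) k unfolding Tam_le_def using le_trans by blast
  qed
qed


text \<open>The surjective half of an image factorization: values are renumbered consecutively by
  counting the changes of value up to the index.\<close>

primrec rank :: "(nat \<Rightarrow> nat) \<Rightarrow> nat \<Rightarrow> nat" where
  "rank f 0 = 0"
| "rank f (Suc i) = (if f (Suc i) = f i then rank f i else Suc (rank f i))"

lemma rank_mono:
  assumes "mono_on {..<m} f" "i \<le> j" "j < m"
  shows "rank f i \<le> rank f j \<and> (rank f i = rank f j \<longleftrightarrow> f i = f j)"
  using assms(2,3)
proof (induction j rule: dec_induct)
  case (step k)
  then have "f i \<le> f k" "f k \<le> f (Suc k)"
    by (auto intro!: mono_onD[OF assms(1)])
  then show ?case using step by auto
qed simp

lemma rank_less_iff: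
  assumes "mono_on {..<m} f" "i < m" "j < m"
  shows "rank f i < rank f j \<longleftrightarrow> f i < f j"
proof (cases "i \<le> j")
  case True
  then show ?thesis using rank_mono[OF assms(1) True assms(3)] mono_onD[OF assms(1), of i j] assms by auto
next
  case False
  then show ?thesis using rank_mono[OF assms(1), of j i] mono_onD[OF assms(1), of j i] assms by auto
qed

lemma rank_surj: "k \<le> rank f i \<Longrightarrow> \<exists>j\<le>i. rank f j = k"
  by (induction i) (auto split: if_splits simp: le_Suc_eq)

text \<open>For the image factorization \<open>\<phi> = \<delta> \<sigma>\<close>, the structure \<open>R\<close> on the image is transported along \<open>\<sigma>\<close>
  from \<open>S\<close>. In \<open>L\<close>, the values of \<open>S\<close> on each fibre are raised to its least element, except at the
  greatest element of the fibre; in \<open>T'\<close>, the values of \<open>T\<close> are lowered to those of \<open>\<delta> R \<delta>\<^sup>*\<close>,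
  and to \<open>0\<close> beyond the image.\<close>

lemma Fsk_hom_if_skew_map:
  assumes f: "skew_map (m, u, S) (n, v, T) \<phi>" and A: "(m, u, S) \<in> Fsk_Ob" and B: "(n, v, T) \<in> Fsk_Ob"
  shows "\<phi> \<in> Fsk_hom (m, u, S) (n, v, T)"
proof -
  have m: "0 < m" and u: "u \<subseteq> {..<m}" and S: "S \<in> Tam m" and n: "0 < n" and v: "v \<subseteq> {..<n}" and T: "T \<in> Tam n"
    using A B by (auto simp: Fsk_Ob_def)
  have ex: "\<phi> \<in> {..<m} \<rightarrow>\<^sub>E {..<n}" and mono: "mono_on {..<m} \<phi>" and \<phi>0: "\<phi> 0 = 0" and im: "\<phi> ` u = v"
    and last: "\<And>i. \<lbrakk>i \<in> u; Suc i < m\<rbrakk> \<Longrightarrow> \<phi> i < \<phi> (Suc i)"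
    and br: "\<And>j k. \<lbrakk>Suc j < m; \<phi> j \<le> k; k < \<phi> (Suc j)\<rbrakk> \<Longrightarrow> \<phi> (S j) \<le> T k"
    using f by (auto simp: skew_map_def)
  have rng: "\<phi> i < n" if "i < m" for i using ex that by auto
  have mon: "\<phi> i \<le> \<phi> j" if "i \<le> j" "j < m" for i j using mono that by (auto simp: mono_on_def)
  define p where "p = Suc (rank \<phi> (m - 1))"
  define \<sigma> where "\<sigma> = restrict (rank \<phi>) {..<m}"
  define s where "s = radj m \<sigma>"
  define \<delta> where "\<delta> = (\<lambda>k\<in>{..<p}. \<phi> (s k))"
  define d where "d = radj p \<delta>"
  define R where "R = (\<lambda>k\<in>{..<p}. \<sigma> (S (s k)))"
  define L where "L = (\<lambda>j\<in>{..<m}. if Suc j < m \<and> \<phi> (Suc j) = \<phi> j then max (S j) (LEAST i. \<phi> i = \<phi> j) else S j)"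
  define T' where "T' = (\<lambda>k\<in>{..<n}. if d k < p - 1 then \<delta> (R (d k)) else if k = n - 1 then n - 1 else 0)"
  have \<sigma>_less: "\<sigma> i < \<sigma> j \<longleftrightarrow> \<phi> i < \<phi> j" if "i < m" "j < m" for i j
    using rank_less_iff[OF mono that] that by (simp add: \<sigma>_def)
  have \<sigma>_le: "\<sigma> i \<le> \<sigma> j \<longleftrightarrow> \<phi> i \<le> \<phi> j" if "i < m" "j < m" for i j
    using \<sigma>_less[OF that(2,1)] by (simp add: not_less[symmetric])
  have \<sigma>_eq: "\<sigma> i = \<sigma> j \<longleftrightarrow> \<phi> i = \<phi> j" if "i < m" "j < m" for i j
    using \<sigma>_le[OF that] \<sigma>_le[OF that(2,1)] by (simp add: order_eq_iff)
  have \<sigma>_rng: "\<sigma> i < p" if "i < m" for i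
    using rank_mono[OF mono, of i "m - 1"] that m by (simp add: \<sigma>_def p_def le_imp_less_Suc)
  have \<sigma>_mono: "mono_on {..<m} \<sigma>" using \<sigma>_le mon by (auto simp: mono_on_def)
  have \<sigma>0: "\<sigma> 0 = 0" using m by (simp add: \<sigma>_def)
  have "k \<in> \<sigma> ` {..<m}" if k: "k < p" for k
  proof -
    obtain j where "j \<le> m - 1" "rank \<phi> j = k" using rank_surj[of k \<phi> "m - 1"] k
      unfolding p_def less_Suc_eq_le by blast
    then show ?thesis using m by (intro image_eqI[of _ _ j]) (auto simp: \<sigma>_def)
  qed
  then have \<sigma>_surj: "ord_surj m p \<sigma>"
    unfolding ord_surj_def using \<sigma>_rng \<sigma>_mono by (auto simp: \<sigma>_def)
  have s_rng: "s k < m" for k unfolding s_def by (rule radj_less[OF \<sigma>_mono \<sigma>0 m])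
  have le_s: "i \<le> s k \<longleftrightarrow> \<sigma> i \<le> k" if "i < m" for i k
    unfolding s_def by (rule le_radj_iff[OF \<sigma>_mono \<sigma>0 m that])
  have \<sigma>s: "\<sigma> (s k) = k" if "k < p" for k
    unfolding s_def by (rule radj_surj[OF \<sigma>_surj that])
  have s_mono: "s k \<le> s k'" if "k \<le> k'" "k' < p" for k k'
    using le_s[OF s_rng, of k k'] \<sigma>s that by simp
  have p: "0 < p" by (simp add: p_def)
  have s_last: "s (p - 1) = m - 1"
    using le_s[of "m - 1" "p - 1"] \<sigma>_rng[of "m - 1"] m s_rng[of "p - 1"] by arith
  have \<delta>\<sigma>: "\<delta> (\<sigma> i) = \<phi> i" if "i < m" for i
    using \<sigma>_rng[OF that] \<sigma>_eq[OF s_rng that, of "\<sigma> i"] \<sigma>s[OF \<sigma>_rng[OF that]] by (simp add: \<delta>_def)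
  have \<delta>_less: "\<delta> k < \<delta> k'" if "k < k'" "k' < p" for k k'
    using \<sigma>_less[OF s_rng s_rng, of k k'] \<sigma>s that by (simp add: \<delta>_def)
  have \<delta>_mono: "\<delta> k \<le> \<delta> k'" if "k \<le> k'" "k' < p" for k k'
    using \<delta>_less[of k k'] that by (cases "k = k'") auto
  have \<delta>_mono_on: "mono_on {..<p} \<delta>" using \<delta>_mono by (auto simp: mono_on_def)
  have \<delta>_inj: "inj_on \<delta> {..<p}"
    by (rule linorder_inj_onI) (use \<delta>_less in \<open>auto simp: less_le\<close>)
  have \<delta>_le: "\<delta> k \<le> \<delta> k' \<longleftrightarrow> k \<le> k'" if "k < p" "k' < p" for k k'
    using \<delta>_mono[of k k'] \<delta>_less[of k' k] that by (meson not_le)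
  have \<delta>_rng: "\<delta> k < n" if "k < p" for k using that rng s_rng by (simp add: \<delta>_def)
  have \<delta>0: "\<delta> 0 = 0" using \<delta>\<sigma>[OF m] \<sigma>0 \<phi>0 by simp
  have \<delta>_ord: "ord_inj0 p n \<delta>"
    unfolding ord_inj0_def using \<delta>_rng \<delta>_mono_on \<delta>_inj \<delta>0 by (auto simp: \<delta>_def)
  have d_rng: "d k < p" for k unfolding d_def by (rule radj_less[OF \<delta>_mono_on \<delta>0 p])
  have le_d: "i \<le> d k \<longleftrightarrow> \<delta> i \<le> k" if "i < p" for i k
    unfolding d_def by (rule le_radj_iff[OF \<delta>_mono_on \<delta>0 p that])
  have d_mono: "d k \<le> d k'" if "k \<le> k'" for k k'
    using le_d[OF d_rng, of k k] le_d[OF d_rng, of k k'] that by simp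
  have d\<delta>: "d (\<delta> k) = k" if "k < p" for k
    using le_d[OF d_rng, of "\<delta> k" "\<delta> k"] le_d[OF that, of "\<delta> k"] \<delta>_le[OF d_rng that, of "\<delta> k"] by simp
  have d_last: "d (n - 1) = p - 1"
    using le_d[of "p - 1" "n - 1"] \<delta>_rng[of "p - 1"] p d_rng[of "n - 1"] by arith
  have \<delta>d: "\<delta> (d k) \<le> k" for k using le_d[OF d_rng, of k k] by simp
  have s_next: "\<sigma> (Suc (s k)) > k" if "Suc (s k) < m" for k using le_s[OF that, of k] by simp
  have R_rng: "R k < p" "R k \<le> k" if "k < p" for k
  proof -
    have "S (s k) < m" using TamD(1)[OF S] s_rng by simp
    then show "R k < p" using that \<sigma>_rng by (simp add: R_def)
    have "S (s k) \<le> s k" using TamD(2)[OF S] s_rng by simp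
    then show "R k \<le> k" using le_s[OF \<open>S (s k) < m\<close>] that by (simp add: R_def)
  qed
  have R: "R \<in> Tam p" unfolding Tam_def
  proof (intro CollectI conjI allI impI)
    show "R \<in> {..<p} \<rightarrow>\<^sub>E {..<p}" using R_rng by (auto simp: R_def)
    show "R k \<le> k" if "k < p" for k using R_rng that by simp
    show "R (p - 1) = p - 1"
      using s_last TamD(4)[OF S] p \<sigma>s[of "p - 1"] by (simp add: R_def)
    fix k i assume k: "k < p" and i: "R k \<le> i \<and> i \<le> k"
    have "S (s k) \<le> s i" using le_s[of "S (s k)" i] TamD(1)[OF S] s_rng k i by (simp add: R_def)
    then have "S (s k) \<le> S (s i)" using TamD(3)[OF S, of "s k" "s i"] s_rng s_mono k i by simp
    then show "R k \<le> R i"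
      using \<sigma>_mono k i TamD(1)[OF S] s_rng by (auto simp: R_def mono_on_def)
  qed
  define st where "st j = (LEAST i. \<phi> i = \<phi> j)" for j
  have st: "\<phi> (st j) = \<phi> j" "st j \<le> j" for j
    unfolding st_def by (rule LeastI, simp) (rule Least_le, simp)
  have L': "L j = (if Suc j < m \<and> \<phi> (Suc j) = \<phi> j then max (S j) (st j) else S j)" if "j < m" for j
    using that by (simp add: L_def st_def)
  have L_le: "S j \<le> L j" "L j \<le> j" if "j < m" for j
    using L' that TamD(2)[OF S] st(2)[of j] by auto
  have L: "L \<in> Tam m" unfolding Tam_def
  proof (intro CollectI conjI allI impI)
    show "L \<in> {..<m} \<rightarrow>\<^sub>E {..<m}" using le_less_trans[OF L_le(2)] by (intro PiE_I) (auto simp: L_def)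
    show "L j \<le> j" if "j < m" for j using L_le that by simp
    show "L (m - 1) = m - 1" using L'[of "m - 1"] m TamD(4)[OF S] by simp
    fix j i assume j: "j < m" and i: "L j \<le> i \<and> i \<le> j"
    have Sij: "S j \<le> S i" using TamD(3)[OF S j, of i] L_le[OF j] i by simp
    show "L j \<le> L i"
    \<comment> \<open>Only a raised value needs care: \<open>L j \<le> i < j\<close> keeps both
      \<open>i\<close> and \<open>Suc i\<close> in the fibre of \<open>j\<close>, so
      \<open>L i\<close> is raised to the same least element.\<close>
    proof (cases "Suc j < m \<and> \<phi> (Suc j) = \<phi> j \<and> i \<noteq> j")
      case False
      then show ?thesis using L'[OF j] L_le(1)[of i] i j Sij by auto
    next
      case True
      then have "st j \<le> i" using L'[OF j] i by simp
      then have eq: "\<phi> i = \<phi> j" "\<phi> (Suc i) = \<phi> j"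
        using mon[of "st j" i] mon[of i "Suc i"] mon[of "Suc i" j] st[of j] True i j by auto
      then have "st i = st j" by (simp add: st_def)
      then show ?thesis using L'[OF j] L'[of i] i True eq Sij by auto
    qed
  qed
  have bij_s: "bij_betw s (\<sigma> ` u) u"
  proof -
    have "s (\<sigma> i) = i" if "i \<in> u" for i
      unfolding s_def using \<sigma>_less[of i "Suc i"] last[OF that] that u
      by (intro radj_eqI \<sigma>_mono \<sigma>0) auto
    then show ?thesis by (intro bij_betw_byWitness[where f' = \<sigma>]) auto
  qed
  have surj: "Fsk_surj (m, u, S) (p, \<sigma> ` u, R) \<sigma>"
    unfolding Fsk_surj.simps shrink.simps
  proof (intro bexI[OF _ L] conjI allI impI)
    show "Tam_le m S L" using L_le by (simp add: Tam_le_def)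
    show "ord_surj m p \<sigma>" by (rule \<sigma>_surj)
    show "bij_betw (radj m \<sigma>) (\<sigma> ` u) u" using bij_s by (simp add: s_def)
  next
    fix j assume j: "j + 1 < m \<and> \<sigma> j = \<sigma> (j + 1)"
    then have e: "\<phi> (Suc j) = \<phi> j" using \<sigma>_eq[of j "Suc j"] by simp
    then have "st j \<le> L j" using L'[of j] j by simp
    then have "\<phi> (L j) = \<phi> j"
      using mon[of "st j" "L j"] mon[of "L j" j] L_le(2)[of j] st[of j] j by simp
    then show "\<sigma> (L j) = \<sigma> j" using \<sigma>_eq[of "L j" j] L_le(2)[of j] j by simp
  next
    fix k assume k: "k < p"
    have "L (s k) = S (s k)"
      using L'[OF s_rng] s_next[of k] \<sigma>_eq[of "Suc (s k)" "s k"] \<sigma>s[OF k] by auto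
    then show "R k = \<sigma> (L (radj m \<sigma> k))" using k by (simp add: R_def s_def)
  qed
  have \<delta>_ub: "k < \<delta> (Suc (d k))" if "Suc (d k) < p" for k using le_d[OF that, of k] by simp
  have T'_eq: "T' k = \<delta> (R (d k))" if "k < n" "d k < p - 1" for k using that by (simp add: T'_def)
  have T'_le: "T' k \<le> T k" if k: "k < n" for k
  \<comment> \<open>\<open>s (d k)\<close> is the last index of its fibre, and \<open>k\<close> lies
    below the next value of \<phi>; this is the situation of the bracketing clause for
    \<phi>.\<close>
  proof (cases "d k < p - 1")
    case True
    let ?j = "s (d k)"
    have j: "Suc ?j < m"
    proof (rule ccontr)
      assume "\<not> Suc ?j < m"
      then have "?j = m - 1" using s_rng[of "d k"] by simp
      then show False using s_last \<sigma>s[of "p - 1"] \<sigma>s[OF d_rng, of k] True by simp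
    qed
    have "\<phi> ?j = \<delta> (d k)" using d_rng by (simp add: \<delta>_def)
    moreover have "\<delta> (Suc (d k)) \<le> \<phi> (Suc ?j)"
      using s_next[OF j] \<sigma>_rng[OF j] \<delta>_mono[of "Suc (d k)" "\<sigma> (Suc ?j)"] \<delta>\<sigma>[OF j] by simp
    ultimately have "\<phi> (S ?j) \<le> T k"
      using br[OF j, of k] \<delta>d[of k] \<delta>_ub[of k] True by (simp add: less_diff_conv)
    then show ?thesis using T'_eq[OF k True] d_rng[of k] \<delta>\<sigma>[of "S ?j"] TamD(1)[OF S] s_rng by (simp add: R_def)
  next
    case False
    then show ?thesis using k TamD(4)[OF T] by (simp add: T'_def)
  qed
  have T': "T' \<in> Tam n" unfolding Tam_def
  proof (intro CollectI conjI allI impI)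
    have le: "T' k \<le> k" if "k < n" for k using T'_le[OF that] TamD(2)[OF T that] by simp
    then show "T' k \<le> k" if "k < n" for k using that .
    show "T' \<in> {..<n} \<rightarrow>\<^sub>E {..<n}" using le_less_trans[OF le] by (intro PiE_I) (auto simp: T'_def)
    show "T' (n - 1) = n - 1" using d_last n by (simp add: T'_def)
    fix k i assume k: "k < n" and i: "T' k \<le> i \<and> i \<le> k"
    show "T' k \<le> T' i"
    proof (cases "d k < p - 1")
      case False
      then show ?thesis using k i by (auto simp: T'_def)
    next
      case True
      then have di: "d i < p - 1" using d_mono[of i k] i by simp
      have "R (d k) \<le> d i" using le_d[OF R_rng(1)[OF d_rng], of k i] i T'_eq[OF k True] by simp
      then have "R (d k) \<le> R (d i)" using TamD(3)[OF R d_rng, of k "d i"] d_mono[of i k] i by simp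
      then show ?thesis using T'_eq k i True di \<delta>_mono R_rng(1)[OF d_rng] by simp
    qed
  qed
  have inj: "Fsk_inj (p, \<sigma> ` u, R) (n, v, T) \<delta>"
    unfolding Fsk_inj.simps swell.simps
  proof (intro bexI[OF _ T'] conjI allI impI)
    show "Tam_le n T' T" using T'_le by (simp add: Tam_le_def)
    show "ord_inj0 p n \<delta>" by (rule \<delta>_ord)
    have "\<delta> ` \<sigma> ` u = (\<lambda>i. \<phi> i) ` u" unfolding image_image using \<delta>\<sigma> u by (intro image_cong) auto
    moreover have "inj_on \<delta> (\<sigma> ` u)" using \<sigma>_rng u by (intro inj_on_subset[OF \<delta>_inj]) auto
    ultimately show "bij_betw \<delta> (\<sigma> ` u) v" using im by (simp add: bij_betw_def)
  next
    fix j k assume j: "j < n" and k: "k < p" and jk: "j < \<delta> k \<and> \<delta> k \<le> rbf n T' j"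
    show "j \<in> \<delta> ` {..<p}"
    proof (rule ccontr)
      \<comment> \<open>Outside the image,
        \<open>T' j = \<delta> (R (d j)) \<le> \<delta> (d j) < j\<close>. Then \<open>j\<close>
        itself witnesses \<open>rbf n T' j \<le> j\<close>, which leaves no room for
        \<open>\<delta> k\<close>.\<close>
      assume nin: "j \<notin> \<delta> ` {..<p}"
      then have lt: "\<delta> (d j) < j" using \<delta>d[of j] d_rng[of j] by (metis imageI le_neq_implies_less lessThan_iff)
      have "d j < k" using le_d[OF k, of j] jk by simp
      then have dj: "d j < p - 1" using k by simp
      have "\<delta> (R (d j)) \<le> \<delta> (d j)" by (rule \<delta>_mono[OF R_rng(2)[OF d_rng] d_rng])
      then have "T' j < j" using T'_eq[OF j dj] lt by simp
      then have "rbf n T' j \<le> j" using rbf_le_iff[OF T' _ j, of j] j by auto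
      then show False using jk by simp
    qed
  next
    fix q assume q: "q < p"
    show "rbf p R q = radj p \<delta> (rbf n T' (\<delta> q))"
    proof (cases "q = 0")
      case True
      then show ?thesis using \<delta>0 d\<delta>[OF p] by (simp add: rbf_def d_def)
    next
      case False
      then have \<delta>q: "0 < \<delta> q" using \<delta>_less[of 0 q] q by simp
      let ?r = "rbf n T' (\<delta> q)"
      \<comment> \<open>Two numbers below \<open>p\<close> agree once they satisfy the same upper
        bounds \<open>t < p - 1\<close>. At \<open>p - 1\<close>, the default value of
        \<open>rbf\<close>, nothing is left to compare.\<close>
      have eq: "rbf p R q \<le> t \<longleftrightarrow> d ?r \<le> t" if t: "t < p - 1" for t
      proof -
        have st: "Suc t < p" using t by simp
        have "d ?r \<le> t \<longleftrightarrow> ?r < \<delta> (Suc t)" using le_d[OF st, of ?r] by arith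
        also have "\<dots> \<longleftrightarrow> ?r \<le> \<delta> (Suc t) - 1" using \<delta>_less[of 0 "Suc t"] st by auto
        also have "\<dots> \<longleftrightarrow> n - 1 \<le> \<delta> (Suc t) - 1 \<or> (\<exists>k\<le>\<delta> (Suc t) - 1. \<delta> q \<le> k \<and> k < n \<and> T' k < \<delta> q)"
          by (rule rbf_le_iff[OF T' \<delta>q \<delta>_rng[OF q]])
        also have "\<dots> \<longleftrightarrow> (\<exists>k<\<delta> (Suc t). \<delta> q \<le> k \<and> k < n \<and> T' k < \<delta> q)"
        proof -
          have "0 < \<delta> (Suc t)" "\<delta> (Suc t) < n" using \<delta>_less[of 0 "Suc t"] st \<delta>_rng[OF st] by auto
          then have "\<not> n - 1 \<le> \<delta> (Suc t) - 1" "\<And>k. k \<le> \<delta> (Suc t) - 1 \<longleftrightarrow> k < \<delta> (Suc t)" by arith+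
          then show ?thesis by simp
        qed
        also have "\<dots> \<longleftrightarrow> (\<exists>k\<le>t. q \<le> k \<and> k < p \<and> R k < q)"
        proof
          assume "\<exists>k<\<delta> (Suc t). \<delta> q \<le> k \<and> k < n \<and> T' k < \<delta> q"
          then obtain k where k: "k < \<delta> (Suc t)" "\<delta> q \<le> k" "k < n" "T' k < \<delta> q" by blast
          have "d k \<le> t" using le_d[OF st, of k] k by simp
          moreover have "q \<le> d k" using le_d[OF q, of k] k by simp
          moreover have "R (d k) < q"
            using T'_eq[OF k(3)] calculation(1) t k(4) \<delta>_le[OF q R_rng(1)[OF d_rng], of k] by (auto simp: not_le[symmetric])
          ultimately show "\<exists>k\<le>t. q \<le> k \<and> k < p \<and> R k < q" using d_rng by blast
        next
          assume "\<exists>k\<le>t. q \<le> k \<and> k < p \<and> R k < q"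
          then obtain k where k: "k \<le> t" "q \<le> k" "k < p" "R k < q" by blast
          have "T' (\<delta> k) < \<delta> q"
            using T'_eq[OF \<delta>_rng[OF k(3)]] d\<delta>[OF k(3)] \<delta>_less[OF k(4) q] k t by simp
          then show "\<exists>k<\<delta> (Suc t). \<delta> q \<le> k \<and> k < n \<and> T' k < \<delta> q"
            using k st \<delta>_less[of k "Suc t"] \<delta>_mono[of q k] \<delta>_rng by (intro exI[of _ "\<delta> k"]) auto
        qed
        also have "\<dots> \<longleftrightarrow> rbf p R q \<le> t"
          using rbf_le_iff[OF R _ q, of t] False t by auto
        finally show ?thesis by simp
      qed
      have "rbf p R q < p" by (rule rbf_less[OF R q])
      moreover have "d ?r < p" by (rule d_rng)
      ultimately have "rbf p R q = d ?r"
        using eq[of "rbf p R q"] eq[of "d ?r"] by (cases "rbf p R q < p - 1"; cases "d ?r < p - 1") auto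
      then show ?thesis by (simp add: d_def)
    qed
  qed
  have "\<phi> = compose {..<m} \<delta> \<sigma>"
    using ex \<delta>\<sigma> by (auto simp: compose_def fun_eq_iff PiE_def extensional_def)
  moreover have "(p, \<sigma> ` u, R) \<in> Fsk_Ob" using p R \<sigma>_rng u by (auto simp: Fsk_Ob_def)
  ultimately show ?thesis using surj inj unfolding Fsk_hom_def fst_conv by blast
qed

text \<open>Unlike the definition by a factorization, the criterion can be checked pointwise and is
  closed under composition. Hom sets are used in this form from here on.\<close>

lemma Fsk_hom_iff:
  assumes "A \<in> Fsk_Ob" "B \<in> Fsk_Ob"
  shows "\<phi> \<in> Fsk_hom A B \<longleftrightarrow> skew_map A B \<phi>"
proof
  obtain m u S where A: "A = (m, u, S)" by (cases A)
  obtain n v T where B: "B = (n, v, T)" by (cases B)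
  show "skew_map A B \<phi>" if h: "\<phi> \<in> Fsk_hom A B"
  proof -
    obtain P \<sigma> \<delta> where "P \<in> Fsk_Ob" "Fsk_surj A P \<sigma>" "Fsk_inj P B \<delta>" "\<phi> = compose {..<fst A} \<delta> \<sigma>"
      using h unfolding Fsk_hom_def by blast
    then obtain p w R where P: "(p, w, R) \<in> Fsk_Ob" "Fsk_surj A (p, w, R) \<sigma>" "Fsk_inj (p, w, R) B \<delta>"
      "\<phi> = compose {..<m} \<delta> \<sigma>"
      by (cases P) (simp add: A)
    have "skew_map A (p, w, R) \<sigma>"
      unfolding A using P(1,2) assms by (intro skew_map_if_Fsk_surj) (auto simp: A Fsk_Ob_def)
    moreover have "skew_map (p, w, R) B \<delta>"
      unfolding B using P(1,3) assms by (intro skew_map_if_Fsk_inj) (auto simp: B Fsk_Ob_def)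
    ultimately show ?thesis
      using P(1,4) assms unfolding A B by (auto intro!: skew_map_comp simp: Fsk_Ob_def)
  qed
  show "\<phi> \<in> Fsk_hom A B" if "skew_map A B \<phi>"
    using Fsk_hom_if_skew_map that assms unfolding A B by blast
qed

lemma skew_map_iff:
  "skew_map A B \<phi> \<longleftrightarrow>
     \<phi> \<in> {..<fst A} \<rightarrow>\<^sub>E {..<fst B} \<and> mono_on {..<fst A} \<phi> \<and> \<phi> 0 = 0 \<and> \<phi> ` fst (snd A) = fst (snd B) \<and>
     (\<forall>i\<in>fst (snd A). Suc i < fst A \<longrightarrow> \<phi> i < \<phi> (Suc i)) \<and>
     (\<forall>j k. Suc j < fst A \<longrightarrow> \<phi> j \<le> k \<longrightarrow> k < \<phi> (Suc j) \<longrightarrow> \<phi> (snd (snd A) j) \<le> snd (snd B) k)"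
  by (cases A; cases B) (simp add: skew_map_def)

section \<open>The skew monoidal structure of Fsk(X)\<close>

lemma star_set_iff: "i \<in> star_set m u v \<longleftrightarrow> i \<in> u \<or> m \<le> i \<and> i - m \<in> v"
proof -
  have "(\<exists>j. i = m + j \<and> j \<in> v) \<longleftrightarrow> m \<le> i \<and> i - m \<in> v"
    by (metis add_diff_cancel_left' le_add1 le_add_diff_inverse)
  then show ?thesis by (simp add: star_set_def)
qed

lemma star_lbf_Tam:
  assumes S: "S \<in> Tam m" and T: "T \<in> Tam n" and m: "0 < m" and n: "0 < n"
  shows "star_lbf m n S T \<in> Tam (m + n)"
  unfolding Tam_def
proof (intro CollectI conjI allI impI)
  show le: "star_lbf m n S T j \<le> j" if "j < m + n" for j
  proof (cases "j < m")
    case True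
    then show ?thesis using TamD(2)[OF S, of j] by (auto simp: star_lbf_def)
  next
    case False
    then have "T (j - m) \<le> j - m" using TamD(2)[OF T, of "j - m"] that by simp
    then show ?thesis using False that by (auto simp: star_lbf_def)
  qed
  have "star_lbf m n S T j < m + n" if "j < m + n" for j using le[OF that] that by simp
  then show "star_lbf m n S T \<in> {..<m + n} \<rightarrow>\<^sub>E {..<m + n}"
    by (intro PiE_I) (simp, simp add: star_lbf_def)
  show "star_lbf m n S T (m + n - 1) = m + n - 1"
    using TamD(4)[OF T] n m by (auto simp: star_lbf_def)
  fix j i assume j: "j < m + n" and i: "star_lbf m n S T j \<le> i \<and> i \<le> j"
  show "star_lbf m n S T j \<le> star_lbf m n S T i"
  proof (cases "j < m")
    case True
    then show ?thesis using TamD(3)[OF S, of j i] i j by (auto simp: star_lbf_def split: if_splits)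
  next
    case False
    then have "star_lbf m n S T j = m + T (j - m)" using j m by (auto simp: star_lbf_def)
    moreover have "m \<le> i" using i calculation by simp
    moreover have "T (j - m) \<le> T (i - m)"
      using False i j calculation by (intro TamD(3)[OF T, of "j - m" "i - m"]) auto
    ultimately show ?thesis using i j m by (auto simp: star_lbf_def)
  qed
qed

text \<open>The two structures may differ, so that besides identities this covers the associator, an
  identity function along an increase in the Tamari order.\<close>

lemma skew_map_id:
  assumes "u \<subseteq> {..<m}" "\<And>k. Suc k < m \<Longrightarrow> S k \<le> T k" "S \<in> Tam m" "0 < m"
  shows "skew_map (m, u, S) (m, u, T) (\<lambda>i\<in>{..<m}. i)"
proof -
  let ?i = "\<lambda>i\<in>{..<m}. i"
  show ?thesis unfolding skew_map_def case_prod_conv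
  proof (intro conjI allI impI ballI)
    show "?i ` u = u" using assms(1) by force
  next
    fix j k assume j: "Suc j < m" "?i j \<le> k" "k < ?i (Suc j)"
    then have "k = j" by simp
    moreover have "S j < m" using TamD(1)[OF assms(3), of j] j by simp
    ultimately show "?i (S j) \<le> T k" using assms(2)[OF j(1)] by simp
  qed (use assms in \<open>auto simp: mono_on_def\<close>)
qed

lemma ord_sum_simps:
  "i < m \<Longrightarrow> ord_sum m n m' \<phi> \<psi> i = \<phi> i"
  "m \<le> i \<Longrightarrow> i < m + n \<Longrightarrow> ord_sum m n m' \<phi> \<psi> i = m' + \<psi> (i - m)"
  by (auto simp: ord_sum_def)

lemma skew_map_ord_sum:
  assumes f: "skew_map (m, u, S) (m', u', S') \<phi>" and g: "skew_map (n, v, T) (n', v', T') \<psi>"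
    and A: "u \<subseteq> {..<m}" "S \<in> Tam m" "0 < m" and B: "v \<subseteq> {..<n}" "T \<in> Tam n" "0 < n"
  shows "skew_map (m + n, star_set m u v, star_lbf m n S T)
     (m' + n', star_set m' u' v', star_lbf m' n' S' T') (ord_sum m n m' \<phi> \<psi>)"
proof -
  have f': "\<And>i. i < m \<Longrightarrow> \<phi> i < m'" "\<And>i j. \<lbrakk>i \<le> j; j < m\<rbrakk> \<Longrightarrow> \<phi> i \<le> \<phi> j"
    "\<phi> 0 = 0" "\<phi> ` u = u'" "\<And>i. \<lbrakk>i \<in> u; Suc i < m\<rbrakk> \<Longrightarrow> \<phi> i < \<phi> (Suc i)"
    "\<And>j k. \<lbrakk>Suc j < m; \<phi> j \<le> k; k < \<phi> (Suc j)\<rbrakk> \<Longrightarrow> \<phi> (S j) \<le> S' k"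
    using f by (auto simp: skew_map_def PiE_def Pi_def mono_on_def)
  have g': "\<And>i. i < n \<Longrightarrow> \<psi> i < n'" "\<And>i j. \<lbrakk>i \<le> j; j < n\<rbrakk> \<Longrightarrow> \<psi> i \<le> \<psi> j"
    "\<psi> 0 = 0" "\<psi> ` v = v'" "\<And>i. \<lbrakk>i \<in> v; Suc i < n\<rbrakk> \<Longrightarrow> \<psi> i < \<psi> (Suc i)"
    "\<And>j k. \<lbrakk>Suc j < n; \<psi> j \<le> k; k < \<psi> (Suc j)\<rbrakk> \<Longrightarrow> \<psi> (T j) \<le> T' k"
    using g by (auto simp: skew_map_def PiE_def Pi_def mono_on_def)
  let ?f = "ord_sum m n m' \<phi> \<psi>"
  have rng: "?f i < m' + n'" if "i < m + n" for i
    using f'(1)[of i] g'(1)[of "i - m"] that by (cases "i < m") (auto simp: ord_sum_simps)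
  have mono: "?f i \<le> ?f j" if "i \<le> j" "j < m + n" for i j
    using f'(2)[of i j] f'(1)[of i] g'(2)[of "i - m" "j - m"] that
    by (cases "i < m"; cases "j < m") (auto simp: ord_sum_simps)
  show ?thesis unfolding skew_map_def case_prod_conv
  proof (intro conjI allI impI ballI)
    show "?f \<in> {..<m + n} \<rightarrow>\<^sub>E {..<m' + n'}" using rng by (intro PiE_I) (auto simp: ord_sum_def)
    show "mono_on {..<m + n} ?f" using mono by (auto simp: mono_on_def)
    show "?f 0 = 0" using f'(3) A by (simp add: ord_sum_simps)
    have "?f ` u = u'" using f'(4) A(1) by (auto simp: ord_sum_simps image_iff subset_iff)
    moreover have "?f ` {m + j |j. j \<in> v} = {m' + j |j. j \<in> v'}"
    proof -
      have *: "{m + j |j. j \<in> v} = (+) m ` v" for m :: nat and v by auto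
      have "?f ` (+) m ` v = (\<lambda>j. m' + \<psi> j) ` v"
        unfolding image_image using B(1) by (intro image_cong) (auto simp: ord_sum_simps)
      then show ?thesis by (simp add: * g'(4)[symmetric] image_image)
    qed
    ultimately show "?f ` star_set m u v = star_set m' u' v'"
      by (simp add: star_set_def image_Un)
  next
    fix i assume i: "i \<in> star_set m u v" "Suc i < m + n"
    show "?f i < ?f (Suc i)"
    proof (cases "i < m")
      case True
      then have "i \<in> u" using i(1) by (simp add: star_set_iff)
      then show ?thesis using True f'(1)[of i] f'(5)[of i] i(2) by (cases "Suc i < m") (auto simp: ord_sum_simps)
    next
      case False
      then have "i - m \<in> v" using i(1) A(1) by (auto simp: star_set_iff)
      then show ?thesis using False g'(5)[of "i - m"] i(2) by (simp add: ord_sum_simps Suc_diff_le)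
    qed
  next
    fix j k assume j: "Suc j < m + n" "?f j \<le> k" "k < ?f (Suc j)"
    have k: "k < m' + n'" using rng[OF j(1)] j(3) by simp
    consider "Suc j < m" | "Suc j = m" | "m \<le> j" by linarith
    then show "?f (star_lbf m n S T j) \<le> star_lbf m' n' S' T' k"
    proof cases
      case 1
      \<comment> \<open>\<open>k\<close> stays below the last index of the left target factor, where
        \<open>star_lbf\<close> replaces the conventional value by \<open>0\<close>.\<close>
      then have "S j < m" "k < m' - 1" using TamD(1)[OF A(2), of j] f'(1)[of "Suc j"] j by (auto simp: ord_sum_simps)
      moreover have "\<phi> (S j) \<le> S' k" using 1 j f'(6)[of j k] by (simp add: ord_sum_simps)
      moreover have "j < m - 1" using 1 by simp
      ultimately show ?thesis using 1 k by (simp add: star_lbf_def ord_sum_simps)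
    next
      case 2
      \<comment> \<open>At the seam the source bracketing is \<open>0\<close>, and
        \<open>\<phi> 0 = 0\<close> is below everything.\<close>
      then show ?thesis using f'(3) A by (auto simp: star_lbf_def ord_sum_simps)
    next
      case 3
      then have *: "T (j - m) < n" "m' + \<psi> (j - m) \<le> k" "k < m' + \<psi> (Suc (j - m))"
        using TamD(1)[OF B(2), of "j - m"] j by (auto simp: ord_sum_simps Suc_diff_le)
      have "0 < m'" using f'(1)[of 0] A(3) by simp
      moreover have "\<psi> (T (j - m)) \<le> T' (k - m')" using g'(6)[of "j - m" "k - m'"] * 3 j by auto
      moreover have "\<not> k < m' - 1" "k \<noteq> m' - 1" "\<not> j < m - 1" "j \<noteq> m - 1"
        using *(2) calculation(1) 3 A(3) by auto
      ultimately show ?thesis using j k *(1) by (simp add: star_lbf_def ord_sum_simps)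
    qed
  qed
qed

lemma Tam_1: "(\<lambda>i\<in>{..<1}. 0) \<in> Tam 1" "S \<in> Tam 1 \<Longrightarrow> S = (\<lambda>i\<in>{..<1}. 0)"
proof -
  show "(\<lambda>i\<in>{..<1}. 0) \<in> Tam 1" by (simp add: Tam_def)
  assume S: "S \<in> Tam 1"
  have "S i = 0" if "i < 1" for i using TamD(1)[OF S that] by simp
  then show "S = (\<lambda>i\<in>{..<1}. 0)"
    using S by (intro extensionalityI[of _ "{..<1}"]) (auto simp: Tam_def PiE_def)
qed

section \<open>Coordinates for objects and arrows of Fsk(X)\<close>

abbreviation osz :: "'o fskx_ob \<Rightarrow> nat" where "osz A \<equiv> fst (fst A)"
abbreviation ou :: "'o fskx_ob \<Rightarrow> nat set" where "ou A \<equiv> fst (snd (fst A))"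
abbreviation olb :: "'o fskx_ob \<Rightarrow> nat \<Rightarrow> nat" where "olb A \<equiv> snd (snd (fst A))"
abbreviation ofam :: "'o fskx_ob \<Rightarrow> nat \<Rightarrow> 'o" where "ofam A \<equiv> snd A"
abbreviation amap :: "('o, 'a) fskx_arr \<Rightarrow> nat \<Rightarrow> nat" where "amap a \<equiv> fst (snd (snd a))"
abbreviation afam :: "('o, 'a) fskx_arr \<Rightarrow> nat \<Rightarrow> 'a" where "afam a \<equiv> snd (snd (snd a))"

lemma fskx_ob_exhaust:
  obtains m u S X where "A = ((m, u, S), X)"
  by (cases A rule: prod.exhaust; cases "fst A") auto

lemma FskX_Ob_iff:
  "A \<in> FskX_Ob \<X> \<longleftrightarrow> 0 < osz A \<and> ou A \<subseteq> {..<osz A} \<and> olb A \<in> Tam (osz A) \<and> ofam A \<in> ou A \<rightarrow>\<^sub>E Ob \<X>"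
  by (rule fskx_ob_exhaust[of A]) (auto simp: FskX_Ob_def Fsk_Ob_def)

lemma FskX_ObD:
  assumes "A \<in> FskX_Ob \<X>"
  shows "0 < osz A" "i \<in> ou A \<Longrightarrow> i < osz A" "olb A \<in> Tam (osz A)" "i \<in> ou A \<Longrightarrow> ofam A i \<in> Ob \<X>"
    "fst A \<in> Fsk_Ob" "ou A \<subseteq> {..<osz A}"
  using assms by (auto simp: FskX_Ob_iff Fsk_Ob_def split: prod.splits)

lemma FskX_Ob_eqI:
  assumes "A \<in> FskX_Ob \<X>" "B \<in> FskX_Ob \<X>" "osz A = osz B" "ou A = ou B"
    "\<And>i. i < osz A \<Longrightarrow> olb A i = olb B i" "\<And>i. i \<in> ou A \<Longrightarrow> ofam A i = ofam B i"
  shows "A = B"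
proof -
  have "olb A \<in> extensional {..<osz A}" "olb B \<in> extensional {..<osz A}"
    "ofam A \<in> extensional (ou A)" "ofam B \<in> extensional (ou A)"
    using assms(1-4) by (auto simp: FskX_Ob_iff Tam_def PiE_def)
  then have "olb A = olb B" "ofam A = ofam B"
    using assms(5,6) by (auto intro: extensionalityI)
  then show ?thesis using assms(3,4) by (simp add: prod_eq_iff)
qed

lemma FskX_Tens_simps:
  "osz (FskX_Tens A B) = osz A + osz B"
  "ou (FskX_Tens A B) = star_set (osz A) (ou A) (ou B)"
  "olb (FskX_Tens A B) = star_lbf (osz A) (osz B) (olb A) (olb B)"
  "ofam (FskX_Tens A B) = star_fam (osz A) (ou A) (ou B) (ofam A) (ofam B)"
  by (rule fskx_ob_exhaust[of A]; rule fskx_ob_exhaust[of B]; simp)+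

lemma FskX_Unit_simps:
  "osz FskX_Unit = 1" "ou FskX_Unit = {}" "olb FskX_Unit = (\<lambda>i\<in>{..<1}. 0)" "ofam FskX_Unit = (\<lambda>i\<in>{}. undefined)"
  by (simp_all add: FskX_Unit_def Fsk_unit_def)

lemma FskX_J_ob_simps:
  "osz (FskX_J_ob A) = 1" "ou (FskX_J_ob A) = {..<1}" "olb (FskX_J_ob A) = (\<lambda>i\<in>{..<1}. 0)"
  "ofam (FskX_J_ob A) = (\<lambda>i\<in>{..<1}. A)"
  by (simp_all add: FskX_J_ob_def Fsk_gen_def)

lemma FskX_Unit_Ob: "FskX_Unit \<in> FskX_Ob \<X>"
  using Tam_1(1) by (simp add: FskX_Ob_iff FskX_Unit_simps)

lemma FskX_J_ob_Ob: "A \<in> Ob \<X> \<Longrightarrow> FskX_J_ob A \<in> FskX_Ob \<X>"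
  using Tam_1(1) by (auto simp: FskX_Ob_iff FskX_J_ob_simps)

lemma star_fam_simps:
  "i \<in> u \<Longrightarrow> u \<subseteq> {..<m} \<Longrightarrow> star_fam m u v X Y i = X i"
  "i - m \<in> v \<Longrightarrow> m \<le> i \<Longrightarrow> star_fam m u v X Y i = Y (i - m)"
  by (auto simp: star_fam_def star_set_iff)

lemma FskX_Tens_Ob:
  assumes "A \<in> FskX_Ob \<X>" "B \<in> FskX_Ob \<X>"
  shows "FskX_Tens A B \<in> FskX_Ob \<X>"
  unfolding FskX_Ob_iff FskX_Tens_simps
proof (intro conjI)
  note A = FskX_ObD[OF assms(1)] and B = FskX_ObD[OF assms(2)]
  show "0 < osz A + osz B" using A(1) by simp
  show "star_set (osz A) (ou A) (ou B) \<subseteq> {..<osz A + osz B}"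
    using A(2) B(2) by (fastforce simp: star_set_def)
  show "star_lbf (osz A) (osz B) (olb A) (olb B) \<in> Tam (osz A + osz B)"
    by (rule star_lbf_Tam[OF A(3) B(3) A(1) B(1)])
  show "star_fam (osz A) (ou A) (ou B) (ofam A) (ofam B) \<in> star_set (osz A) (ou A) (ou B) \<rightarrow>\<^sub>E Ob \<X>"
    using A(2,4) B(4) by (intro PiE_I) (auto simp: star_set_iff star_fam_def)
qed

lemma FskX_sel [simp]:
  "Ob (FskX \<X>) = FskX_Ob \<X>" "Arr (FskX \<X>) = FskX_Arr \<X>" "Ident (FskX \<X>) = FskX_Ident \<X>"
  "Comp (FskX \<X>) = FskX_Comp \<X>" "Unit (FskX \<X>) = FskX_Unit" "Tens (FskX \<X>) = FskX_Tens"
  "TensA (FskX \<X>) = FskX_TensA" "Assoc (FskX \<X>) = FskX_Assoc \<X>" "LUnit (FskX \<X>) = FskX_LUnit \<X>"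
  "RUnit (FskX \<X>) = FskX_RUnit \<X>" "Dom (FskX \<X>) a = fst a" "Cod (FskX \<X>) a = fst (snd a)"
  by (simp_all add: FskX_def case_prod_unfold)

lemma FskX_arrow_simps:
  "FskX_Ident \<X> A = (A, A, (\<lambda>i\<in>{..<osz A}. i), (\<lambda>i\<in>ou A. Ident \<X> (ofam A i)))"
  "FskX_Comp \<X> b a = (fst a, fst (snd b), compose {..<osz (fst a)} (amap b) (amap a),
     (\<lambda>i\<in>ou (fst a). Comp \<X> (afam b (amap a i)) (afam a i)))"
  "FskX_TensA a b = (FskX_Tens (fst a) (fst b), FskX_Tens (fst (snd a)) (fst (snd b)),
     ord_sum (osz (fst a)) (osz (fst b)) (osz (fst (snd a))) (amap a) (amap b),
     star_fam (osz (fst a)) (ou (fst a)) (ou (fst b)) (afam a) (afam b))"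
  "FskX_LUnit \<X> A = (FskX_Tens FskX_Unit A, A, (\<lambda>i\<in>{..<osz A + 1}. i - 1),
     (\<lambda>i\<in>star_set 1 {} (ou A). Ident \<X> (ofam A (i - 1))))"
  "FskX_RUnit \<X> A = (A, FskX_Tens A FskX_Unit, (\<lambda>i\<in>{..<osz A}. i), (\<lambda>i\<in>ou A. Ident \<X> (ofam A i)))"
  "FskX_Assoc \<X> A B E = (FskX_Tens (FskX_Tens A B) E, FskX_Tens A (FskX_Tens B E),
     (\<lambda>i\<in>{..<osz A + osz B + osz E}. i),
     (\<lambda>i\<in>ou (FskX_Tens (FskX_Tens A B) E). Ident \<X> (ofam (FskX_Tens (FskX_Tens A B) E) i)))"
proof -
  obtain m u S X where A: "A = ((m, u, S), X)" by (rule fskx_ob_exhaust)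
  show "FskX_Ident \<X> A = (A, A, (\<lambda>i\<in>{..<osz A}. i), (\<lambda>i\<in>ou A. Ident \<X> (ofam A i)))"
    "FskX_LUnit \<X> A = (FskX_Tens FskX_Unit A, A, (\<lambda>i\<in>{..<osz A + 1}. i - 1),
     (\<lambda>i\<in>star_set 1 {} (ou A). Ident \<X> (ofam A (i - 1))))"
    "FskX_RUnit \<X> A = (A, FskX_Tens A FskX_Unit, (\<lambda>i\<in>{..<osz A}. i), (\<lambda>i\<in>ou A. Ident \<X> (ofam A i)))"
    by (simp_all add: A)
  show "FskX_Assoc \<X> A B E = (FskX_Tens (FskX_Tens A B) E, FskX_Tens A (FskX_Tens B E),
     (\<lambda>i\<in>{..<osz A + osz B + osz E}. i),
     (\<lambda>i\<in>ou (FskX_Tens (FskX_Tens A B) E). Ident \<X> (ofam (FskX_Tens (FskX_Tens A B) E) i)))"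
    by (simp add: FskX_Assoc_def case_prod_unfold FskX_Tens_simps)
next
  obtain A1 A2 \<phi> x B1 B2 \<psi> y where a: "a = (A1, A2, \<phi>, x)" and b: "b = (B1, B2, \<psi>, y)"
    by (cases a; cases b) auto
  obtain m u S X where A1: "A1 = ((m, u, S), X)" by (rule fskx_ob_exhaust)
  obtain m' u' S' X' where A2: "A2 = ((m', u', S'), X')" by (rule fskx_ob_exhaust)
  obtain n v T Y where B1: "B1 = ((n, v, T), Y)" by (rule fskx_ob_exhaust)
  show "FskX_Comp \<X> b a = (fst a, fst (snd b), compose {..<osz (fst a)} (amap b) (amap a),
     (\<lambda>i\<in>ou (fst a). Comp \<X> (afam b (amap a i)) (afam a i)))"
    by (simp add: a b A1)
  show "FskX_TensA a b = (FskX_Tens (fst a) (fst b), FskX_Tens (fst (snd a)) (fst (snd b)),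
     ord_sum (osz (fst a)) (osz (fst b)) (osz (fst (snd a))) (amap a) (amap b),
     star_fam (osz (fst a)) (ou (fst a)) (ou (fst b)) (afam a) (afam b))"
    by (simp add: a b A1 A2 B1 del: FskX_Tens.simps)
qed

lemma star_lbf_simps:
  "i < m - 1 \<Longrightarrow> star_lbf m n S T i = S i"
  "0 < m \<Longrightarrow> star_lbf m n S T (m - 1) = 0"
  "m \<le> i \<Longrightarrow> i < m + n \<Longrightarrow> 0 < m \<Longrightarrow> star_lbf m n S T i = m + T (i - m)"
  by (auto simp: star_lbf_def)

lemma star_set_assoc: "star_set (m + n) (star_set m u v) w = star_set m u (star_set n v w)"
  by (auto simp: star_set_iff)

lemma star_fam_assoc:
  assumes "u \<subseteq> {..<m}" "v \<subseteq> {..<n}"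
  shows "star_fam (m + n) (star_set m u v) w (star_fam m u v X Y) Z
    = star_fam m u (star_set n v w) X (star_fam n v w Y Z)"
proof
  fix i
  show "star_fam (m + n) (star_set m u v) w (star_fam m u v X Y) Z i
    = star_fam m u (star_set n v w) X (star_fam n v w Y Z) i"
    using assms by (auto simp: star_fam_def star_set_iff subset_iff)
qed

text \<open>The two sides differ only at \<open>k = m + n - 1\<close>, the last index of the second
  factor, with value \<open>0\<close> on the left and \<open>m\<close> on the right. This strict
  rise is why \<alpha> has a direction.\<close>

lemma star_lbf_assoc:
  assumes "0 < m" "0 < n"
  shows "star_lbf (m + n) l (star_lbf m n S T) R k \<le> star_lbf m (n + l) S (star_lbf n l T R) k"
  using assms by (auto simp: star_lbf_def)

section \<open>Category, tensor product and coherence of Fsk(X)\<close>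

locale base_category = category \<X> for \<X> :: "('o, 'a) cat"
begin

abbreviation fhom where "fhom \<equiv> cat_hom (FskX \<X>)"

lemma FskX_hom_iff:
  "a \<in> fhom A B \<longleftrightarrow> fst a = A \<and> fst (snd a) = B \<and> A \<in> FskX_Ob \<X> \<and> B \<in> FskX_Ob \<X> \<and>
     skew_map (fst A) (fst B) (amap a) \<and>
     afam a \<in> (\<Pi>\<^sub>E i\<in>ou A. cat_hom \<X> (ofam A i) (ofam B (amap a i)))"
proof -
  obtain A' B' \<phi> x where a: "a = (A', B', \<phi>, x)" by (cases a) auto
  obtain m u S X where A: "A' = ((m, u, S), X)" by (rule fskx_ob_exhaust)
  obtain n v T Y where B: "B' = ((n, v, T), Y)" by (rule fskx_ob_exhaust)
  show ?thesis
    unfolding cat_hom_def[of "FskX \<X>"] FskX_sel by (auto simp: FskX_Arr_def FskX_Ob_def a A B Fsk_hom_iff)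
qed

lemma FskX_homI:
  assumes "A \<in> FskX_Ob \<X>" "B \<in> FskX_Ob \<X>" "skew_map (fst A) (fst B) \<phi>"
    "x \<in> (\<Pi>\<^sub>E i\<in>ou A. cat_hom \<X> (ofam A i) (ofam B (\<phi> i)))"
  shows "(A, B, \<phi>, x) \<in> fhom A B"
  using assms by (simp add: FskX_hom_iff)

lemma FskX_homD:
  assumes "a \<in> fhom A B"
  shows "fst a = A" "fst (snd a) = B" "A \<in> FskX_Ob \<X>" "B \<in> FskX_Ob \<X>" "skew_map (fst A) (fst B) (amap a)"
    "i < osz A \<Longrightarrow> amap a i < osz B" "i \<in> ou A \<Longrightarrow> amap a i \<in> ou B"
    "i \<in> ou A \<Longrightarrow> afam a i \<in> cat_hom \<X> (ofam A i) (ofam B (amap a i))"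
    "i \<in> ou A \<Longrightarrow> Comp \<X> (afam a i) (Ident \<X> (ofam A i)) = afam a i"
    "i \<in> ou A \<Longrightarrow> Comp \<X> (Ident \<X> (ofam B (amap a i))) (afam a i) = afam a i"
proof -
  note a = assms[unfolded FskX_hom_iff]
  show "fst a = A" "fst (snd a) = B" "A \<in> FskX_Ob \<X>" "B \<in> FskX_Ob \<X>" "skew_map (fst A) (fst B) (amap a)"
    using a by auto
  show "i < osz A \<Longrightarrow> amap a i < osz B" "i \<in> ou A \<Longrightarrow> amap a i \<in> ou B" using a unfolding skew_map_iff by auto
  show h: "i \<in> ou A \<Longrightarrow> afam a i \<in> cat_hom \<X> (ofam A i) (ofam B (amap a i))" using a by (auto simp: PiE_def Pi_def)
  show "i \<in> ou A \<Longrightarrow> Comp \<X> (afam a i) (Ident \<X> (ofam A i)) = afam a i"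
    "i \<in> ou A \<Longrightarrow> Comp \<X> (Ident \<X> (ofam B (amap a i))) (afam a i) = afam a i"
    using h Comp_Ident Ident_Comp by blast+
qed

lemma FskX_hom_eqI:
  assumes a: "a \<in> fhom A B" and b: "b \<in> fhom A B"
    and "\<And>i. i < osz A \<Longrightarrow> amap a i = amap b i" "\<And>i. i \<in> ou A \<Longrightarrow> afam a i = afam b i"
  shows "a = b"
proof -
  have "amap a \<in> extensional {..<osz A}" "amap b \<in> extensional {..<osz A}"
    "afam a \<in> extensional (ou A)" "afam b \<in> extensional (ou A)"
    using a b unfolding FskX_hom_iff skew_map_iff by (auto simp: PiE_def)
  then have "amap a = amap b" "afam a = afam b" using assms(3,4) by (auto intro: extensionalityI)
  then show ?thesis using FskX_homD(1,2)[OF a] FskX_homD(1,2)[OF b] by (simp add: prod_eq_iff)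
qed

lemma FskX_Comp_in:
  assumes a: "a \<in> fhom A B" and b: "b \<in> fhom B E"
  shows "FskX_Comp \<X> b a \<in> fhom A E"
  unfolding FskX_arrow_simps FskX_homD(1)[OF a] FskX_homD(2)[OF b]
proof (rule FskX_homI)
  note A = FskX_homD[OF a] and B = FskX_homD[OF b]
  show "A \<in> FskX_Ob \<X>" "E \<in> FskX_Ob \<X>" using A(3) B(4) .
  show "skew_map (fst A) (fst E) (compose {..<osz A} (amap b) (amap a))"
    using skew_map_comp[of "osz A" "ou A" "olb A" "osz B" "ou B" "olb B" "amap a" "osz E" "ou E" "olb E" "amap b"]
      A(5) B(5) FskX_ObD(3,6)[OF A(3)] FskX_ObD(3,6)[OF A(4)] by simp
  show "(\<lambda>i\<in>ou A. Comp \<X> (afam b (amap a i)) (afam a i))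
    \<in> (\<Pi>\<^sub>E i\<in>ou A. cat_hom \<X> (ofam A i) (ofam E (compose {..<osz A} (amap b) (amap a) i)))"
    using Comp_in[OF A(8) B(8)] A(7) FskX_ObD(2)[OF A(3)] by (intro PiE_I) (auto simp: compose_eq)
qed

lemma FskX_category: "category (FskX \<X>)"
proof (rule category.intro, unfold FskX_sel)
  show "fst f \<in> FskX_Ob \<X>" "fst (snd f) \<in> FskX_Ob \<X>" if "f \<in> FskX_Arr \<X>" for f
    using FskX_homD(3,4)[of f "fst f" "fst (snd f)"] that by (auto simp: cat_hom_def)
  show "FskX_Ident \<X> A \<in> fhom A A" if "A \<in> FskX_Ob \<X>" for A
    unfolding FskX_arrow_simps
  proof (rule FskX_homI[OF that that])
    show "skew_map (fst A) (fst A) (\<lambda>i\<in>{..<osz A}. i)"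
      using skew_map_id[of "ou A" "osz A" "olb A" "olb A"] FskX_ObD[OF that] by simp
    show "(\<lambda>i\<in>ou A. Ident \<X> (ofam A i)) \<in> (\<Pi>\<^sub>E i\<in>ou A. cat_hom \<X> (ofam A i) (ofam A (restrict (\<lambda>i. i) {..<osz A} i)))"
      using Ident_in FskX_ObD(2,4)[OF that] by (intro PiE_I) auto
  qed
  note Ident_in' = this
  show "FskX_Comp \<X> g f \<in> fhom A D" if "f \<in> fhom A B" "g \<in> fhom B D" for f g A B D
    using FskX_Comp_in that .
  show "FskX_Comp \<X> f (FskX_Ident \<X> A) = f" if f: "f \<in> fhom A B" for f A B
    using FskX_ObD(2)[OF FskX_homD(3)[OF f]] FskX_homD(9)[OF f]
    by (intro FskX_hom_eqI[OF FskX_Comp_in[OF Ident_in'[OF FskX_homD(3)[OF f]] f] f])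
      (auto simp: FskX_arrow_simps compose_eq)
  show "FskX_Comp \<X> (FskX_Ident \<X> B) f = f" if f: "f \<in> fhom A B" for f A B
    using FskX_ObD(2)[OF FskX_homD(3)[OF f]] FskX_homD(6,7,10)[OF f] FskX_homD(1,2)[OF f]
    by (intro FskX_hom_eqI[OF FskX_Comp_in[OF f Ident_in'[OF FskX_homD(4)[OF f]]] f])
      (auto simp: FskX_arrow_simps compose_eq)
  show "FskX_Comp \<X> (FskX_Comp \<X> h g) f = FskX_Comp \<X> h (FskX_Comp \<X> g f)"
    if f: "f \<in> fhom A B" and g: "g \<in> fhom B D" and h: "h \<in> fhom D E" for f g h A B D E
  proof (rule FskX_hom_eqI)
    show "FskX_Comp \<X> (FskX_Comp \<X> h g) f \<in> fhom A E" "FskX_Comp \<X> h (FskX_Comp \<X> g f) \<in> fhom A E"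
      using f g h FskX_Comp_in by blast+
    show "amap (FskX_Comp \<X> (FskX_Comp \<X> h g) f) i = amap (FskX_Comp \<X> h (FskX_Comp \<X> g f)) i" if "i < osz A" for i
      using FskX_homD(1,2,6)[OF f] FskX_homD(1)[OF g] that by (simp add: FskX_arrow_simps compose_eq)
    show "afam (FskX_Comp \<X> (FskX_Comp \<X> h g) f) i = afam (FskX_Comp \<X> h (FskX_Comp \<X> g f)) i" if "i \<in> ou A" for i
      using FskX_homD(1,2,7)[OF f] FskX_homD(1,7)[OF g] FskX_ObD(2)[OF FskX_homD(3)[OF f]] that
        Comp_assoc[OF FskX_homD(8)[OF f] FskX_homD(8)[OF g] FskX_homD(8)[OF h], of i]
      by (simp add: FskX_arrow_simps compose_eq)
  qed
qed

lemma FskX_TensA_in: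
  assumes a: "a \<in> fhom A A'" and b: "b \<in> fhom B B'"
  shows "FskX_TensA a b \<in> fhom (FskX_Tens A B) (FskX_Tens A' B')"
  unfolding FskX_arrow_simps FskX_homD(1,2)[OF a] FskX_homD(1,2)[OF b]
proof (rule FskX_homI)
  note A = FskX_homD[OF a] and B = FskX_homD[OF b]
  note Ao = FskX_ObD[OF A(3)] and Bo = FskX_ObD[OF B(3)] and Ao' = FskX_ObD[OF A(4)] and Bo' = FskX_ObD[OF B(4)]
  show "FskX_Tens A B \<in> FskX_Ob \<X>" "FskX_Tens A' B' \<in> FskX_Ob \<X>" using FskX_Tens_Ob A B by blast+
  have fst_Tens: "fst (FskX_Tens A B) = (osz A + osz B, star_set (osz A) (ou A) (ou B), star_lbf (osz A) (osz B) (olb A) (olb B))" for A B :: "'o fskx_ob"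
    by (simp add: prod_eq_iff FskX_Tens_simps)
  show "skew_map (fst (FskX_Tens A B)) (fst (FskX_Tens A' B')) (ord_sum (osz A) (osz B) (osz A') (amap a) (amap b))"
    unfolding fst_Tens using A(5) B(5) Ao Bo by (intro skew_map_ord_sum) auto
  show "star_fam (osz A) (ou A) (ou B) (afam a) (afam b)
    \<in> (\<Pi>\<^sub>E i\<in>ou (FskX_Tens A B). cat_hom \<X> (ofam (FskX_Tens A B) i)
        (ofam (FskX_Tens A' B') (ord_sum (osz A) (osz B) (osz A') (amap a) (amap b) i)))"
    unfolding FskX_Tens_simps
  proof (rule PiE_I)
    fix i assume "i \<in> star_set (osz A) (ou A) (ou B)"
    then consider "i \<in> ou A" "i < osz A" | "osz A \<le> i" "i - osz A \<in> ou B" "i < osz A + osz B"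
      using Ao(2) Bo(2) by (fastforce simp: star_set_iff)
    then show "star_fam (osz A) (ou A) (ou B) (afam a) (afam b) i
      \<in> cat_hom \<X> (star_fam (osz A) (ou A) (ou B) (ofam A) (ofam B) i)
         (star_fam (osz A') (ou A') (ou B') (ofam A') (ofam B') (ord_sum (osz A) (osz B) (osz A') (amap a) (amap b) i))"
    proof cases
      case 1
      then show ?thesis
        using A(6,7,8)[of i] Ao(6) Ao'(6) by (simp add: star_fam_simps ord_sum_simps)
    next
      case 2
      then show ?thesis
        using B(6,7,8)[of "i - osz A"] by (simp add: star_fam_simps ord_sum_simps)
    qed
  qed (simp add: star_fam_def)
qed

text \<open>The arrows all of whose components are identities; such an arrow is determined by its underlying
  function.\<close>

definition bare :: "'o fskx_ob \<Rightarrow> 'o fskx_ob \<Rightarrow> ('o, 'a) fskx_arr \<Rightarrow> bool" where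
  "bare A B a \<longleftrightarrow> a \<in> fhom A B \<and> (\<forall>i\<in>ou A. ofam B (amap a i) = ofam A i \<and> afam a i = Ident \<X> (ofam A i))"

lemma bareI:
  assumes "A \<in> FskX_Ob \<X>" "B \<in> FskX_Ob \<X>" "skew_map (fst A) (fst B) \<phi>"
    "\<And>i. i \<in> ou A \<Longrightarrow> ofam B (\<phi> i) = ofam A i"
    "U = ou A" "\<And>i. i \<in> ou A \<Longrightarrow> Z i = ofam A i"
  shows "bare A B (A, B, \<phi>, \<lambda>i\<in>U. Ident \<X> (Z i))"
  unfolding bare_def
  using assms FskX_ObD(4)[OF assms(1)] Ident_in by (auto intro!: FskX_homI PiE_I)

lemma bare_hom: "bare A B a \<Longrightarrow> a \<in> fhom A B"
  by (simp add: bare_def)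

lemma bare_eqI:
  assumes "bare A B a" "bare A B b" "\<And>i. i < osz A \<Longrightarrow> amap a i = amap b i"
  shows "a = b"
  using assms by (intro FskX_hom_eqI[of _ A B]) (auto simp: bare_def)

lemma bare_Comp:
  assumes a: "bare A B a" and b: "bare B E b"
  shows "bare A E (FskX_Comp \<X> b a)"
proof -
  note A = FskX_homD[OF bare_hom[OF a]]
  show ?thesis
    using a b FskX_Comp_in[OF bare_hom[OF a] bare_hom[OF b]] A(1,7) FskX_ObD(2,4)[OF A(3)] Comp_Ident[OF Ident_in]
    unfolding bare_def by (auto simp: FskX_arrow_simps compose_eq)
qed

lemma bare_TensA:
  assumes a: "bare A A' a" and b: "bare B B' b"
  shows "bare (FskX_Tens A B) (FskX_Tens A' B') (FskX_TensA a b)"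
proof -
  note A = FskX_homD[OF bare_hom[OF a]] and B = FskX_homD[OF bare_hom[OF b]]
  note Ao = FskX_ObD[OF A(3)] and Bo = FskX_ObD[OF B(3)] and Ao' = FskX_ObD[OF A(4)]
  have "ofam (FskX_Tens A' B') (amap (FskX_TensA a b) i) = ofam (FskX_Tens A B) i \<and>
      afam (FskX_TensA a b) i = Ident \<X> (ofam (FskX_Tens A B) i)"
    if i: "i \<in> star_set (osz A) (ou A) (ou B)" for i
  proof -
    consider "i \<in> ou A" "i < osz A" | "osz A \<le> i" "i - osz A \<in> ou B" "i < osz A + osz B"
      using i Ao(2) Bo(2) by (fastforce simp: star_set_iff)
    then show ?thesis
    proof cases
      case 1
      then show ?thesis using a A(1,2) A(6,7)[of i] B(1,2) Ao(6) Ao'(6)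
        by (simp add: FskX_arrow_simps FskX_Tens_simps star_fam_simps ord_sum_simps bare_def)
    next
      case 2
      then show ?thesis using b A(1,2) B(1,2) B(7)[of "i - osz A"]
        by (simp add: FskX_arrow_simps FskX_Tens_simps star_fam_simps ord_sum_simps bare_def)
    qed
  qed
  then show ?thesis
    using FskX_TensA_in[OF bare_hom[OF a] bare_hom[OF b]] by (simp add: bare_def FskX_Tens_simps)
qed

lemma bare_Ident: "A \<in> FskX_Ob \<X> \<Longrightarrow> bare A A (FskX_Ident \<X> A)"
  using category.Ident_in[OF FskX_category, of A] FskX_ObD(2)[of A]
  unfolding bare_def by (auto simp: FskX_arrow_simps)

lemma bare_Assoc:
  assumes "A \<in> FskX_Ob \<X>" "B \<in> FskX_Ob \<X>" "E \<in> FskX_Ob \<X>"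
  shows "bare (FskX_Tens (FskX_Tens A B) E) (FskX_Tens A (FskX_Tens B E)) (FskX_Assoc \<X> A B E)"
  unfolding FskX_arrow_simps
proof (rule bareI)
  note A = FskX_ObD[OF assms(1)] and B = FskX_ObD[OF assms(2)]
  let ?l = "FskX_Tens (FskX_Tens A B) E" and ?r = "FskX_Tens A (FskX_Tens B E)"
  show l: "?l \<in> FskX_Ob \<X>" and r: "?r \<in> FskX_Ob \<X>" using assms FskX_Tens_Ob by blast+
  have eq: "osz ?r = osz ?l" "ou ?r = ou ?l" "ofam ?r = ofam ?l" "olb ?l k \<le> olb ?r k" for k
    using A B by (simp_all add: FskX_Tens_simps star_set_assoc star_fam_assoc star_lbf_assoc)
  have "skew_map (osz ?l, ou ?l, olb ?l) (osz ?l, ou ?l, olb ?r) (\<lambda>i\<in>{..<osz ?l}. i)"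
    using FskX_ObD[OF l] eq(4) by (intro skew_map_id) auto
  then show "skew_map (fst ?l) (fst ?r) (\<lambda>i\<in>{..<osz A + osz B + osz E}. i)"
    using eq(1,2) by (metis FskX_Tens_simps(1) prod.collapse)
  show "ofam ?r ((\<lambda>i\<in>{..<osz A + osz B + osz E}. i) i) = ofam ?l i" if "i \<in> ou ?l" for i
    using FskX_ObD(2)[OF l that] eq(3) by (simp add: FskX_Tens_simps(1))
qed auto

lemma bare_LUnit:
  assumes "A \<in> FskX_Ob \<X>"
  shows "bare (FskX_Tens FskX_Unit A) A (FskX_LUnit \<X> A)"
  unfolding FskX_arrow_simps
proof (rule bareI)
  note A = FskX_ObD[OF assms]
  let ?l = "FskX_Tens FskX_Unit A" and ?\<phi> = "\<lambda>i\<in>{..<osz A + 1}. i - 1"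
  have f: "osz ?l = osz A + 1" "\<And>i. i \<in> ou ?l \<longleftrightarrow> 0 < i \<and> i - 1 \<in> ou A"
    "\<And>i. 0 < i \<Longrightarrow> i < osz A + 1 \<Longrightarrow> olb ?l i = 1 + olb A (i - 1)" "olb ?l 0 = 0"
    "\<And>i. i \<in> ou ?l \<Longrightarrow> ofam ?l i = ofam A (i - 1)"
    by (auto simp: FskX_Tens_simps FskX_Unit_simps star_set_iff star_lbf_def star_fam_def)
  show "?l \<in> FskX_Ob \<X>" "A \<in> FskX_Ob \<X>" using assms FskX_Tens_Ob FskX_Unit_Ob by blast+
  show "star_set 1 {} (ou A) = ou ?l" by (simp add: FskX_Tens_simps FskX_Unit_simps)
  show "ofam A (i - 1) = ofam ?l i" if "i \<in> ou ?l" for i using f(5)[OF that] by simp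
  show "ofam A (?\<phi> i) = ofam ?l i" if "i \<in> ou ?l" for i
    using f(2,5)[of i] that A(2)[of "i - 1"] by auto
  show "skew_map (fst ?l) (fst A) ?\<phi>"
    unfolding skew_map_iff f(1)
  proof (intro conjI allI impI ballI)
    show "?\<phi> \<in> {..<osz A + 1} \<rightarrow>\<^sub>E {..<osz A}" using A(1) by (intro PiE_I) auto
    show "?\<phi> ` ou ?l = ou A"
    proof (intro equalityI subsetI)
      fix i assume "i \<in> ou A"
      then show "i \<in> ?\<phi> ` ou ?l" using A(2) f(2)[of "Suc i"] by (intro image_eqI[of _ _ "Suc i"]) auto
    next
      fix i assume "i \<in> ?\<phi> ` ou ?l"
      then obtain j where "j \<in> ou ?l" "i = ?\<phi> j" by blast
      then show "i \<in> ou A" using f(2)[of j] A(2)[of "j - 1"] by auto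
    qed
  next
    fix i assume "i \<in> ou ?l" "Suc i < osz A + 1"
    then show "?\<phi> i < ?\<phi> (Suc i)" using f(2)[of i] by simp
  next
    fix j k assume j: "Suc j < osz A + 1" "?\<phi> j \<le> k" "k < ?\<phi> (Suc j)"
    then have k: "0 < j" "k = j - 1" by auto
    have "olb A k < osz A" using TamD(1)[OF A(3)] j k by simp
    then show "?\<phi> (olb ?l j) \<le> olb A k" using f(3)[OF k(1)] j k by simp
  qed (auto simp: mono_on_def)
qed

lemma bare_RUnit:
  assumes "A \<in> FskX_Ob \<X>"
  shows "bare A (FskX_Tens A FskX_Unit) (FskX_RUnit \<X> A)"
  unfolding FskX_arrow_simps
proof (rule bareI)
  note A = FskX_ObD[OF assms]
  let ?r = "FskX_Tens A FskX_Unit" and ?\<phi> = "\<lambda>i\<in>{..<osz A}. i"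
  have f: "osz ?r = osz A + 1" "ou ?r = ou A" "\<And>i. Suc i < osz A \<Longrightarrow> olb ?r i = olb A i"
    "\<And>i. i \<in> ou A \<Longrightarrow> ofam ?r i = ofam A i"
    using A(6) by (auto simp: FskX_Tens_simps FskX_Unit_simps star_set_iff star_lbf_simps star_fam_simps)
  show "A \<in> FskX_Ob \<X>" "?r \<in> FskX_Ob \<X>" using assms FskX_Tens_Ob FskX_Unit_Ob by blast+
  show "ofam ?r (?\<phi> i) = ofam A i" if "i \<in> ou A" for i using f(4) A(2) that by simp
  show "skew_map (fst A) (fst ?r) ?\<phi>"
    unfolding skew_map_iff f(1,2)
  proof (intro conjI allI impI ballI)
    show "?\<phi> ` ou A = ou A" using A(6) by force
  next
    fix j k assume j: "Suc j < osz A" "?\<phi> j \<le> k" "k < ?\<phi> (Suc j)"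
    then have "k = j" by simp
    moreover have "olb A j < osz A" using TamD(1)[OF A(3)] j by simp
    ultimately show "?\<phi> (olb A j) \<le> olb ?r k" using f(3)[OF j(1)] by simp
  qed (use A(1,6) in \<open>auto simp: mono_on_def\<close>)
qed auto

text \<open>The five coherence axioms compare arrows whose components are identities, hence reduce
  by \<open>bare_eqI\<close> to equalities of functions on ordinals. Preservation of composites by
  the tensor and the naturality conditions involve arbitrary families and are checked in each
  component.\<close>

lemma FskX_skew_monoidal: "skew_monoidal_category (FskX \<X>)"
proof (intro skew_monoidal_category.intro FskX_category skew_monoidal_category_axioms.intro, unfold FskX_sel)
  note amap_simps = FskX_arrow_simps FskX_Tens_simps FskX_Unit_simps ord_sum_def compose_def
  show "FskX_Unit \<in> FskX_Ob \<X>" by (rule FskX_Unit_Ob)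
  show "FskX_Tens A B \<in> FskX_Ob \<X>" if "A \<in> FskX_Ob \<X>" "B \<in> FskX_Ob \<X>" for A B
    using FskX_Tens_Ob that .
  show "FskX_TensA f g \<in> fhom (FskX_Tens A B) (FskX_Tens A' B')" if "f \<in> fhom A A'" "g \<in> fhom B B'" for f g A A' B B'
    using FskX_TensA_in that .
  show "FskX_Assoc \<X> A B E \<in> fhom (FskX_Tens (FskX_Tens A B) E) (FskX_Tens A (FskX_Tens B E))"
    if "A \<in> FskX_Ob \<X>" "B \<in> FskX_Ob \<X>" "E \<in> FskX_Ob \<X>" for A B E
    using bare_hom[OF bare_Assoc[OF that]] .
  show "FskX_LUnit \<X> A \<in> fhom (FskX_Tens FskX_Unit A) A" if "A \<in> FskX_Ob \<X>" for A
    using bare_hom[OF bare_LUnit[OF that]] .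
  show "FskX_RUnit \<X> A \<in> fhom A (FskX_Tens A FskX_Unit)" if "A \<in> FskX_Ob \<X>" for A
    using bare_hom[OF bare_RUnit[OF that]] .
  show "FskX_TensA (FskX_Ident \<X> A) (FskX_Ident \<X> B) = FskX_Ident \<X> (FskX_Tens A B)"
    if "A \<in> FskX_Ob \<X>" "B \<in> FskX_Ob \<X>" for A B
    by (rule bare_eqI[OF bare_TensA[OF bare_Ident bare_Ident] bare_Ident[OF FskX_Tens_Ob]])
      (use that in \<open>auto simp: amap_simps\<close>)
  show "FskX_TensA (FskX_Comp \<X> f' f) (FskX_Comp \<X> g' g) = FskX_Comp \<X> (FskX_TensA f' g') (FskX_TensA f g)"
    if f: "f \<in> fhom A A'" "f' \<in> fhom A' A''" and g: "g \<in> fhom B B'" "g' \<in> fhom B' B''"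
    for f f' g g' A A' A'' B B' B''
  proof (rule FskX_hom_eqI)
    note ff = FskX_homD(1,2,6,7)[OF f(1)] FskX_homD(1,2)[OF f(2)] FskX_homD(1,2,6,7)[OF g(1)] FskX_homD(1,2)[OF g(2)]
    note Ao = FskX_ObD(2,6)[OF FskX_homD(3)[OF f(1)]] and Bo = FskX_ObD(2,6)[OF FskX_homD(3)[OF g(1)]]
      and Ao' = FskX_ObD(2,6)[OF FskX_homD(3)[OF f(2)]] and Bo' = FskX_ObD(2,6)[OF FskX_homD(3)[OF g(2)]]
    show "FskX_TensA (FskX_Comp \<X> f' f) (FskX_Comp \<X> g' g) \<in> fhom (FskX_Tens A B) (FskX_Tens A'' B'')"
      using f g FskX_Comp_in FskX_TensA_in by blast
    show "FskX_Comp \<X> (FskX_TensA f' g') (FskX_TensA f g) \<in> fhom (FskX_Tens A B) (FskX_Tens A'' B'')"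
      using f g FskX_Comp_in FskX_TensA_in by blast
    fix i
    show "amap (FskX_TensA (FskX_Comp \<X> f' f) (FskX_Comp \<X> g' g)) i
        = amap (FskX_Comp \<X> (FskX_TensA f' g') (FskX_TensA f g)) i" if "i < osz (FskX_Tens A B)"
      using that ff(3)[of i] ff(9)[of "i - osz A"] ff(1,2,5-8,11,12) by (auto simp: amap_simps)
    assume "i \<in> ou (FskX_Tens A B)"
    then consider "i \<in> ou A" "i < osz A" | "osz A \<le> i" "i - osz A \<in> ou B" "i < osz A + osz B"
      using Ao(1) Bo(1) by (fastforce simp: star_set_iff FskX_Tens_simps)
    then show "afam (FskX_TensA (FskX_Comp \<X> f' f) (FskX_Comp \<X> g' g)) i
        = afam (FskX_Comp \<X> (FskX_TensA f' g') (FskX_TensA f g)) i"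
    proof cases
      case 1
      then show ?thesis using ff(3,4)[of i] ff(1,2,5-8,11,12) Ao(2) Ao'(2)
        by (simp add: FskX_arrow_simps FskX_Tens_simps star_fam_simps ord_sum_simps star_set_iff compose_def)
    next
      case 2
      then show ?thesis using ff(9,10)[of "i - osz A"] ff(1,2,5-8,11,12)
        by (simp add: FskX_arrow_simps FskX_Tens_simps star_fam_simps ord_sum_simps star_set_iff compose_def)
    qed
  qed
  show "FskX_Comp \<X> (FskX_Assoc \<X> X' Y' Z') (FskX_TensA (FskX_TensA f g) h)
      = FskX_Comp \<X> (FskX_TensA f (FskX_TensA g h)) (FskX_Assoc \<X> X Y Z)"
    if f: "f \<in> fhom X X'" and g: "g \<in> fhom Y Y'" and h: "h \<in> fhom Z Z'" for f g h X X' Y Y' Z Z'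
  proof (rule FskX_hom_eqI)
    let ?s = "FskX_Tens (FskX_Tens X Y) Z" and ?t = "FskX_Tens X' (FskX_Tens Y' Z')"
    note F = FskX_homD[OF f] and G = FskX_homD[OF g] and H = FskX_homD[OF h]
    note Xo = FskX_ObD[OF F(3)] and Yo = FskX_ObD[OF G(3)] and Zo = FskX_ObD[OF H(3)]
    note Xo' = FskX_ObD[OF F(4)] and Yo' = FskX_ObD[OF G(4)]
    show l: "FskX_Comp \<X> (FskX_Assoc \<X> X' Y' Z') (FskX_TensA (FskX_TensA f g) h) \<in> fhom ?s ?t"
      by (rule FskX_Comp_in[OF FskX_TensA_in[OF FskX_TensA_in[OF f g] h] bare_hom[OF bare_Assoc]]) (use F G H in auto)
    show r: "FskX_Comp \<X> (FskX_TensA f (FskX_TensA g h)) (FskX_Assoc \<X> X Y Z) \<in> fhom ?s ?t"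
      by (rule FskX_Comp_in[OF bare_hom[OF bare_Assoc] FskX_TensA_in[OF f FskX_TensA_in[OF g h]]]) (use F G H in auto)
    fix i
    show "amap (FskX_Comp \<X> (FskX_Assoc \<X> X' Y' Z') (FskX_TensA (FskX_TensA f g) h)) i
      = amap (FskX_Comp \<X> (FskX_TensA f (FskX_TensA g h)) (FskX_Assoc \<X> X Y Z)) i" if "i < osz ?s"
      using that F(6)[of i] G(6)[of "i - osz X"] H(6)[of "i - (osz X + osz Y)"] F(1,2) G(1,2) H(1,2)
      by (auto simp: amap_simps)
    assume i: "i \<in> ou ?s"
    have A1: "FskX_TensA (FskX_TensA f g) h \<in> fhom ?s (FskX_Tens (FskX_Tens X' Y') Z')"
      and A2: "FskX_TensA f (FskX_TensA g h) \<in> fhom (FskX_Tens X (FskX_Tens Y Z)) ?t"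
      using f g h FskX_TensA_in by blast+
    have b1: "bare (FskX_Tens (FskX_Tens X' Y') Z') ?t (FskX_Assoc \<X> X' Y' Z')"
      and b2: "bare ?s (FskX_Tens X (FskX_Tens Y Z)) (FskX_Assoc \<X> X Y Z)"
      using bare_Assoc F(3,4) G(3,4) H(3,4) by blast+
    have i': "i < osz ?s" using FskX_ObD(2)[OF FskX_homD(3)[OF A1]] i by simp
    have i2: "i \<in> ou (FskX_Tens X (FskX_Tens Y Z))" using i by (simp add: FskX_Tens_simps star_set_assoc)
    have am: "amap (FskX_Assoc \<X> X Y Z) i = i" using i' by (simp add: FskX_arrow_simps FskX_Tens_simps)
    \<comment> \<open>The identity components of the associators drop out on both sides, and
      \<open>star_fam_assoc\<close> identifies the two remaining families.\<close>
    have "afam (FskX_Comp \<X> (FskX_Assoc \<X> X' Y' Z') (FskX_TensA (FskX_TensA f g) h)) i = afam (FskX_TensA (FskX_TensA f g) h) i"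
      using FskX_homD(10)[OF A1 i] b1 FskX_homD(7)[OF A1 i] i FskX_homD(1)[OF A1]
      by (simp add: FskX_arrow_simps(2) bare_def)
    also have "\<dots> = afam (FskX_TensA f (FskX_TensA g h)) i"
      using i i2 Xo(6) Yo(6) F(1) G(1) H(1) by (simp add: FskX_arrow_simps FskX_Tens_simps star_fam_assoc)
    also have "\<dots> = afam (FskX_Comp \<X> (FskX_TensA f (FskX_TensA g h)) (FskX_Assoc \<X> X Y Z)) i"
    proof -
      have "afam (FskX_Assoc \<X> X Y Z) i = Ident \<X> (ofam (FskX_Tens X (FskX_Tens Y Z)) i)"
        using b2 i am unfolding bare_def by auto
      then show ?thesis
        using FskX_homD(9)[OF A2 i2] i am FskX_homD(1)[OF bare_hom[OF b2]] by (simp add: FskX_arrow_simps(2))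
    qed
    finally show "afam (FskX_Comp \<X> (FskX_Assoc \<X> X' Y' Z') (FskX_TensA (FskX_TensA f g) h)) i
      = afam (FskX_Comp \<X> (FskX_TensA f (FskX_TensA g h)) (FskX_Assoc \<X> X Y Z)) i" .
  qed
  show "FskX_Comp \<X> (FskX_LUnit \<X> X') (FskX_TensA (FskX_Ident \<X> FskX_Unit) f) = FskX_Comp \<X> f (FskX_LUnit \<X> X)"
    if f: "f \<in> fhom X X'" for f X X'
  proof (rule FskX_hom_eqI)
    note F = FskX_homD[OF f]
    note Xo = FskX_ObD[OF F(3)] and Xo' = FskX_ObD[OF F(4)]
    let ?s = "FskX_Tens FskX_Unit X"
    show "FskX_Comp \<X> (FskX_LUnit \<X> X') (FskX_TensA (FskX_Ident \<X> FskX_Unit) f) \<in> fhom ?s X'"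
      by (rule FskX_Comp_in[OF FskX_TensA_in[OF bare_hom[OF bare_Ident] f] bare_hom[OF bare_LUnit]]) (use F FskX_Unit_Ob in auto)
    show "FskX_Comp \<X> f (FskX_LUnit \<X> X) \<in> fhom ?s X'"
      by (rule FskX_Comp_in[OF bare_hom[OF bare_LUnit] f]) (use F in auto)
    have \<phi>0: "amap f 0 = 0" using F(5) by (simp add: skew_map_iff)
    fix i
    show "amap (FskX_Comp \<X> (FskX_LUnit \<X> X') (FskX_TensA (FskX_Ident \<X> FskX_Unit) f)) i = amap (FskX_Comp \<X> f (FskX_LUnit \<X> X)) i"
      if "i < osz ?s" using that F(1,2) F(6)[of "i - 1"] \<phi>0 by (auto simp: amap_simps)
    assume "i \<in> ou ?s"
    then have i: "0 < i" "i - 1 \<in> ou X" "i < osz X + 1" using Xo(2)[of "i - 1"] by (auto simp: FskX_Tens_simps FskX_Unit_simps star_set_iff)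
    then show "afam (FskX_Comp \<X> (FskX_LUnit \<X> X') (FskX_TensA (FskX_Ident \<X> FskX_Unit) f)) i = afam (FskX_Comp \<X> f (FskX_LUnit \<X> X)) i"
      using F(1,2) F(6,7,9,10)[of "i - 1"] 
      by (simp add: amap_simps star_fam_def star_set_iff)
  qed
  show "FskX_Comp \<X> (FskX_RUnit \<X> X') f = FskX_Comp \<X> (FskX_TensA f (FskX_Ident \<X> FskX_Unit)) (FskX_RUnit \<X> X)"
    if f: "f \<in> fhom X X'" for f X X'
  proof (rule FskX_hom_eqI)
    note F = FskX_homD[OF f]
    note Xo = FskX_ObD[OF F(3)] and Xo' = FskX_ObD[OF F(4)]
    let ?t = "FskX_Tens X' FskX_Unit"
    show "FskX_Comp \<X> (FskX_RUnit \<X> X') f \<in> fhom X ?t"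
      by (rule FskX_Comp_in[OF f bare_hom[OF bare_RUnit]]) (use F in auto)
    show "FskX_Comp \<X> (FskX_TensA f (FskX_Ident \<X> FskX_Unit)) (FskX_RUnit \<X> X) \<in> fhom X ?t"
      by (rule FskX_Comp_in[OF bare_hom[OF bare_RUnit] FskX_TensA_in[OF f bare_hom[OF bare_Ident]]]) (use F FskX_Unit_Ob in auto)
    fix i
    show "amap (FskX_Comp \<X> (FskX_RUnit \<X> X') f) i = amap (FskX_Comp \<X> (FskX_TensA f (FskX_Ident \<X> FskX_Unit)) (FskX_RUnit \<X> X)) i"
      if "i < osz X" using that F(1,2) F(6)[of i] by (auto simp: amap_simps)
    assume "i \<in> ou X"
    then show "afam (FskX_Comp \<X> (FskX_RUnit \<X> X') f) i = afam (FskX_Comp \<X> (FskX_TensA f (FskX_Ident \<X> FskX_Unit)) (FskX_RUnit \<X> X)) i"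
      using F(1,2) F(6,7,9,10)[of i] Xo(2)[of i] by (simp add: amap_simps star_fam_def star_set_iff)
  qed
  show "FskX_Comp \<X> (FskX_TensA (FskX_Ident \<X> W) (FskX_Assoc \<X> X Y Z))
         (FskX_Comp \<X> (FskX_Assoc \<X> W (FskX_Tens X Y) Z) (FskX_TensA (FskX_Assoc \<X> W X Y) (FskX_Ident \<X> Z)))
       = FskX_Comp \<X> (FskX_Assoc \<X> W X (FskX_Tens Y Z)) (FskX_Assoc \<X> (FskX_Tens W X) Y Z)"
    if "W \<in> FskX_Ob \<X>" "X \<in> FskX_Ob \<X>" "Y \<in> FskX_Ob \<X>" "Z \<in> FskX_Ob \<X>" for W X Y Z
    by (rule bare_eqI[OF bare_Comp[OF bare_Comp[OF bare_TensA[OF bare_Assoc bare_Ident] bare_Assoc]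
            bare_TensA[OF bare_Ident bare_Assoc]] bare_Comp[OF bare_Assoc bare_Assoc]])
      (use that in \<open>auto simp: amap_simps intro: FskX_Tens_Ob\<close>)
  show "FskX_Comp \<X> (FskX_LUnit \<X> (FskX_Tens X Y)) (FskX_Assoc \<X> FskX_Unit X Y)
      = FskX_TensA (FskX_LUnit \<X> X) (FskX_Ident \<X> Y)"
    if "X \<in> FskX_Ob \<X>" "Y \<in> FskX_Ob \<X>" for X Y
    by (rule bare_eqI[OF bare_Comp[OF bare_Assoc bare_LUnit] bare_TensA[OF bare_LUnit bare_Ident]])
      (use that FskX_ObD(1)[OF that(1)] in \<open>auto simp: amap_simps intro: FskX_Tens_Ob FskX_Unit_Ob\<close>)
  show "FskX_Comp \<X> (FskX_TensA (FskX_Ident \<X> X) (FskX_LUnit \<X> Y))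
         (FskX_Comp \<X> (FskX_Assoc \<X> X FskX_Unit Y) (FskX_TensA (FskX_RUnit \<X> X) (FskX_Ident \<X> Y)))
       = FskX_Ident \<X> (FskX_Tens X Y)"
    if "X \<in> FskX_Ob \<X>" "Y \<in> FskX_Ob \<X>" for X Y
    by (rule bare_eqI[OF bare_Comp[OF bare_Comp[OF bare_TensA[OF bare_RUnit bare_Ident] bare_Assoc]
            bare_TensA[OF bare_Ident bare_LUnit]] bare_Ident])
      (use that in \<open>auto simp: amap_simps intro: FskX_Tens_Ob FskX_Unit_Ob\<close>)
  show "FskX_Comp \<X> (FskX_Assoc \<X> X Y FskX_Unit) (FskX_RUnit \<X> (FskX_Tens X Y))
      = FskX_TensA (FskX_Ident \<X> X) (FskX_RUnit \<X> Y)"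
    if "X \<in> FskX_Ob \<X>" "Y \<in> FskX_Ob \<X>" for X Y
    by (rule bare_eqI[OF bare_Comp[OF bare_RUnit bare_Assoc] bare_TensA[OF bare_Ident bare_RUnit]])
      (use that in \<open>auto simp: amap_simps intro: FskX_Tens_Ob FskX_Unit_Ob\<close>)
  show "FskX_Comp \<X> (FskX_LUnit \<X> FskX_Unit) (FskX_RUnit \<X> FskX_Unit) = FskX_Ident \<X> FskX_Unit"
    by (rule bare_eqI[OF bare_Comp[OF bare_RUnit bare_LUnit] bare_Ident])
      (use FskX_Unit_Ob in \<open>auto simp: amap_simps\<close>)
qed

end

section \<open>Products of skew monoidal categories\<close>

definition prod_skew :: "('o, 'a) skew_cat \<Rightarrow> ('p, 'b) skew_cat \<Rightarrow> ('o \<times> 'p, 'a \<times> 'b) skew_cat" where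
  "prod_skew C D =
     \<lparr>Ob = Ob C \<times> Ob D,
      Arr = Arr C \<times> Arr D,
      Dom = (\<lambda>f. (Dom C (fst f), Dom D (snd f))),
      Cod = (\<lambda>f. (Cod C (fst f), Cod D (snd f))),
      Ident = (\<lambda>A. (Ident C (fst A), Ident D (snd A))),
      Comp = (\<lambda>g f. (Comp C (fst g) (fst f), Comp D (snd g) (snd f))),
      Unit = (Unit C, Unit D),
      Tens = (\<lambda>A B. (Tens C (fst A) (fst B), Tens D (snd A) (snd B))),
      TensA = (\<lambda>f g. (TensA C (fst f) (fst g), TensA D (snd f) (snd g))),
      Assoc = (\<lambda>A B E. (Assoc C (fst A) (fst B) (fst E), Assoc D (snd A) (snd B) (snd E))),
      LUnit = (\<lambda>A. (LUnit C (fst A), LUnit D (snd A))),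
      RUnit = (\<lambda>A. (RUnit C (fst A), RUnit D (snd A)))\<rparr>"

lemma prod_skew_sel [simp]:
  "Ob (prod_skew C D) = Ob C \<times> Ob D"
  "Arr (prod_skew C D) = Arr C \<times> Arr D"
  "Dom (prod_skew C D) f = (Dom C (fst f), Dom D (snd f))"
  "Cod (prod_skew C D) f = (Cod C (fst f), Cod D (snd f))"
  "Ident (prod_skew C D) A = (Ident C (fst A), Ident D (snd A))"
  "Comp (prod_skew C D) g f = (Comp C (fst g) (fst f), Comp D (snd g) (snd f))"
  "Unit (prod_skew C D) = (Unit C, Unit D)"
  "Tens (prod_skew C D) A B = (Tens C (fst A) (fst B), Tens D (snd A) (snd B))"
  "TensA (prod_skew C D) f g = (TensA C (fst f) (fst g), TensA D (snd f) (snd g))"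
  "Assoc (prod_skew C D) A B E = (Assoc C (fst A) (fst B) (fst E), Assoc D (snd A) (snd B) (snd E))"
  "LUnit (prod_skew C D) A = (LUnit C (fst A), LUnit D (snd A))"
  "RUnit (prod_skew C D) A = (RUnit C (fst A), RUnit D (snd A))"
  by (simp_all add: prod_skew_def)

lemma prod_skew_hom:
  "f \<in> cat_hom (prod_skew C D) A B \<longleftrightarrow>
     fst f \<in> cat_hom C (fst A) (fst B) \<and> snd f \<in> cat_hom D (snd A) (snd B)"
  by (cases f; cases A; cases B) (auto simp: cat_hom_def)

lemma prod_skew_monoidal:
  assumes "skew_monoidal_category C" "skew_monoidal_category D"
  shows "skew_monoidal_category (prod_skew C D)"
proof -
  interpret C: skew_monoidal_category C by fact
  interpret D: skew_monoidal_category D by fact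
  show ?thesis
  proof (intro skew_monoidal_category.intro category.intro skew_monoidal_category_axioms.intro)
  qed (auto simp: prod_skew_hom C.Dom_in D.Dom_in C.Cod_in D.Cod_in C.Unit_in D.Unit_in C.LUnit_RUnit D.LUnit_RUnit
      C.LUnit_Assoc D.LUnit_Assoc C.LUnit_Assoc_RUnit D.LUnit_Assoc_RUnit C.Assoc_RUnit D.Assoc_RUnit
      C.Tens_in D.Tens_in C.TensA_Ident D.TensA_Ident
      intro: C.Ident_in D.Ident_in C.Comp_in D.Comp_in C.Comp_Ident D.Comp_Ident C.Ident_Comp D.Ident_Comp
      C.Comp_assoc D.Comp_assoc C.TensA_in D.TensA_in C.TensA_Comp D.TensA_Comp
      C.Assoc_in D.Assoc_in C.LUnit_in D.LUnit_in C.RUnit_in D.RUnit_in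
      C.Assoc_natural D.Assoc_natural C.LUnit_natural D.LUnit_natural C.RUnit_natural D.RUnit_natural
      C.pentagon D.pentagon)
qed

section \<open>The objects of Fsk(X) as trees\<close>

text \<open>The interpretation of trees in Fsk(X) alone. It will be the first component of
  \<open>ev\<close> in the product model, but is independent of \<open>C\<close>.\<close>

primrec enc :: "'o tree \<Rightarrow> 'o fskx_ob" where
  "enc Unt = FskX_Unit"
| "enc (Leaf A) = FskX_J_ob A"
| "enc (Node s t) = FskX_Tens (enc s) (enc t)"

lemma osz_enc_pos: "0 < osz (enc t)"
  by (induction t) (simp_all add: FskX_Unit_simps FskX_J_ob_simps FskX_Tens_simps)

lemma enc_Ob: "set_tree t \<subseteq> Ob \<X> \<Longrightarrow> enc t \<in> FskX_Ob \<X>"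
  by (induction t) (simp_all add: FskX_Unit_Ob FskX_J_ob_Ob FskX_Tens_Ob)

text \<open>The seam can be recovered from the bracketing: \<open>star_lbf\<close> vanishes at the
  last index of the left factor and is positive afterwards, so two different seams contradict each
  other at the later one.\<close>

lemma FskX_Tens_inj:
  assumes A: "A \<in> FskX_Ob \<X>" "A' \<in> FskX_Ob \<X>" and B: "B \<in> FskX_Ob \<X>" "B' \<in> FskX_Ob \<X>"
    and eq: "FskX_Tens A B = FskX_Tens A' B'"
  shows "A = A' \<and> B = B'"
proof -
  note Ao = FskX_ObD[OF A(1)] and Ao' = FskX_ObD[OF A(2)] and Bo = FskX_ObD[OF B(1)] and Bo' = FskX_ObD[OF B(2)]
  have sz: "osz A + osz B = osz A' + osz B'" using arg_cong[OF eq, of osz] by (simp only: FskX_Tens_simps)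
  have lb: "star_lbf (osz A) (osz B) (olb A) (olb B) = star_lbf (osz A') (osz B') (olb A') (olb B')"
    using arg_cong[OF eq, of olb] by (simp only: FskX_Tens_simps)
  have us: "i \<in> ou A \<or> osz A \<le> i \<and> i - osz A \<in> ou B \<longleftrightarrow> i \<in> ou A' \<or> osz A' \<le> i \<and> i - osz A' \<in> ou B'" for i
    using arg_cong[OF eq, of ou] unfolding FskX_Tens_simps star_set_iff[symmetric] by simp
  have fam: "star_fam (osz A) (ou A) (ou B) (ofam A) (ofam B) = star_fam (osz A') (ou A') (ou B') (ofam A') (ofam B')"
    using arg_cong[OF eq, of snd] by (simp only: FskX_Tens_simps)
  have m: "osz A = osz A'"
  proof (rule linorder_cases[of "osz A" "osz A'"])
    assume "osz A < osz A'"
    then show ?thesis using fun_cong[OF lb, of "osz A' - 1"] Ao(1) Bo'(1) sz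
        star_lbf_simps(2)[OF Ao'(1), of "osz B'" "olb A'" "olb B'"]
      by (simp add: star_lbf_simps(3)[of "osz A"])
  next
    assume "osz A' < osz A"
    then show ?thesis using fun_cong[OF lb, of "osz A - 1"] Ao'(1) Bo(1) sz
        star_lbf_simps(2)[OF Ao(1), of "osz B" "olb A" "olb B"]
      by (simp add: star_lbf_simps(3)[of "osz A'"])
  qed
  then have n: "osz B = osz B'" using sz by simp
  have u: "i \<in> ou A \<longleftrightarrow> i \<in> ou A'" for i
    using us[of i] Ao(2)[of i] Ao'(2)[of i] m by auto
  then have uA: "ou A = ou A'" by blast
  have v: "i \<in> ou B \<longleftrightarrow> i \<in> ou B'" for i
    using us[of "osz A + i"] Ao(2)[of "osz A + i"] Ao'(2)[of "osz A + i"] m by auto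
  then have uB: "ou B = ou B'" by blast
  have "A = A'"
  proof (rule FskX_Ob_eqI[OF A m uA])
    fix i assume i: "i < osz A"
    show "olb A i = olb A' i"
    \<comment> \<open>The tensor has overwritten this value by \<open>0\<close>; membership in
      \<open>Tam\<close> restores it.\<close>
    proof (cases "i = osz A - 1")
      case True
      then show ?thesis using TamD(4)[OF Ao(3)] TamD(4)[OF Ao'(3)] m by simp
    next
      case False
      then show ?thesis using fun_cong[OF lb, of i] i m by (simp add: star_lbf_simps(1))
    qed
  next
    fix i assume i: "i \<in> ou A"
    then show "ofam A i = ofam A' i"
      using fun_cong[OF fam, of i] uA Ao(6) Ao'(6) by (simp add: star_fam_simps(1))
  qed
  moreover have "B = B'"
  proof (rule FskX_Ob_eqI[OF B n uB])
    fix i assume i: "i < osz B"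
    then show "olb B i = olb B' i"
      using fun_cong[OF lb, of "osz A + i"] m n Ao(1) by (simp add: star_lbf_simps(3))
  next
    fix i assume i: "i \<in> ou B"
    then show "ofam B i = ofam B' i"
      using fun_cong[OF fam, of "osz A + i"] uB m by (simp add: star_fam_simps(2))
  qed
  ultimately show ?thesis ..
qed

lemma enc_inj:
  fixes \<X> :: "('o, 'a) cat"
  shows "set_tree s \<subseteq> Ob \<X> \<Longrightarrow> set_tree t \<subseteq> Ob \<X> \<Longrightarrow> enc s = enc t \<Longrightarrow> s = t"
proof (induction s arbitrary: t)
  case Unt
  then show ?case
  proof (cases t)
    case (Leaf A)
    then show ?thesis using arg_cong[OF Unt(3), of ou] by (simp add: FskX_Unit_simps FskX_J_ob_simps lessThan_Suc)
  next
    case (Node t1 t2)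
    then show ?thesis using arg_cong[OF Unt(3), of osz] osz_enc_pos[of t1] osz_enc_pos[of t2]
      by (simp add: FskX_Unit_simps FskX_Tens_simps)
  qed simp
next
  case (Leaf A)
  then show ?case
  proof (cases t)
    case Unt
    then show ?thesis using arg_cong[OF Leaf(3), of ou] by (simp add: FskX_Unit_simps FskX_J_ob_simps lessThan_Suc)
  next
    case l: (Leaf B)
    then show ?thesis using fun_cong[OF arg_cong[OF Leaf(3), of snd], of 0] by (simp add: FskX_J_ob_simps)
  next
    case (Node t1 t2)
    then show ?thesis using arg_cong[OF Leaf(3), of osz] osz_enc_pos[of t1] osz_enc_pos[of t2]
      by (simp add: FskX_J_ob_simps FskX_Tens_simps)
  qed
next
  case (Node s1 s2)
  show ?case
  proof (cases t)
    case Unt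
    then show ?thesis using arg_cong[OF Node.prems(3), of osz] osz_enc_pos[of s1] osz_enc_pos[of s2]
      by (simp add: FskX_Unit_simps FskX_Tens_simps)
  next
    case (Leaf A)
    then show ?thesis using arg_cong[OF Node.prems(3), of osz] osz_enc_pos[of s1] osz_enc_pos[of s2]
      by (simp add: FskX_J_ob_simps FskX_Tens_simps)
  next
    case n: (Node t1 t2)
    then have "enc s1 = enc t1 \<and> enc s2 = enc t2"
      using Node.prems by (intro FskX_Tens_inj[of _ \<X>]) (simp_all add: enc_Ob)
    then show ?thesis using Node.IH[of t1] Node.IH(2)[of t2] Node.prems n by simp
  qed
qed

lemma FskX_Ob_split:
  assumes A: "A \<in> FskX_Ob \<X>" and m: "1 < osz A"
  shows "\<exists>B\<in>FskX_Ob \<X>. \<exists>E\<in>FskX_Ob \<X>. A = FskX_Tens B E"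
proof -
  note Ao = FskX_ObD[OF A]
  define l m where "l = olb A" and "m = osz A"
  note l = TamD[OF Ao(3), folded l_def m_def]
  let ?K = "{j. j < m - 1 \<and> l j = 0}"
  \<comment> \<open>\<open>star_lbf p\<close> is positive from \<open>p\<close> on, so the last zero of \<open>l\<close> marks the end of the left factor.\<close>
  define p where "p = Suc (Max ?K)"
  have fin: "finite ?K" by simp
  have "0 \<in> ?K" using l(2)[of 0] m by (simp add: m_def)
  then have "?K \<noteq> {}" by blast
  with fin have "Max ?K \<in> ?K" by (rule Max_in)
  then have p: "0 < p" "p < m" "l (p - 1) = 0" by (auto simp: p_def)
  \<comment> \<open>A value below \<open>p\<close> at a later index would by nesting be at most
    \<open>l (p - 1) = 0\<close>, a zero after the last one.\<close>
  have l_ge: "p \<le> l j" if "p \<le> j" "j < m" for j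
  proof (rule ccontr)
    assume n: "\<not> p \<le> l j"
    then have "l j \<le> l (p - 1)" using l(3)[of j "p - 1"] that by simp
    then have z: "l j = 0" using p by simp
    then have "j < m - 1" using l(4) that p by (cases "j = m - 1") auto
    then have "j \<le> Max ?K" using fin z by (intro Max_ge) auto
    then show False using that by (simp add: p_def)
  qed
  \<comment> \<open>The last value of the left factor goes back from \<open>0\<close> to the
    conventional \<open>p - 1\<close>, and values on the right factor are shifted down by
    \<open>p\<close>.\<close>
  define B where "B = ((p, ou A \<inter> {..<p}, \<lambda>i\<in>{..<p}. if i = p - 1 then p - 1 else l i), \<lambda>i\<in>ou A \<inter> {..<p}. ofam A i)"
  define E where "E = ((m - p, {j. p + j \<in> ou A}, \<lambda>i\<in>{..<m - p}. l (p + i) - p), \<lambda>i\<in>{j. p + j \<in> ou A}. ofam A (p + i))"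
  have BTam: "(\<lambda>i\<in>{..<p}. if i = p - 1 then p - 1 else l i) \<in> Tam p" (is "?l \<in> _")
    unfolding Tam_def
  proof (intro CollectI conjI allI impI)
    have le: "?l j \<le> j" if "j < p" for j using l(2)[of j] that p by auto
    then show "?l j \<le> j" if "j < p" for j using that .
    have "?l j < p" if "j < p" for j using le[OF that] that by simp
    then show "?l \<in> {..<p} \<rightarrow>\<^sub>E {..<p}" by (intro PiE_I) (simp, simp)
    show "?l (p - 1) = p - 1" using p by simp
    fix j i assume "j < p" "?l j \<le> i \<and> i \<le> j"
    then show "?l j \<le> ?l i" using l(3)[of j i] p l(2)[of j] by (auto split: if_splits)
  qed
  have ETam: "(\<lambda>i\<in>{..<m - p}. l (p + i) - p) \<in> Tam (m - p)" (is "?l \<in> _")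
    unfolding Tam_def
  proof (intro CollectI conjI allI impI)
    have le: "?l j \<le> j" if "j < m - p" for j
      using l(2)[of "p + j"] that le_diff_conv[of "l (p + j)" p j] less_diff_conv[of j m p] by (simp add: add.commute)
    then show "?l j \<le> j" if "j < m - p" for j using that .
    have "?l j < m - p" if "j < m - p" for j using le[OF that] that by simp
    then show "?l \<in> {..<m - p} \<rightarrow>\<^sub>E {..<m - p}" by (intro PiE_I) (simp, simp)
    have "m - p - 1 < m - p" using p by arith
    then show "?l (m - p - 1) = m - p - 1" using p l(4) by simp
    fix j i assume j: "j < m - p" and i: "?l j \<le> i \<and> i \<le> j"
    have "l (p + j) \<le> l (p + i)" using i j by (intro l(3)) auto
    then show "?l j \<le> ?l i" using i j by simp
  qed
  have B: "B \<in> FskX_Ob \<X>" using BTam p Ao by (auto simp: B_def FskX_Ob_iff)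
  have E: "E \<in> FskX_Ob \<X>" using ETam p Ao by (auto simp: E_def FskX_Ob_iff m_def less_diff_conv add.commute)
  have "A = FskX_Tens B E"
  proof (rule FskX_Ob_eqI[OF A FskX_Tens_Ob[OF B E]])
    show "osz A = osz (FskX_Tens B E)" using p by (simp add: FskX_Tens_simps B_def E_def m_def)
    show "ou A = ou (FskX_Tens B E)" by (auto simp: FskX_Tens_simps B_def E_def star_set_iff)
  next
    fix i assume i: "i < osz A"
    have "l i = star_lbf p (m - p) (olb B) (olb E) i"
    proof (cases "i < p")
      case True
      then show ?thesis using p by (auto simp: star_lbf_def B_def)
    next
      case False
      then show ?thesis using l_ge[of i] i p by (auto simp: star_lbf_def E_def m_def)
    qed
    then show "olb A i = olb (FskX_Tens B E) i" by (simp add: FskX_Tens_simps l_def) (simp add: B_def E_def)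
  next
    fix i assume "i \<in> ou A"
    then show "ofam A i = ofam (FskX_Tens B E) i"
      by (auto simp: FskX_Tens_simps B_def E_def star_fam_def star_set_iff)
  qed
  then show ?thesis using B E by blast
qed

text \<open>Tensor factors are peeled off down to size one, where the bracketing is forced and
  \<open>u\<close> decides between the unit and a leaf. With \<open>enc_inj\<close>, each object of
  Fsk(X) has exactly one tree.\<close>

lemma enc_surj: "A \<in> FskX_Ob \<X> \<Longrightarrow> \<exists>t. set_tree t \<subseteq> Ob \<X> \<and> enc t = A"
proof (induction "osz A" arbitrary: A rule: less_induct)
  case less
  note Ao = FskX_ObD[OF less.prems]
  show ?case
  proof (cases "osz A = 1")
    case True
    have l: "olb A = (\<lambda>i\<in>{..<1}. 0)" using Tam_1(2) Ao(3) True by simp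
    have u: "ou A = {} \<or> ou A = {..<1}" using Ao(6) True by auto
    show ?thesis
    proof (cases "ou A = {}")
      case e: True
      have "A = FskX_Unit"
        by (rule FskX_Ob_eqI[OF less.prems FskX_Unit_Ob]) (use True l e in \<open>auto simp: FskX_Unit_simps\<close>)
      then show ?thesis by (intro exI[of _ Unt]) simp
    next
      case False
      then have u: "ou A = {..<1}" using u by simp
      then have o: "ofam A 0 \<in> Ob \<X>" using Ao(4)[of 0] by simp
      have "A = FskX_J_ob (ofam A 0)"
        by (rule FskX_Ob_eqI[OF less.prems FskX_J_ob_Ob[OF o]]) (use True l u in \<open>auto simp: FskX_J_ob_simps\<close>)
      then show ?thesis using o by (intro exI[of _ "Leaf (ofam A 0)"]) simp
    qed
  next
    case False
    then obtain B E where BE: "B \<in> FskX_Ob \<X>" "E \<in> FskX_Ob \<X>" "A = FskX_Tens B E"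
      using FskX_Ob_split[OF less.prems] Ao(1) by (metis One_nat_def Suc_lessI)
    have "osz B < osz A" "osz E < osz A"
      using FskX_ObD(1)[OF BE(1)] FskX_ObD(1)[OF BE(2)] by (auto simp: BE(3) FskX_Tens_simps)
    then obtain s t where "set_tree s \<subseteq> Ob \<X>" "enc s = B" "set_tree t \<subseteq> Ob \<X>" "enc t = E"
      using less.hyps BE by metis
    then show ?thesis using BE by (intro exI[of _ "Node s t"]) simp
  qed
qed

lemma (in base_category) FskX_J_functor: "is_functor \<X> (FskX \<X>) (FskX_J \<X>)"
proof -
  have hom: "on_arr (FskX_J \<X>) f \<in> fhom (FskX_J_ob A) (FskX_J_ob B)" if f: "f \<in> cat_hom \<X> A B" for f A B
  proof -
    have o: "A \<in> Ob \<X>" "B \<in> Ob \<X>" "f \<in> Arr \<X>" "Dom \<X> f = A" "Cod \<X> f = B" using hom_Ob[OF f] cat_homD[OF f] by auto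
    have "(FskX_J_ob A, FskX_J_ob B, \<lambda>i\<in>{..<1::nat}. i, \<lambda>i\<in>{..<1::nat}. f) \<in> fhom (FskX_J_ob A) (FskX_J_ob B)"
      by (rule FskX_homI[OF FskX_J_ob_Ob[OF o(1)] FskX_J_ob_Ob[OF o(2)]])
        (use f in \<open>auto simp: skew_map_iff FskX_J_ob_simps mono_on_def\<close>)
    then show ?thesis using o by (simp add: FskX_J_def)
  qed
  show ?thesis
    unfolding is_functor_def FskX_sel
  proof (intro conjI ballI impI)
    show "on_ob (FskX_J \<X>) \<in> Ob \<X> \<rightarrow>\<^sub>E FskX_Ob \<X>" by (auto simp: FskX_J_def FskX_J_ob_Ob)
    show "on_arr (FskX_J \<X>) \<in> Arr \<X> \<rightarrow>\<^sub>E FskX_Arr \<X>"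
      using cat_homD(1)[OF hom[OF cat_homI]] by (intro PiE_I) (auto simp: FskX_J_def)
    fix f assume f: "f \<in> Arr \<X>"
    show "fst (on_arr (FskX_J \<X>) f) = on_ob (FskX_J \<X>) (Dom \<X> f)" "fst (snd (on_arr (FskX_J \<X>) f)) = on_ob (FskX_J \<X>) (Cod \<X> f)"
      using f Dom_in Cod_in by (auto simp: FskX_J_def)
    fix g assume g: "g \<in> Arr \<X>" "Cod \<X> f = Dom \<X> g"
    have "Comp \<X> g f \<in> cat_hom \<X> (Dom \<X> f) (Cod \<X> g)" using f g by (intro Comp_in) (auto simp: cat_hom_def)
    then show "on_arr (FskX_J \<X>) (Comp \<X> g f) = FskX_Comp \<X> (on_arr (FskX_J \<X>) g) (on_arr (FskX_J \<X>) f)"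
      using f g by (auto simp: FskX_J_def FskX_arrow_simps FskX_J_ob_simps compose_def fun_eq_iff dest: cat_homD)
  next
    fix A assume A: "A \<in> Ob \<X>"
    then show "on_arr (FskX_J \<X>) (Ident \<X> A) = FskX_Ident \<X> (on_ob (FskX_J \<X>) A)"
      using cat_homD[OF Ident_in[OF A]] by (auto simp: FskX_J_def FskX_arrow_simps FskX_J_ob_simps)
  qed
qed

section \<open>Factoring arrows of Fsk(X)\<close>

context base_category
begin

text \<open>What \<open>lstep\<close> and \<open>spl\<close> amount to in Fsk(X). By the truncated subtraction, the values of the left
  bracketing function which refer to leaves outside the new tree become \<open>0\<close>.\<close>

definition lstep_data :: "'o fskx_ob \<Rightarrow> 'o fskx_ob \<Rightarrow> ('o, 'a) fskx_arr \<Rightarrow> bool" where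
  "lstep_data A A' l \<longleftrightarrow> bare A A' l \<and> osz A = Suc (osz A') \<and> (\<forall>i. i \<in> ou A \<longleftrightarrow> 0 < i \<and> i - 1 \<in> ou A') \<and>
     (\<forall>i<osz A. amap l i = i - 1) \<and> (\<forall>i<osz A'. olb A' i = olb A (Suc i) - 1)"

definition spl_data :: "'o fskx_ob \<Rightarrow> 'o fskx_ob \<Rightarrow> 'o fskx_ob \<Rightarrow> ('o, 'a) fskx_arr \<Rightarrow> bool" where
  "spl_data A Q E k \<longleftrightarrow> Q \<in> FskX_Ob \<X> \<and> E \<in> FskX_Ob \<X> \<and> bare A (FskX_Tens Q E) k \<and>
     Suc (osz A) = osz Q + osz E \<and>
     (\<forall>i<osz A. amap k i = (if i < osz Q then i else Suc i)) \<and>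
     (\<forall>i<osz Q. i \<in> ou Q \<longleftrightarrow> i \<in> ou A) \<and>
     (\<forall>i. i \<in> ou E \<longleftrightarrow> 0 < i \<and> osz Q + (i - 1) \<in> ou A) \<and>
     (\<forall>i. Suc i < osz Q \<longrightarrow> olb Q i = olb A i) \<and>
     (osz Q < osz A \<longrightarrow> olb A (osz Q - 1) = 0) \<and>
     (\<forall>i. Suc i < osz E \<longrightarrow> olb E (Suc i) = Suc (olb A (osz Q + i)) - osz Q)"

lemma lstep_data_simps:
  assumes "lstep_data A A' l"
  shows "fst l = A" "osz A = Suc (osz A')" "i < osz A \<Longrightarrow> amap l i = i - 1"
  using assms by (simp_all add: lstep_data_def bare_def FskX_hom_iff)

lemma spl_data_simps:
  assumes "spl_data A Q E k"
  shows "fst k = A" "Suc (osz A) = osz Q + osz E" "i < osz A \<Longrightarrow> amap k i = (if i < osz Q then i else Suc i)"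
  using assms by (simp_all add: spl_data_def bare_def FskX_hom_iff)

lemma lstep_data_unit:
  assumes "A \<in> FskX_Ob \<X>"
  shows "lstep_data (FskX_Tens FskX_Unit A) A (FskX_LUnit \<X> A)"
  unfolding lstep_data_def
proof (intro conjI allI impI)
  show "bare (FskX_Tens FskX_Unit A) A (FskX_LUnit \<X> A)" using bare_LUnit[OF assms] .
qed (auto simp: FskX_Tens_simps FskX_Unit_simps star_set_iff FskX_arrow_simps star_lbf_simps(3))

lemma lstep_data_Tens:
  assumes d: "lstep_data A A' l" and Q: "Q \<in> FskX_Ob \<X>"
  shows "lstep_data (FskX_Tens A Q) (FskX_Tens A' Q) (FskX_TensA l (FskX_Ident \<X> Q))"
proof -
  have b: "bare A A' l" and sz: "osz A = Suc (osz A')" and us: "\<And>i. i \<in> ou A \<longleftrightarrow> 0 < i \<and> i - 1 \<in> ou A'"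
    and am: "\<And>i. i < osz A \<Longrightarrow> amap l i = i - 1" and lb: "\<And>i. i < osz A' \<Longrightarrow> olb A' i = olb A (Suc i) - 1"
    using d by (auto simp: lstep_data_def)
  note L = FskX_homD[OF bare_hom[OF b]]
  note Ao = FskX_ObD[OF L(4)]
  show ?thesis
    unfolding lstep_data_def
  proof (intro conjI allI impI)
    show "bare (FskX_Tens A Q) (FskX_Tens A' Q) (FskX_TensA l (FskX_Ident \<X> Q))"
      by (rule bare_TensA[OF b bare_Ident[OF Q]])
    show "osz (FskX_Tens A Q) = Suc (osz (FskX_Tens A' Q))" using sz by (simp add: FskX_Tens_simps)
    show "i \<in> ou (FskX_Tens A Q) \<longleftrightarrow> 0 < i \<and> i - 1 \<in> ou (FskX_Tens A' Q)" for i
      using us[of i] sz by (cases i) (auto simp: FskX_Tens_simps star_set_iff)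
    show "amap (FskX_TensA l (FskX_Ident \<X> Q)) i = i - 1" if "i < osz (FskX_Tens A Q)" for i
      using that am[of i] sz L(1,2) by (auto simp: FskX_Tens_simps FskX_arrow_simps ord_sum_def)
    fix i assume i: "i < osz (FskX_Tens A' Q)"
    consider "i < osz A' - 1" | "i = osz A' - 1" | "osz A' \<le> i" by linarith
    then show "olb (FskX_Tens A' Q) i = olb (FskX_Tens A Q) (Suc i) - 1"
    proof cases
      case 1
      then show ?thesis using lb[of i] sz by (simp add: FskX_Tens_simps star_lbf_simps)
    next
      case 2
      then have "Suc i = osz A - 1" using sz Ao(1) by simp
      then show ?thesis using 2 Ao(1) star_lbf_simps(2)[of "osz A'"] star_lbf_simps(2)[of "osz A"] sz
        by (simp only: FskX_Tens_simps)
    next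
      case 3
      then show ?thesis using i sz Ao(1) by (simp add: FskX_Tens_simps star_lbf_simps)
    qed
  qed
qed

lemma spl_data_unit:
  assumes "A \<in> FskX_Ob \<X>"
  shows "spl_data A A FskX_Unit (FskX_RUnit \<X> A)"
  unfolding spl_data_def
proof (intro conjI allI impI)
  show "bare A (FskX_Tens A FskX_Unit) (FskX_RUnit \<X> A)" using bare_RUnit[OF assms] .
  show "i \<in> ou FskX_Unit \<longleftrightarrow> 0 < i \<and> osz A + (i - 1) \<in> ou A" for i
    using FskX_ObD(2)[OF assms, of "osz A + (i - 1)"] by (auto simp: FskX_Unit_simps)
qed (use assms FskX_Unit_Ob in \<open>auto simp: FskX_Tens_simps FskX_Unit_simps FskX_arrow_simps\<close>)

lemma spl_data_Tens:
  assumes d: "spl_data A Q E k" and R: "R \<in> FskX_Ob \<X>"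
  shows "spl_data (FskX_Tens A R) Q (FskX_Tens E R)
    (FskX_Comp \<X> (FskX_Assoc \<X> Q E R) (FskX_TensA k (FskX_Ident \<X> R)))"
proof -
  have Q: "Q \<in> FskX_Ob \<X>" and E: "E \<in> FskX_Ob \<X>" and b: "bare A (FskX_Tens Q E) k"
    and sz: "Suc (osz A) = osz Q + osz E"
    and am: "\<And>i. i < osz A \<Longrightarrow> amap k i = (if i < osz Q then i else Suc i)"
    and uQ: "\<And>i. i < osz Q \<Longrightarrow> i \<in> ou Q \<longleftrightarrow> i \<in> ou A"
    and uE: "\<And>i. i \<in> ou E \<longleftrightarrow> 0 < i \<and> osz Q + (i - 1) \<in> ou A"
    and lQ: "\<And>i. Suc i < osz Q \<Longrightarrow> olb Q i = olb A i"
    and lz: "osz Q < osz A \<Longrightarrow> olb A (osz Q - 1) = 0"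
    and lE: "\<And>i. Suc i < osz E \<Longrightarrow> olb E (Suc i) = Suc (olb A (osz Q + i)) - osz Q"
    using d by (auto simp: spl_data_def)
  note K = FskX_homD[OF bare_hom[OF b]]
  note Ao = FskX_ObD[OF K(3)] and Qo = FskX_ObD[OF Q] and Eo = FskX_ObD[OF E] and Ro = FskX_ObD[OF R]
  let ?k = "FskX_Comp \<X> (FskX_Assoc \<X> Q E R) (FskX_TensA k (FskX_Ident \<X> R))"
  show ?thesis
    unfolding spl_data_def
  proof (intro conjI allI impI Q FskX_Tens_Ob[OF E R])
    show "bare (FskX_Tens A R) (FskX_Tens Q (FskX_Tens E R)) ?k"
      by (rule bare_Comp[OF bare_TensA[OF b bare_Ident[OF R]] bare_Assoc[OF Q E R]])
    show "Suc (osz (FskX_Tens A R)) = osz Q + osz (FskX_Tens E R)" using sz by (simp add: FskX_Tens_simps)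
  next
    fix i assume i: "i < osz (FskX_Tens A R)"
    have t: "fst k = A" "fst (snd k) = FskX_Tens Q E" using K by auto
    have "amap (FskX_TensA k (FskX_Ident \<X> R)) i = (if i < osz Q then i else Suc i)"
      using i am[of i] sz Eo(1) t by (auto simp: FskX_arrow_simps FskX_Tens_simps ord_sum_def)
    then show "amap ?k i = (if i < osz Q then i else Suc i)"
      using i sz Eo(1) t by (simp add: FskX_arrow_simps FskX_Tens_simps compose_def)
  next
    fix i assume "i < osz Q"
    then show "i \<in> ou Q \<longleftrightarrow> i \<in> ou (FskX_Tens A R)" using uQ[of i] sz Eo(1) by (auto simp: FskX_Tens_simps star_set_iff)
  next
    fix i
    show "i \<in> ou (FskX_Tens E R) \<longleftrightarrow> 0 < i \<and> osz Q + (i - 1) \<in> ou (FskX_Tens A R)"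
    proof -
      have "osz E \<le> i \<longleftrightarrow> 0 < i \<and> osz A \<le> osz Q + (i - 1)" using sz Eo(1) Qo(1) by arith
      moreover have "i - osz E = osz Q + (i - 1) - osz A" if "0 < i" using sz that Eo(1) by arith
      ultimately show ?thesis using uE[of i] by (auto simp: FskX_Tens_simps star_set_iff)
    qed
  next
    fix i assume "Suc i < osz Q"
    then show "olb Q i = olb (FskX_Tens A R) i" using lQ[of i] sz Eo(1) by (simp add: FskX_Tens_simps star_lbf_simps(1))
  next
    assume "osz Q < osz (FskX_Tens A R)"
    show "olb (FskX_Tens A R) (osz Q - 1) = 0"
    proof (cases "osz Q < osz A")
      case True
      then show ?thesis using lz Qo(1) by (simp add: FskX_Tens_simps star_lbf_simps(1) diff_less_mono)
    next
      case False
      then have "osz Q = osz A" using sz Eo(1) by simp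
      then show ?thesis using star_lbf_simps(2)[OF Ao(1)] by (simp add: FskX_Tens_simps)
    qed
  next
    fix i assume i: "Suc i < osz (FskX_Tens E R)"
    consider "Suc i < osz E - 1" | "Suc i = osz E - 1" | "osz E \<le> Suc i" by linarith
    then show "olb (FskX_Tens E R) (Suc i) = Suc (olb (FskX_Tens A R) (osz Q + i)) - osz Q"
    proof cases
      case 1
      then have "osz Q + i < osz A - 1" using sz by arith
      then show ?thesis using lE[of i] 1 by (simp add: FskX_Tens_simps star_lbf_simps(1))
    next
      case 2
      then have "osz Q + i = osz A - 1" using sz by arith
      then show ?thesis using 2 star_lbf_simps(2)[OF Ao(1)] star_lbf_simps(2)[OF Eo(1)] Qo(1)
        by (simp only: FskX_Tens_simps)
    next
      case 3
      then have *: "osz A \<le> osz Q + i" "osz Q + i < osz A + osz R" "osz Q + i - osz A = Suc i - osz E"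
        using i sz by (auto simp: FskX_Tens_simps)
      have "olb (FskX_Tens E R) (Suc i) = osz E + olb R (Suc i - osz E)"
        using 3 i Eo(1) by (simp add: FskX_Tens_simps star_lbf_simps(3))
      moreover have "olb (FskX_Tens A R) (osz Q + i) = osz A + olb R (Suc i - osz E)"
        using * Ao(1) by (simp add: FskX_Tens_simps star_lbf_simps(3))
      ultimately show ?thesis using sz by arith
    qed
  qed
qed

text \<open>The contraction is surjective, identifies just the leaves \<open>0\<close> and
  \<open>1\<close>, and has identity components. An arrow that agrees on these two leaves therefore
  descends by a shift of indices, in only one way.\<close>

lemma lstep_factor:
  assumes d: "lstep_data A A' l" and a: "a \<in> fhom A B" and sz1: "1 < osz A" and z: "amap a 1 = 0"
  shows "\<exists>!a'. a' \<in> fhom A' B \<and> a = FskX_Comp \<X> a' l"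
proof -
  have b: "bare A A' l" and sz: "osz A = Suc (osz A')" and us: "\<And>i. i \<in> ou A \<longleftrightarrow> 0 < i \<and> i - 1 \<in> ou A'"
    and am: "\<And>i. i < osz A \<Longrightarrow> amap l i = i - 1" and lb: "\<And>i. i < osz A' \<Longrightarrow> olb A' i = olb A (Suc i) - 1"
    using d by (auto simp: lstep_data_def)
  note L = FskX_homD[OF bare_hom[OF b]] and H = FskX_homD[OF a]
  note Ao = FskX_ObD[OF L(3)] and Ao' = FskX_ObD[OF L(4)]
  have sk: "mono_on {..<osz A} (amap a)" "amap a 0 = 0" "amap a ` ou A = ou B"
    "\<And>i. \<lbrakk>i \<in> ou A; Suc i < osz A\<rbrakk> \<Longrightarrow> amap a i < amap a (Suc i)"
    "\<And>j k. \<lbrakk>Suc j < osz A; amap a j \<le> k; k < amap a (Suc j)\<rbrakk> \<Longrightarrow> amap a (olb A j) \<le> olb B k"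
    using H(5) by (auto simp: skew_map_iff)
  have ouA: "ou A = Suc ` ou A'"
  proof (intro equalityI subsetI)
    fix i assume "i \<in> ou A"
    then have "0 < i" "i - 1 \<in> ou A'" using us by auto
    then show "i \<in> Suc ` ou A'" by (intro image_eqI[of _ _ "i - 1"]) auto
  next
    fix i assume "i \<in> Suc ` ou A'"
    then obtain j where "i = Suc j" "j \<in> ou A'" by blast
    then show "i \<in> ou A" using us[of i] by simp
  qed
  have fam: "ofam A (Suc i) = ofam A' i" if "i \<in> ou A'" for i
  proof -
    have i: "Suc i \<in> ou A" using us[of "Suc i"] that by simp
    then have "ofam A' (amap l (Suc i)) = ofam A (Suc i)" using b unfolding bare_def by blast
    then show ?thesis using am[OF Ao(2)[OF i]] by simp
  qed
  let ?a = "(A', B, \<lambda>i\<in>{..<osz A'}. amap a (Suc i), \<lambda>i\<in>ou A'. afam a (Suc i))"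
  show ?thesis
  proof (rule ex1I[of _ ?a], rule conjI)
    show a': "?a \<in> fhom A' B"
    proof (rule FskX_homI[OF L(4) H(4)])
      show "skew_map (fst A') (fst B) (\<lambda>i\<in>{..<osz A'}. amap a (Suc i))" (is "skew_map _ _ ?\<phi>")
        unfolding skew_map_iff
      proof (intro conjI allI impI ballI)
        show "?\<phi> \<in> {..<osz A'} \<rightarrow>\<^sub>E {..<osz B}" using H(6) sz by (intro PiE_I) auto
        show "mono_on {..<osz A'} ?\<phi>" using sk(1) sz by (auto simp: mono_on_def)
        show "?\<phi> 0 = 0" using z Ao'(1) by simp
        have "?\<phi> ` ou A' = (\<lambda>i. amap a (Suc i)) ` ou A'" using Ao'(2) by (intro image_cong) auto
        then show "?\<phi> ` ou A' = ou B" using sk(3) by (simp add: ouA image_image)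
      next
        fix i assume "i \<in> ou A'" "Suc i < osz A'"
        then show "?\<phi> i < ?\<phi> (Suc i)" using sk(4)[of "Suc i"] ouA sz by simp
      next
        fix j k assume j: "Suc j < osz A'" "?\<phi> j \<le> k" "k < ?\<phi> (Suc j)"
        have "amap a (olb A (Suc j)) \<le> olb B k" using sk(5)[of "Suc j" k] j sz by simp
        moreover have "olb A' j < osz A'" using TamD(1)[OF Ao'(3)] j by simp
        \<comment> \<open>If \<open>olb A (Suc j)\<close> is \<open>0\<close>, truncation makes
          \<open>olb A' j\<close> equal to \<open>0\<close>, which is sent to
          \<open>amap a 1 = 0\<close>.\<close>
        ultimately show "?\<phi> (olb A' j) \<le> olb B k"
          using lb[of j] j z by (cases "olb A (Suc j)") auto
      qed
      show "(\<lambda>i\<in>ou A'. afam a (Suc i)) \<in> (\<Pi>\<^sub>E i\<in>ou A'. cat_hom \<X> (ofam A' i) (ofam B ((\<lambda>i\<in>{..<osz A'}. amap a (Suc i)) i)))"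
        using H(8) ouA fam Ao'(2) by (intro PiE_I) (fastforce, simp)
    qed
    show "a = FskX_Comp \<X> ?a l"
    proof (rule FskX_hom_eqI[OF a FskX_Comp_in[OF bare_hom[OF b] a']])
      fix i assume i: "i < osz A"
      show "amap a i = amap (FskX_Comp \<X> ?a l) i"
        using i am[OF i] sz z sk(2) Ao'(1) L(1) by (cases i) (simp_all add: FskX_arrow_simps(2) compose_def)
    next
      fix i assume i: "i \<in> ou A"
      then obtain j where j: "i = Suc j" "j \<in> ou A'" using ouA by auto
      have "afam l i = Ident \<X> (ofam A i)" using b i by (simp add: bare_def)
      then show "afam a i = afam (FskX_Comp \<X> ?a l) i"
        using j i am[of i] Ao(2)[OF i] L(1) H(9)[OF i] by (simp add: FskX_arrow_simps(2))
    qed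
  next
    fix a' assume a': "a' \<in> fhom A' B \<and> a = FskX_Comp \<X> a' l"
    then have h: "a' \<in> fhom A' B" and eq: "a = FskX_Comp \<X> a' l" by auto
    have am': "amap a' i = amap a (Suc i)" if "i < osz A'" for i
      using that am[of "Suc i"] sz L(1) unfolding eq by (simp add: FskX_arrow_simps(2) compose_def)
    have af': "afam a' i = afam a (Suc i)" if i: "i \<in> ou A'" for i
    proof -
      have "afam l (Suc i) = Ident \<X> (ofam A' i)" using b ouA i fam[OF i] by (simp add: bare_def)
      then show ?thesis
        using i am[of "Suc i"] Ao(2)[of "Suc i"] L(1) ouA FskX_homD(9)[OF h i] unfolding eq by (simp add: FskX_arrow_simps(2))
    qed
    have ax: "amap a' \<in> extensional {..<osz A'}" "afam a' \<in> extensional (ou A')"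
      using h unfolding FskX_hom_iff skew_map_iff by (auto simp: PiE_def)
    have "amap a' = (\<lambda>i\<in>{..<osz A'}. amap a (Suc i))" "afam a' = (\<lambda>i\<in>ou A'. afam a (Suc i))"
      using ax am' af' by (auto intro!: extensionalityI[OF _ restrict_extensional])
    then show "a' = ?a" using FskX_homD(1,2)[OF h] by (simp add: prod_eq_iff)
  qed
qed

text \<open>Since the leaves of \<open>Q\<close> are exactly those sent into \<open>B\<close>,
  \<open>f\<close> and \<open>h\<close> have to be the two restrictions of \<open>a\<close>. The
  function of \<open>k\<close> misses only leaf \<open>0\<close> of \<open>E\<close>, the inserted
  unit, and every morphism sends \<open>0\<close> to \<open>0\<close>; hence uniqueness.\<close>

lemma spl_factor:
  assumes d: "spl_data A Q E k" and B: "B \<in> FskX_Ob \<X>" and C: "C \<in> FskX_Ob \<X>"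
    and a: "a \<in> fhom A (FskX_Tens B C)" and split: "\<And>i. i < osz A \<Longrightarrow> amap a i < osz B \<longleftrightarrow> i < osz Q"
  shows "\<exists>f h. f \<in> fhom Q B \<and> h \<in> fhom E C \<and> a = FskX_Comp \<X> (FskX_TensA f h) k \<and>
    (\<forall>f' h'. f' \<in> fhom Q B \<and> h' \<in> fhom E C \<and> a = FskX_Comp \<X> (FskX_TensA f' h') k \<longrightarrow> f' = f \<and> h' = h)"
proof -
  have Q: "Q \<in> FskX_Ob \<X>" and E: "E \<in> FskX_Ob \<X>" and b: "bare A (FskX_Tens Q E) k"
    and sz: "Suc (osz A) = osz Q + osz E"
    and am: "\<And>i. i < osz A \<Longrightarrow> amap k i = (if i < osz Q then i else Suc i)"
    and uQ: "\<And>i. i < osz Q \<Longrightarrow> i \<in> ou Q \<longleftrightarrow> i \<in> ou A"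
    and uE: "\<And>i. i \<in> ou E \<longleftrightarrow> 0 < i \<and> osz Q + (i - 1) \<in> ou A"
    and lQ: "\<And>i. Suc i < osz Q \<Longrightarrow> olb Q i = olb A i"
    and lE: "\<And>i. Suc i < osz E \<Longrightarrow> olb E (Suc i) = Suc (olb A (osz Q + i)) - osz Q"
    using d by (auto simp: spl_data_def)
  note K = FskX_homD[OF bare_hom[OF b]] and H = FskX_homD[OF a]
  note Ao = FskX_ObD[OF K(3)] and Qo = FskX_ObD[OF Q] and Eo = FskX_ObD[OF E] and Bo = FskX_ObD[OF B] and Co = FskX_ObD[OF C]
  let ?q = "osz Q" and ?b = "osz B" and ?\<phi> = "amap a"
  have sk: "mono_on {..<osz A} ?\<phi>" "?\<phi> 0 = 0" "?\<phi> ` ou A = star_set ?b (ou B) (ou C)"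
    "\<And>i. \<lbrakk>i \<in> ou A; Suc i < osz A\<rbrakk> \<Longrightarrow> ?\<phi> i < ?\<phi> (Suc i)"
    "\<And>j k. \<lbrakk>Suc j < osz A; ?\<phi> j \<le> k; k < ?\<phi> (Suc j)\<rbrakk> \<Longrightarrow> ?\<phi> (olb A j) \<le> star_lbf ?b (osz C) (olb B) (olb C) k"
    using H(5) by (auto simp: skew_map_iff FskX_Tens_simps)
  have mon: "?\<phi> i \<le> ?\<phi> j" if "i \<le> j" "j < osz A" for i j using sk(1) that by (auto simp: mono_on_def)
  have ou_k: "amap k i \<in> star_set ?q (ou Q) (ou E)" "ofam (FskX_Tens Q E) (amap k i) = ofam A i" if "i \<in> ou A" for i
    using K(7)[OF that] b that by (auto simp: bare_def FskX_Tens_simps)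
  have famQ: "i \<in> ou A \<and> ofam Q i = ofam A i" if i: "i \<in> ou Q" for i
  proof -
    have "i \<in> ou A" using uQ[of i] Qo(2)[OF i] i by simp
    then show ?thesis using ou_k(2)[of i] am[of i] Ao(2)[of i] Qo(2)[OF i] i Qo(6)
      by (simp add: FskX_Tens_simps star_fam_simps)
  qed
  have famE: "?q + i \<in> ou A \<and> ofam E (Suc i) = ofam A (?q + i)" if i: "Suc i \<in> ou E" for i
  proof -
    have "?q + i \<in> ou A" using uE[of "Suc i"] i by simp
    then show ?thesis using ou_k(2)[of "?q + i"] am[of "?q + i"] Ao(2)[of "?q + i"] i
      by (simp add: FskX_Tens_simps star_fam_simps(2))
  qed
  have rng: "?\<phi> i < ?b + osz C" if "i < osz A" for i using H(6)[OF that] by (simp add: FskX_Tens_simps)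
  have ouT: "i \<in> ou A \<Longrightarrow> ?\<phi> i \<in> star_set ?b (ou B) (ou C)" for i using sk(3) by auto
  have lo: "?\<phi> i < ?b" if "i < ?q" "i < osz A" for i using split that by simp
  have hi: "?b \<le> ?\<phi> i" if "?q \<le> i" "i < osz A" for i using split[of i] that by simp
  have qA: "?q \<le> osz A" using sz Eo(1) by simp
  let ?f\<phi> = "\<lambda>i\<in>{..<?q}. ?\<phi> i" and ?fx = "\<lambda>i\<in>ou Q. afam a i"
  let ?h\<phi> = "\<lambda>i\<in>{..<osz E}. if i = 0 then 0 else ?\<phi> (?q + (i - 1)) - ?b" and ?hx = "\<lambda>i\<in>ou E. afam a (?q + (i - 1))"
  let ?f = "(Q, B, ?f\<phi>, ?fx)" and ?h = "(E, C, ?h\<phi>, ?hx)"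
  have f: "?f \<in> fhom Q B"
  proof (rule FskX_homI[OF Q B])
    show "skew_map (fst Q) (fst B) ?f\<phi>"
      unfolding skew_map_iff
    proof (intro conjI allI impI ballI)
      show "?f\<phi> \<in> {..<?q} \<rightarrow>\<^sub>E {..<?b}" using lo qA by (intro PiE_I) auto
      show "mono_on {..<?q} ?f\<phi>" using mon qA by (auto simp: mono_on_def)
      show "?f\<phi> 0 = 0" using sk(2) Qo(1) by simp
      show "?f\<phi> ` ou Q = ou B"
      proof (intro equalityI subsetI)
        fix j assume "j \<in> ?f\<phi> ` ou Q"
        then obtain i where i: "i \<in> ou Q" "j = ?\<phi> i" "i < ?q" using Qo(2) by auto
        then have "?\<phi> i \<in> star_set ?b (ou B) (ou C)" "?\<phi> i < ?b" using ouT famQ lo[of i] qA by auto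
        then show "j \<in> ou B" using i by (auto simp: star_set_iff)
      next
        fix j assume j: "j \<in> ou B"
        then have "j \<in> ?\<phi> ` ou A" unfolding sk(3) by (simp add: star_set_iff)
        then obtain i where i: "i \<in> ou A" "j = ?\<phi> i" by blast
        then have "i < ?q" using split[of i] Ao(2)[of i] Bo(2)[OF j] by simp
        then show "j \<in> ?f\<phi> ` ou Q" using i uQ[of i] by (intro image_eqI[of _ _ i]) auto
      qed
    next
      fix i assume "i \<in> ou Q" "Suc i < ?q"
      then show "?f\<phi> i < ?f\<phi> (Suc i)" using famQ sk(4)[of i] qA by simp
    next
      fix j k' assume j: "Suc j < ?q" "?f\<phi> j \<le> k'" "k' < ?f\<phi> (Suc j)"
      \<comment> \<open>Strictly before the seam of the target, where its bracketing is still that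
        of \<open>B\<close>.\<close>
      have "k' < ?b - 1" using lo[of "Suc j"] j qA by simp
      then have "?\<phi> (olb A j) \<le> olb B k'" using sk(5)[of j k'] j qA by (simp add: star_lbf_simps(1))
      moreover have "olb Q j < ?q" using TamD(1)[OF Qo(3)] j by simp
      ultimately show "?f\<phi> (olb Q j) \<le> olb B k'" using lQ[OF j(1)] by simp
    qed
    show "?fx \<in> (\<Pi>\<^sub>E i\<in>ou Q. cat_hom \<X> (ofam Q i) (ofam B (?f\<phi> i)))"
    proof (rule PiE_I)
      fix i assume i: "i \<in> ou Q"
      then have iA: "i \<in> ou A" "i < osz A" "i < ?q" "ofam Q i = ofam A i" using famQ Qo(2) qA by fastforce+
      then have "?\<phi> i \<in> ou B" using ouT[of i] lo[of i] by (auto simp: star_set_iff)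
      then show "?fx i \<in> cat_hom \<X> (ofam Q i) (ofam B (?f\<phi> i))"
        using H(8)[OF iA(1)] i iA Bo(6) by (simp add: FskX_Tens_simps star_fam_simps(1))
    qed simp
  qed
  have h: "?h \<in> fhom E C"
  proof (rule FskX_homI[OF E C])
    have Suc_A: "?q + i < osz A" if "Suc i < osz E" for i using that sz by simp
    show "skew_map (fst E) (fst C) ?h\<phi>"
      unfolding skew_map_iff
    proof (intro conjI allI impI ballI)
      have lt: "?h\<phi> i < osz C" if "i < osz E" for i
        using that rng[of "?q + (i - 1)"] hi[of "?q + (i - 1)"] Suc_A[of "i - 1"] Co(1) by (cases i) auto
      then show "?h\<phi> \<in> {..<osz E} \<rightarrow>\<^sub>E {..<osz C}" by (intro PiE_I) (simp, simp)
      have "?h\<phi> i \<le> ?h\<phi> j" if "i \<le> j" "j < osz E" for i j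
        using that mon[of "?q + (i - 1)" "?q + (j - 1)"] Suc_A[of "j - 1"] by (cases i; cases j) auto
      then show "mono_on {..<osz E} ?h\<phi>" by (auto simp: mono_on_def)
      show "?h\<phi> 0 = 0" using Eo(1) by simp
      show "?h\<phi> ` ou E = ou C"
      proof (intro equalityI subsetI)
        fix j assume "j \<in> ?h\<phi> ` ou E"
        then obtain i where i: "i \<in> ou E" "j = ?h\<phi> i" by blast
        then obtain i' where i': "i = Suc i'" using uE[of i] by (cases i) auto
        then have *: "?q + i' \<in> ou A" "?q + i' < osz A" using famE i Ao(2) by auto
        then have "?\<phi> (?q + i') \<in> star_set ?b (ou B) (ou C)" "?b \<le> ?\<phi> (?q + i')" using ouT hi[of "?q + i'"] by auto
        then show "j \<in> ou C" using i i' Eo(2)[OF i(1)] Bo(2) by (fastforce simp: star_set_iff)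
      next
        fix j assume j: "j \<in> ou C"
        then have "?b + j \<in> ?\<phi> ` ou A" unfolding sk(3) by (simp add: star_set_iff)
        then obtain i where i: "i \<in> ou A" "?b + j = ?\<phi> i" by blast
        then have "?q \<le> i" using lo[of i] Ao(2)[of i] by (cases "i < ?q") auto
        then have iE: "Suc (i - ?q) \<in> ou E" using uE[of "Suc (i - ?q)"] i by simp
        then show "j \<in> ?h\<phi> ` ou E" using i \<open>?q \<le> i\<close> Eo(2)[OF iE] by (intro image_eqI[OF _ iE]) (auto simp: i(2)[symmetric])
      qed
    next
      fix i assume i: "i \<in> ou E" "Suc i < osz E"
      then obtain i' where i': "i = Suc i'" using uE[of i] by (cases i) auto
      have "?\<phi> (?q + i') < ?\<phi> (?q + Suc i')" using famE[of i'] sk(4)[of "?q + i'"] i i' Suc_A[of i] by simp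
      then show "?h\<phi> i < ?h\<phi> (Suc i)" using i i' hi[of "?q + i'"] Suc_A[of i'] by simp
    next
      fix j k' assume j: "Suc j < osz E" "?h\<phi> j \<le> k'" "k' < ?h\<phi> (Suc j)"
      show "?h\<phi> (olb E j) \<le> olb C k'"
      \<comment> \<open>Leaf \<open>0\<close> of \<open>E\<close> is the inserted unit, whose
        bracketing value is \<open>0\<close>. At a later leaf, a value of \<open>olb A\<close>
        pointing into \<open>Q\<close> has been truncated to \<open>0\<close> in \<open>E\<close>,
        and \<open>?h\<phi>\<close> fixes \<open>0\<close>.\<close>
      proof (cases j)
        case 0
        then have "olb E j = 0" using TamD(2)[OF Eo(3), of 0] Eo(1) by simp
        then show ?thesis using Eo(1) by simp
      next
        case (Suc j')
        have A: "Suc (?q + j') < osz A" using Suc_A[OF j(1)] Suc by simp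
        have "?\<phi> (?q + j') \<le> ?b + k'" "?b + k' < ?\<phi> (Suc (?q + j'))"
          using j Suc by auto
        then have le: "?\<phi> (olb A (?q + j')) \<le> star_lbf ?b (osz C) (olb B) (olb C) (?b + k')"
          and k': "?b + k' < ?b + osz C"
          using sk(5)[OF A] rng[OF A] by auto
        then have le: "?\<phi> (olb A (?q + j')) \<le> ?b + olb C k'" using Bo(1) by (simp add: star_lbf_simps(3))
        have lb: "olb E j = Suc (olb A (?q + j')) - ?q" using lE[of j'] j Suc by simp
        have lt: "olb E j < osz E" using TamD(1)[OF Eo(3)] j by simp
        show ?thesis
        proof (cases "?q \<le> olb A (?q + j')")
          case True
          then have "olb E j \<noteq> 0" "?q + (olb E j - 1) = olb A (?q + j')" using lb by auto
          then show ?thesis using le lt by simp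
        next
          case False
          then have "olb E j = 0" using lb by simp
          then show ?thesis using Eo(1) by simp
        qed
      qed
    qed
    show "?hx \<in> (\<Pi>\<^sub>E i\<in>ou E. cat_hom \<X> (ofam E i) (ofam C (?h\<phi> i)))"
    proof (rule PiE_I)
      fix i assume i: "i \<in> ou E"
      then obtain i' where i': "i = Suc i'" using uE[of i] by (cases i) auto
      then have iA: "?q + i' \<in> ou A" "?q + i' < osz A" "ofam E i = ofam A (?q + i')" using famE[of i'] i Ao(2) by auto
      then have "?\<phi> (?q + i') - ?b \<in> ou C" "?b \<le> ?\<phi> (?q + i')" using ouT[of "?q + i'"] hi[of "?q + i'"] Bo(2) by (fastforce simp: star_set_iff)+
      then show "?hx i \<in> cat_hom \<X> (ofam E i) (ofam C (?h\<phi> i))"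
        using H(8)[OF iA(1)] i i' iA Eo(2)[OF i] by (simp add: FskX_Tens_simps star_fam_simps(2))
    qed simp
  qed
  have comp: "FskX_Comp \<X> (FskX_TensA f' h') k \<in> fhom A (FskX_Tens B C) \<and>
      (\<forall>i<osz A. amap (FskX_Comp \<X> (FskX_TensA f' h') k) i = (if i < ?q then amap f' i else ?b + amap h' (Suc i - ?q))) \<and>
      (\<forall>i\<in>ou A. afam (FskX_Comp \<X> (FskX_TensA f' h') k) i = (if i < ?q then afam f' i else afam h' (Suc i - ?q)))"
    if f': "f' \<in> fhom Q B" and h': "h' \<in> fhom E C" for f' h'
  proof (intro conjI allI impI ballI)
    note F = FskX_homD[OF f'] and G = FskX_homD[OF h']
    note fh = FskX_TensA_in[OF f' h']
    show "FskX_Comp \<X> (FskX_TensA f' h') k \<in> fhom A (FskX_Tens B C)"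
      using FskX_Comp_in[OF bare_hom[OF b] fh] .
    have am_fh: "amap (FskX_TensA f' h') i = (if i < ?q then amap f' i else ?b + amap h' (i - ?q))" if "i < ?q + osz E" for i
      using that F(1,2) G(1) by (simp add: FskX_arrow_simps(3) ord_sum_def)
    show "amap (FskX_Comp \<X> (FskX_TensA f' h') k) i = (if i < ?q then amap f' i else ?b + amap h' (Suc i - ?q))" if i: "i < osz A" for i
      using i am[OF i] sz K(1) am_fh[of "amap k i"] qA by (simp add: FskX_arrow_simps(2) compose_def)
    fix i assume i: "i \<in> ou A"
    have "afam k i = Ident \<X> (ofam (FskX_Tens Q E) (amap k i))" using b i by (simp add: bare_def)
    moreover have T: "amap k i \<in> ou (FskX_Tens Q E)" using K(7)[OF i] .
    ultimately have "afam (FskX_Comp \<X> (FskX_TensA f' h') k) i = afam (FskX_TensA f' h') (amap k i)"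
      using i K(1) FskX_homD(9)[OF fh T] by (simp add: FskX_arrow_simps(2))
    also have "\<dots> = (if amap k i < ?q then afam f' (amap k i) else afam h' (amap k i - ?q))"
      using T F(1) G(1) by (simp add: FskX_arrow_simps(3) FskX_Tens_simps star_fam_def)
    also have "\<dots> = (if i < ?q then afam f' i else afam h' (Suc i - ?q))"
      using am[OF Ao(2)[OF i]] by simp
    finally show "afam (FskX_Comp \<X> (FskX_TensA f' h') k) i = (if i < ?q then afam f' i else afam h' (Suc i - ?q))" .
  qed
  have eq: "a = FskX_Comp \<X> (FskX_TensA ?f ?h) k"
  proof (rule FskX_hom_eqI[OF a conjunct1[OF comp[OF f h]]])
    fix i assume i: "i < osz A"
    show "amap a i = amap (FskX_Comp \<X> (FskX_TensA ?f ?h) k) i"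
      using comp[OF f h] i hi[of i] sz by (auto simp: Suc_diff_le)
  next
    fix i assume i: "i \<in> ou A"
    have "i \<in> ou Q" if "i < ?q" using uQ[OF that] i by simp
    moreover have "Suc i - ?q \<in> ou E" "?q + (Suc i - ?q - 1) = i" if "\<not> i < ?q" using uE[of "Suc i - ?q"] i that by auto
    ultimately show "afam a i = afam (FskX_Comp \<X> (FskX_TensA ?f ?h) k) i"
      using comp[OF f h] i by auto
  qed
  have unique: "f' = ?f \<and> h' = ?h" if f': "f' \<in> fhom Q B" and h': "h' \<in> fhom E C"
    and eq': "a = FskX_Comp \<X> (FskX_TensA f' h') k" for f' h'
  proof -
    note c = comp[OF f' h', folded eq'] and c' = comp[OF f h, folded eq]
    have "f' = ?f"
    proof (rule FskX_hom_eqI[OF f' f])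
      fix i assume i: "i < ?q"
      then have "i < osz A" using qA by simp
      then have "amap a i = amap f' i" "amap a i = amap ?f i" using c c' i by auto
      then show "amap f' i = amap ?f i" by simp
    next
      fix i assume i: "i \<in> ou Q"
      then have "i \<in> ou A" "i < ?q" using famQ Qo(2) by auto
      then have "afam a i = afam f' i" "afam a i = afam ?f i" using c c' by auto
      then show "afam f' i = afam ?f i" by simp
    qed
    moreover have "h' = ?h"
    proof (rule FskX_hom_eqI[OF h' h])
      fix i assume i: "i < osz E"
      show "amap h' i = amap ?h i"
      proof (cases i)
        case 0
        then show ?thesis using FskX_homD(5)[OF h'] FskX_homD(5)[OF h] by (simp add: skew_map_iff)
      next
        case (Suc i')
        then have "?q + i' < osz A" using i sz by simp
        then have "amap a (?q + i') = ?b + amap h' i" "amap a (?q + i') = ?b + amap ?h i" using c c' Suc by auto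
        then show ?thesis by simp
      qed
    next
      fix i assume i: "i \<in> ou E"
      then obtain i' where i': "i = Suc i'" using uE[of i] by (cases i) auto
      then have "?q + i' \<in> ou A" using famE i by auto
      then have "afam a (?q + i') = afam h' i" "afam a (?q + i') = afam ?h i" using c c' i' by auto
      then show "afam h' i = afam ?h i" by simp
    qed
    ultimately show ?thesis ..
  qed
  show ?thesis using f h eq unique by blast
qed

end

section \<open>The universal property\<close>

locale free_extension = base_category \<X> + C: skew_monoidal_category C
  for \<X> :: "('o, 'a) cat" and C :: "('c, 'd) skew_cat" +
  fixes G :: "('o, 'a, 'c, 'd) ftor"
  assumes G: "is_functor \<X> C G"
begin

definition GP :: "('o, 'a, 'o fskx_ob \<times> 'c, ('o, 'a) fskx_arr \<times> 'd) ftor" where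
  "GP = \<lparr>on_ob = (\<lambda>A\<in>Ob \<X>. (FskX_J_ob A, on_ob G A)),
         on_arr = (\<lambda>f\<in>Arr \<X>. (on_arr (FskX_J \<X>) f, on_arr G f))\<rparr>"

lemma GP_simps: "A \<in> Ob \<X> \<Longrightarrow> on_ob GP A = (FskX_J_ob A, on_ob G A)"
  "f \<in> Arr \<X> \<Longrightarrow> on_arr GP f = (on_arr (FskX_J \<X>) f, on_arr G f)"
  by (simp_all add: GP_def)

lemma GP_functor: "is_functor \<X> (prod_skew (FskX \<X>) C) GP"
proof -
  have "Comp \<X> g f \<in> Arr \<X>" if "f \<in> Arr \<X>" "g \<in> Arr \<X>" "Cod \<X> f = Dom \<X> g" for f g
    using Comp_in[of f "Dom \<X> f" "Cod \<X> f" g "Cod \<X> g"] that by (simp add: cat_hom_def)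
  moreover have "Ident \<X> A \<in> Arr \<X>" if "A \<in> Ob \<X>" for A
    using Ident_in[OF that] by (simp add: cat_hom_def)
  moreover have "on_ob (FskX_J \<X>) A = FskX_J_ob A" if "A \<in> Ob \<X>" for A using that by (simp add: FskX_J_def)
  ultimately show ?thesis
    using FskX_J_functor G Dom_in Cod_in unfolding is_functor_def GP_def
    by (auto simp: FskX_J_ob_Ob)
qed

end

sublocale free_extension \<subseteq> P: skew_model \<X> "prod_skew (FskX \<X>) C" GP
  by (intro skew_model.intro skew_model_axioms.intro prod_skew_monoidal FskX_skew_monoidal GP_functor
      C.skew_monoidal_category_axioms category_axioms)

context free_extension
begin

section \<open>Existence and uniqueness of normal forms over the product\<close>

lemma fst_ev: "P.ok t \<Longrightarrow> fst (P.ev t) = enc t"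
  by (induction t) (auto simp: GP_simps)

lemma enc_ok: "P.ok t \<Longrightarrow> enc t \<in> FskX_Ob \<X>"
  by (rule enc_Ob) (simp add: P.ok_def)

lemma den_fhom: "P.den D B p \<Longrightarrow> fst p \<in> fhom (enc D) (enc B)"
  using P.den_hom[of D B p] fst_ev by (auto simp: prod_skew_hom)

lemmas NF_fhom = den_fhom[OF P.NF_den]

lemma lstep_data_lstep: "P.lstep D D' l \<Longrightarrow> lstep_data (enc D) (enc D') (fst l)"
proof (induction rule: P.lstep.induct)
  case (lstep_unit A)
  then show ?case using lstep_data_unit[OF enc_ok] by (simp add: fst_ev)
next
  case (lstep_node D D' l Q)
  then show ?case using lstep_data_Tens[OF _ enc_ok] by (simp add: fst_ev)
qed

lemma spl_data_spl: "P.spl D Q E k \<Longrightarrow> spl_data (enc D) (enc Q) (enc E) (fst k)"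
proof (induction rule: P.spl.induct)
  case (spl_unit A)
  then show ?case using spl_data_unit[OF enc_ok] by (simp add: fst_ev)
next
  case (spl_node D Q E k R)
  then show ?case using spl_data_Tens[OF _ enc_ok] P.spl_hom[OF spl_node.hyps(1)] by (simp add: fst_ev)
qed

text \<open>As leaf \<open>0\<close> is not in \<open>u\<close>, the left spine ends in
  \<open>Unt\<close>; size above one puts a node above it.\<close>

lemma lstep_ex:
  "P.ok D \<Longrightarrow> 1 < osz (enc D) \<Longrightarrow> 0 \<notin> ou (enc D) \<Longrightarrow> \<exists>D' l. P.lstep D D' l"
proof (induction D)
  case (Node P Q)
  show ?case
  proof (cases P)
    case Unt
    then show ?thesis using P.lstep_unit[of Q] Node.prems(1) unfolding P.ok_simps by blast
  next
    case (Leaf A)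
    then show ?thesis using Node.prems by (simp add: FskX_Tens_simps FskX_J_ob_simps star_set_iff)
  next
    case (Node P1 P2)
    then have "1 < osz (enc P)" using osz_enc_pos[of P1] osz_enc_pos[of P2] by (simp add: FskX_Tens_simps)
    moreover have "0 \<notin> ou (enc P)" using Node.prems by (simp add: FskX_Tens_simps star_set_iff)
    ultimately obtain D' l where "P.lstep P D' l" using Node.IH(1) Node.prems(1) unfolding P.ok_simps by blast
    then show ?thesis using P.lstep_node[of P D' l Q] Node.prems(1) unfolding P.ok_simps by blast
  qed
qed (simp_all add: FskX_Unit_simps FskX_J_ob_simps)

text \<open>The zeros of the bracketing function, together with the last leaf, mark the ends of the
  nodes on the left spine: past the left factor \<open>star_lbf\<close> is positive, and inside it
  the induction continues.\<close>

lemma spl_ex: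
  "P.ok D \<Longrightarrow> j < osz (enc D) \<Longrightarrow> (Suc j < osz (enc D) \<Longrightarrow> olb (enc D) j = 0) \<Longrightarrow>
    \<exists>Q E k. P.spl D Q E k \<and> osz (enc Q) = Suc j"
proof (induction D arbitrary: j)
  case (Node P R)
  show ?case
  proof (cases "Suc j = osz (enc (Node P R))")
    case True
    then show ?thesis using P.spl_unit[OF Node.prems(1)] by metis
  next
    case False
    then have z: "star_lbf (osz (enc P)) (osz (enc R)) (olb (enc P)) (olb (enc R)) j = 0"
      and j: "j < osz (enc P) + osz (enc R)"
      using Node.prems by (auto simp: FskX_Tens_simps)
    have jP: "j < osz (enc P)"
      using z j osz_enc_pos[of P] by (cases "j < osz (enc P)") (auto simp: star_lbf_simps(3))
    have "olb (enc P) j = 0" if "Suc j < osz (enc P)"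
      using z that by (simp add: star_lbf_simps(1))
    then obtain Q E k where "P.spl P Q E k" "osz (enc Q) = Suc j"
      using Node.IH(1)[OF _ jP] Node.prems(1) unfolding P.ok_simps by blast
    moreover have "P.ok R" using Node.prems(1) by simp
    ultimately show ?thesis using P.spl_node by blast
  qed
next
  case Unt
  then have "osz (enc (Unt :: 'o tree)) = Suc j" by (simp add: FskX_Unit_simps)
  then show ?case using P.spl_unit[OF Unt(1)] by blast
next
  case (Leaf A)
  then have "osz (enc (Leaf A)) = Suc j" by (simp add: FskX_J_ob_simps)
  then show ?case using P.spl_unit[OF Leaf(1)] by blast
qed

lemma spl_size: "P.spl D Q E k \<Longrightarrow> osz (enc Q) \<le> osz (enc D)"
  using spl_data_simps(2)[OF spl_data_spl[of D Q E k]] osz_enc_pos[of E] by simp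

text \<open>Sizes strictly decrease down the left spine, so the size of the head tells at which node
  the splitting stops.\<close>

lemma spl_det:
  "P.spl D Q E k \<Longrightarrow> P.spl D Q' E' k' \<Longrightarrow> osz (enc Q') = osz (enc Q) \<Longrightarrow> Q' = Q \<and> E' = E \<and> k' = k"
proof (induction arbitrary: Q' E' k' rule: P.spl.induct)
  case (spl_unit P)
  from spl_unit(2) show ?case
  proof (cases rule: P.spl.cases)
    case (spl_node D' E'' k'' R)
    then show ?thesis using spl_unit(3) spl_size[OF spl_node(4)] osz_enc_pos[of R] by (simp add: FskX_Tens_simps)
  qed auto
next
  case (spl_node D Q E k R)
  from spl_node.prems(1) show ?case
  proof (cases rule: P.spl.cases)
    case spl_unit
    then show ?thesis using spl_node.prems(2) spl_size[OF spl_node.hyps(1)] osz_enc_pos[of R] by (simp add: FskX_Tens_simps)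
  next
    case (spl_node E'' k'')
    then show ?thesis using spl_node.IH spl_node.prems(2) by blast
  qed
qed

text \<open>In \<open>NF_tens\<close> the leaves of the head are handled by induction, and those
  beyond it are sent past \<open>B\<close>. Together with \<open>pass_zero\<close> this lets the
  underlying function decide whether a normal form is focused.\<close>

lemma focused_pos:
  "P.NF b D B p \<Longrightarrow> b \<Longrightarrow> 0 < i \<Longrightarrow> i < osz (enc D) \<Longrightarrow> 0 < amap (fst p) i"
proof (induction arbitrary: i rule: P.NF.induct)
  case (NF_tens P B f D E k C h)
  note K = spl_data_spl[OF NF_tens.hyps(2)]
  note f = NF_fhom[OF NF_tens.hyps(1)] and h = NF_fhom[OF NF_tens.hyps(3)]
  show ?case
    using NF_tens.prems NF_tens.IH(1)[of i] spl_data_simps(1,2)[OF K] spl_data_simps(3)[OF K, of i] osz_enc_pos[of B] FskX_homD(1,2)[OF f] FskX_homD(1)[OF h]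
    by (simp add: FskX_arrow_simps(2,3) ord_sum_def compose_def)
qed (auto simp: FskX_Unit_simps FskX_J_ob_simps)

lemma pass_zero:
  assumes "P.lstep D D' l" "P.NF False D' B f" "a = FskX_Comp \<X> (fst f) (fst l)"
  shows "1 < osz (enc D) \<and> amap a 1 = 0"
proof -
  have d: "lstep_data (enc D) (enc D') (fst l)" by (rule lstep_data_lstep[OF assms(1)])
  then have sz: "1 < osz (enc D)" and "amap (fst l) 1 = 0" "fst (fst l) = enc D"
    using osz_enc_pos[of D'] lstep_data_simps(1,2)[OF d] lstep_data_simps(3)[OF d, of 1] by auto
  moreover have "amap (fst f) 0 = 0"
    using FskX_homD(5)[OF NF_fhom[OF assms(2)]] by (simp add: skew_map_iff)
  ultimately show ?thesis using assms(3) by (simp add: FskX_arrow_simps(2) compose_def)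
qed

text \<open>The measure drops because a contraction shortens \<open>D\<close>, while a splitting
  gives parts no larger than \<open>D\<close> and replaces \<open>B\<close> by a proper subtree.
  Uniqueness of each step comes from \<open>lstep_factor\<close> or \<open>spl_factor\<close> in the
  first component and is then passed on to the second.\<close>

lemma NF_ex1:
  assumes "P.ok D" "P.ok B" "a \<in> fhom (enc D) (enc B)"
  shows "\<exists>!g. P.NF False D B (a, g)"
  using assms
proof (induction "osz (enc D) + size B" arbitrary: D B a rule: less_induct)
  case less
  note okD = less.prems(1) and okB = less.prems(2) and a = less.prems(3)
  note H = FskX_homD[OF a]
  have mon: "amap a i \<le> amap a j" if "i \<le> j" "j < osz (enc D)" for i j
    using H(5) that by (auto simp: skew_map_iff mono_on_def)
  have a0: "amap a 0 = 0" using H(5) by (simp add: skew_map_iff)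
  show ?case
  proof (cases "\<exists>i. 0 < i \<and> i < osz (enc D) \<and> amap a i = 0")
    case True
    then obtain i where i: "0 < i" "i < osz (enc D)" "amap a i = 0" by blast
    then have sz: "1 < osz (enc D)" and z: "amap a 1 = 0" using mon[of 1 i] by auto
    \<comment> \<open>An element of \<open>u\<close> is the last one of its fibre, but leaf
      \<open>1\<close> has the same value as leaf \<open>0\<close>.\<close>
    have "0 \<notin> ou (enc D)" using H(5) sz z a0 by (auto simp: skew_map_iff)
    then obtain D' l where l: "P.lstep D D' l" using lstep_ex[OF okD sz] by blast
    have okD': "P.ok D'" using P.lstep_hom[OF l] by simp
    obtain a' where a': "a' \<in> fhom (enc D') (enc B)" "a = FskX_Comp \<X> a' (fst l)"
      and ua: "\<And>b. b \<in> fhom (enc D') (enc B) \<Longrightarrow> a = FskX_Comp \<X> b (fst l) \<Longrightarrow> b = a'"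
      using lstep_factor[OF lstep_data_lstep[OF l] a sz z] by blast
    have "osz (enc D') + size B < osz (enc D) + size B" using lstep_data_simps(2)[OF lstep_data_lstep[OF l]] by simp
    then obtain g' where g': "P.NF False D' B (a', g')" and ug: "\<And>h. P.NF False D' B (a', h) \<Longrightarrow> h = g'"
      using less.hyps[OF _ okD' okB a'(1)] by blast
    show ?thesis
    proof (rule ex1I[of _ "Comp C g' (snd l)"])
      show "P.NF False D B (a, Comp C g' (snd l))" using P.NF_pass[OF l g'] a'(2) by simp
      fix h assume "P.NF False D B (a, h)"
      then show "h = Comp C g' (snd l)"
      proof (cases rule: P.NF.cases)
        case NF_switch
        then show ?thesis using focused_pos[of True D B "(a, h)" 1] sz z by simp
      next
        case (NF_pass D'' l' f)
        have eq: "D'' = D'" "l' = l" using P.lstep_det[OF l NF_pass(2)] by auto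
        then have "fst f = a'" using NF_pass NF_fhom[OF NF_pass(3)] by (intro ua) auto
        then have "snd f = g'" using NF_pass(3) eq by (intro ug) (metis prod.collapse)
        then show ?thesis using NF_pass(1) eq by simp
      qed simp_all
    qed
  next
    case False
    then have pos: "0 < amap a i" if "0 < i" "i < osz (enc D)" for i
      using that by auto
    have focused: "P.NF False D B (a, h) \<longleftrightarrow> P.NF True D B (a, h)" for h
    proof
      assume "P.NF False D B (a, h)"
      then show "P.NF True D B (a, h)"
      proof (cases rule: P.NF.cases)
        case (NF_pass D' l f)
        have "a = FskX_Comp \<X> (fst f) (fst l)" using NF_pass(1) by simp
        from pass_zero[OF NF_pass(2,3) this] show ?thesis using pos[of 1] by simp
      qed simp_all
    qed (rule P.NF_switch)
    \<comment> \<open>A second leaf would need a positive value below \<open>1\<close>.\<close>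
    have sz1: "osz (enc D) = 1" if "osz (enc B) = 1"
      using pos[of 1] H(6)[of 1] osz_enc_pos[of D] that by (cases "1 < osz (enc D)") auto
    have leaf: "D = Unt \<or> (\<exists>A. D = Leaf A)" if "osz (enc D) = 1"
    proof (cases D)
      case (Node P R)
      then show ?thesis using that osz_enc_pos[of P] osz_enc_pos[of R] by (simp add: FskX_Tens_simps)
    qed auto
    have img: "amap a ` ou (enc D) = ou (enc B)" using H(5) by (simp add: skew_map_iff)
    show ?thesis
      unfolding focused
    proof (cases B)
      case Unt
      then have D: "D = Unt" using leaf sz1 img by (auto simp: FskX_Unit_simps FskX_J_ob_simps)
      have "a = FskX_Ident \<X> FskX_Unit"
        using a a0 Unt D category.Ident_in[OF FskX_category, of FskX_Unit] FskX_Unit_Ob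
        by (intro FskX_hom_eqI[of a FskX_Unit FskX_Unit]) (auto simp: FskX_Unit_simps FskX_arrow_simps)
      then show "\<exists>!g. P.NF True D B (a, g)"
        using P.NF_unit Unt D by (intro ex1I[of _ "Ident C (Unit C)"]) (simp, auto elim!: P.focused_UntE)
    next
      case (Leaf A)
      then obtain A0 where D: "D = Leaf A0" using leaf sz1 img by (auto simp: FskX_Unit_simps FskX_J_ob_simps)
      have f: "afam a 0 \<in> cat_hom \<X> A0 A" using H(8)[of 0] a0 Leaf D by (simp add: FskX_J_ob_simps)
      have J: "on_arr (FskX_J \<X>) f \<in> fhom (FskX_J_ob A0) (FskX_J_ob A) \<and> afam (on_arr (FskX_J \<X>) f) 0 = f
          \<and> amap (on_arr (FskX_J \<X>) f) 0 = 0 \<and> on_arr GP f = (on_arr (FskX_J \<X>) f, on_arr G f)"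
        if "f \<in> cat_hom \<X> A0 A" for f
        using is_functor_hom[OF FskX_J_functor that] cat_homD[OF that] hom_Ob[OF that]
        by (auto simp: FskX_J_def GP_simps)
      have aJ: "a = on_arr (FskX_J \<X>) (afam a 0)"
        using a a0 Leaf D J[OF f] by (intro FskX_hom_eqI[of a "FskX_J_ob A0" "FskX_J_ob A"]) (auto simp: FskX_J_ob_simps)
      show "\<exists>!g. P.NF True D B (a, g)"
      proof (rule ex1I[of _ "on_arr G (afam a 0)"])
        show "P.NF True D B (a, on_arr G (afam a 0))"
          using P.NF_leaf[OF f] J[OF f] aJ Leaf D by simp
        fix g assume "P.NF True D B (a, g)"
        then have "P.NF True D (Leaf A) (a, g)" using Leaf by simp
        then show "g = on_arr G (afam a 0)"
        proof (cases rule: P.focused_LeafE)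
          case (leaf f' A')
          then show ?thesis using J[of f'] D by auto
        qed
      qed
    next
      case B: (Node B1 B2)
      let ?b = "osz (enc B1)"
      have ok: "P.ok B1" "P.ok B2" using okB B by auto
      note B1o = FskX_ObD[OF enc_ok[OF ok(1)]]
      have aT: "a \<in> fhom (enc D) (FskX_Tens (enc B1) (enc B2))" using a B by simp
      let ?K = "{i. i < osz (enc D) \<and> amap a i < ?b}"
      \<comment> \<open>The last leaf sent into \<open>B1\<close>. The splitting has to stop there,
        which \<open>spl_ex\<close> permits once the bracketing is known to vanish at
        \<open>j\<close>.\<close>
      define j where "j = Max ?K"
      have fin: "finite ?K" by simp
      have "0 \<in> ?K" using a0 osz_enc_pos[of D] osz_enc_pos[of B1] by simp
      then have "?K \<noteq> {}" by blast
      with fin have "j \<in> ?K" unfolding j_def by (rule Max_in)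
      then have j: "j < osz (enc D)" "amap a j < ?b" by auto
      have jmax: "i \<le> j" if "i < osz (enc D)" "amap a i < ?b" for i
        unfolding j_def using that by (intro Max_ge fin) simp
      have split: "amap a i < ?b \<longleftrightarrow> i < Suc j" if "i < osz (enc D)" for i
        using jmax[OF that] mon[of i j] j by auto
      \<comment> \<open>At the seam \<open>?b - 1\<close> the bracketing of \<open>B\<close> is
        \<open>0\<close>, so the leaf \<open>olb (enc D) j\<close> is sent to \<open>0\<close>; in
        the present case only leaf \<open>0\<close> is.\<close>
      have "olb (enc D) j = 0" if sj: "Suc j < osz (enc D)"
      proof -
        have "?b - 1 < amap a (Suc j)" using split[OF sj] osz_enc_pos[of B1] by simp
        moreover have "amap a j \<le> ?b - 1" using j by simp
        ultimately have "amap a (olb (enc D) j) \<le> olb (enc B) (?b - 1)"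
          using H(5) sj unfolding skew_map_iff by blast
        also have "\<dots> = 0" using star_lbf_simps(2)[OF osz_enc_pos[of B1]] B by (simp only: enc.simps FskX_Tens_simps)
        finally show ?thesis
          using pos[of "olb (enc D) j"] TamD(1)[OF FskX_ObD(3)[OF H(3)], of j] j by (cases "olb (enc D) j") auto
      qed
      then obtain Q E k where k: "P.spl D Q E k" "osz (enc Q) = Suc j"
        using spl_ex[OF okD j(1)] by blast
      note dat = spl_data_spl[OF k(1)]
      have okQE: "P.ok Q" "P.ok E" using P.spl_hom[OF k(1)] by auto
      obtain f h where f: "f \<in> fhom (enc Q) (enc B1)" and h: "h \<in> fhom (enc E) (enc B2)"
        and eq: "a = FskX_Comp \<X> (FskX_TensA f h) (fst k)"
        and ufh: "\<And>f' h'. f' \<in> fhom (enc Q) (enc B1) \<Longrightarrow> h' \<in> fhom (enc E) (enc B2) \<Longrightarrow>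
            a = FskX_Comp \<X> (FskX_TensA f' h') (fst k) \<Longrightarrow> f' = f \<and> h' = h"
        using spl_factor[OF dat enc_ok[OF ok(1)] enc_ok[OF ok(2)] aT split[folded k(2)]] by blast
      have sz: "osz (enc Q) \<le> osz (enc D)" "osz (enc E) \<le> osz (enc D)"
        using spl_data_simps(2)[OF dat] osz_enc_pos[of Q] osz_enc_pos[of E] by auto
      obtain gf where gf: "P.NF False Q B1 (f, gf)" and ugf: "\<And>g. P.NF False Q B1 (f, g) \<Longrightarrow> g = gf"
        using less.hyps[OF _ okQE(1) ok(1) f] sz B by (auto simp: less_Suc_eq_le)
      obtain gh where gh: "P.NF False E B2 (h, gh)" and ugh: "\<And>g. P.NF False E B2 (h, g) \<Longrightarrow> g = gh"
        using less.hyps[OF _ okQE(2) ok(2) h] sz B by (auto simp: less_Suc_eq_le)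
      show "\<exists>!g. P.NF True D B (a, g)"
      proof (rule ex1I[of _ "Comp C (TensA C gf gh) (snd k)"])
        have "P.NF False D B (a, Comp C (TensA C gf gh) (snd k))"
          using P.NF_tens_general[OF gf k(1) gh] eq B by simp
        then show "P.NF True D B (a, Comp C (TensA C gf gh) (snd k))" using focused by simp
        fix g assume "P.NF True D B (a, g)"
        then have "P.NF True D (Node B1 B2) (a, g)" using B by simp
        then show "g = Comp C (TensA C gf gh) (snd k)"
        proof (cases rule: P.focused_NodeE)
          case (tens Q' f' E' k' h')
          have f': "fst f' \<in> fhom (enc Q') (enc B1)" and h': "fst h' \<in> fhom (enc E') (enc B2)"
            using NF_fhom tens by blast+
          have aeq: "a = FskX_Comp \<X> (FskX_TensA (fst f') (fst h')) (fst k')" using tens(1) by simp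
          note dat' = spl_data_spl[OF tens(3)]
          \<comment> \<open>The head of a competing normal form also consists of the leaves sent
            into \<open>B1\<close>, so by \<open>spl_det\<close> the splitting is the same.\<close>
          have "i < osz (enc Q') \<longleftrightarrow> amap a i < ?b" if i: "i < osz (enc D)" for i
            using i spl_data_simps(1,2)[OF dat'] spl_data_simps(3)[OF dat' i] FskX_homD(1,2)[OF f'] FskX_homD(6)[OF f', of i]
              FskX_homD(1)[OF h']
            unfolding aeq by (auto simp: FskX_arrow_simps(2,3) compose_def ord_sum_def)
          then have *: "i < osz (enc Q') \<longleftrightarrow> i < Suc j" if "i < osz (enc D)" for i using split that by blast
          have "osz (enc Q') = Suc j"
            using *[of "osz (enc Q') - 1"] *[of j] j spl_size[OF tens(3)] osz_enc_pos[of Q'] by arith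
          then have same: "Q' = Q" "E' = E" "k' = k" using spl_det[OF k(1) tens(3)] k(2) by auto
          then have fh: "fst f' = f" "fst h' = h" using ufh[of "fst f'" "fst h'"] f' h' aeq by auto
          have "snd f' = gf" using P.NF_switch[OF tens(2)] same fh by (intro ugf) (metis prod.collapse)
          moreover have "snd h' = gh" using tens(4) same fh by (intro ugh) (metis prod.collapse)
          ultimately show ?thesis using tens(1) same by simp
        qed
      qed
    qed
  qed
qed

section \<open>The induced functor and its uniqueness\<close>

definition dec :: "'o fskx_ob \<Rightarrow> 'o tree" where
  "dec A = (THE t. P.ok t \<and> enc t = A)"

lemma dec_enc: "P.ok t \<Longrightarrow> dec (enc t) = t"
  unfolding dec_def using enc_inj[of _ \<X>] by (intro the_equality) (auto simp: P.ok_def)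

lemma dec_ok: "A \<in> FskX_Ob \<X> \<Longrightarrow> P.ok (dec A) \<and> enc (dec A) = A"
  using enc_surj[of A \<X>] dec_enc unfolding P.ok_def by metis

text \<open>Second component of the graph of generated arrows; \<open>den_ex1\<close> makes the
  description well defined. The restrictions provide the extensionality that
  \<open>is_functor\<close> asks for.\<close>

definition lift :: "('o fskx_ob, ('o, 'a) fskx_arr, 'c, 'd) ftor" where
  "lift = \<lparr>on_ob = (\<lambda>A\<in>FskX_Ob \<X>. snd (P.ev (dec A))),
           on_arr = (\<lambda>a\<in>FskX_Arr \<X>. THE g. P.den (dec (fst a)) (dec (fst (snd a))) (a, g))\<rparr>"

lemma lift_ob: "P.ok t \<Longrightarrow> on_ob lift (enc t) = snd (P.ev t)"
  by (simp add: lift_def enc_ok dec_enc)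

lemma den_ex1: "P.ok D \<Longrightarrow> P.ok B \<Longrightarrow> a \<in> fhom (enc D) (enc B) \<Longrightarrow> \<exists>!g. P.den D B (a, g)"
  using NF_ex1 by (simp add: P.NF_iff_den)

lemma lift_arr:
  assumes "P.ok D" "P.ok B" "a \<in> fhom (enc D) (enc B)"
  shows "P.den D B (a, on_arr lift a)"
proof -
  have "on_arr lift a = (THE g. P.den D B (a, g))"
    using assms FskX_homD(1,2)[OF assms(3)] cat_homD(1)[OF assms(3)] by (simp add: lift_def dec_enc)
  then show ?thesis using theI'[OF den_ex1[OF assms]] by simp
qed

text \<open>Reduces an equation for \<open>lift\<close> to exhibiting one generated arrow of the
  product; the constructors of \<open>den\<close> then yield the clauses of strict
  functoriality.\<close>

lemma lift_den:
  assumes "P.den D B (a, g)"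
  shows "on_arr lift a = g"
proof -
  have "P.ok D" "P.ok B" "a \<in> fhom (enc D) (enc B)" using P.den_hom[OF assms] den_fhom[OF assms] by auto
  then show ?thesis using lift_arr den_ex1 assms by blast
qed

lemma FskX_ob_tree:
  assumes "A \<in> FskX_Ob \<X>"
  obtains t where "P.ok t" "A = enc t"
  using dec_ok[OF assms] by metis

lemma FskX_arr_den:
  assumes "a \<in> FskX_Arr \<X>"
  obtains D B where "P.ok D" "P.ok B" "fst a = enc D" "fst (snd a) = enc B" "P.den D B (a, on_arr lift a)"
proof -
  have a: "a \<in> fhom (fst a) (fst (snd a))" using assms by (simp add: cat_hom_def)
  then obtain D B where "P.ok D" "fst a = enc D" "P.ok B" "fst (snd a) = enc B"
    using FskX_ob_tree FskX_homD(3,4) by metis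
  then show ?thesis using that lift_arr a by metis
qed

lemma snd_hom: "P.den D B (a, g) \<Longrightarrow> g \<in> cat_hom C (snd (P.ev D)) (snd (P.ev B))"
  using P.den_hom[of D B "(a, g)"] by (simp add: prod_skew_hom)

lemma snd_ev_Ob: "P.ok t \<Longrightarrow> snd (P.ev t) \<in> Ob C"
  using P.ev_Ob[of t] by (cases "P.ev t") simp

lemma lift_functor: "is_functor (FskX \<X>) C lift"
  unfolding is_functor_def FskX_sel
proof (intro conjI ballI impI)
  show "on_ob lift \<in> FskX_Ob \<X> \<rightarrow>\<^sub>E Ob C"
    using dec_ok snd_ev_Ob by (auto simp: lift_def)
  show "on_arr lift \<in> FskX_Arr \<X> \<rightarrow>\<^sub>E Arr C"
  proof (rule PiE_I)
    show "on_arr lift a \<in> Arr C" if "a \<in> FskX_Arr \<X>" for a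
      using FskX_arr_den[OF that] snd_hom cat_homD(1) by metis
  qed (simp add: lift_def)
next
  fix a assume "a \<in> FskX_Arr \<X>"
  then obtain D B where d: "P.ok D" "P.ok B" "fst a = enc D" "fst (snd a) = enc B" "P.den D B (a, on_arr lift a)"
    by (rule FskX_arr_den)
  then show "Dom C (on_arr lift a) = on_ob lift (fst a)" "Cod C (on_arr lift a) = on_ob lift (fst (snd a))"
    using cat_homD[OF snd_hom[OF d(5)]] by (simp_all add: lift_ob)
  fix b assume "b \<in> FskX_Arr \<X>" "fst (snd a) = fst b"
  then obtain B' E where e: "P.ok B'" "P.ok E" "enc B = enc B'" "P.den B' E (b, on_arr lift b)"
    using d(4) by (metis FskX_arr_den)
  \<comment> \<open>Composable arrows meet in one object of Fsk(X), which has only one tree.\<close>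
  then have "B' = B" using dec_enc d(2) by metis
  then show "on_arr lift (FskX_Comp \<X> b a) = Comp C (on_arr lift b) (on_arr lift a)"
    using P.den_comp[OF d(5), of E "(b, on_arr lift b)"] e(4) by (intro lift_den) simp
next
  fix A assume "A \<in> FskX_Ob \<X>"
  then obtain t where t: "P.ok t" "A = enc t" by (rule FskX_ob_tree)
  then show "on_arr lift (FskX_Ident \<X> A) = Ident C (on_ob lift A)"
    using lift_den[of t t "FskX_Ident \<X> A" "Ident C (snd (P.ev t))"] P.den_id[OF t(1)] by (simp add: fst_ev lift_ob)
qed

lemma lift_strict: "strict_skew_functor (FskX \<X>) C lift"
  unfolding strict_skew_functor_def FskX_sel
proof (intro conjI ballI lift_functor)
  show "on_ob lift FskX_Unit = Unit C" using lift_ob[of Unt] by simp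
next
  fix A B assume "A \<in> FskX_Ob \<X>" "B \<in> FskX_Ob \<X>"
  then obtain s t where s: "P.ok s" "A = enc s" and t: "P.ok t" "B = enc t" by (metis FskX_ob_tree)
  then show "on_ob lift (FskX_Tens A B) = Tens C (on_ob lift A) (on_ob lift B)"
    using lift_ob[of "Node s t"] by (simp add: lift_ob)
  fix E assume "E \<in> FskX_Ob \<X>"
  then obtain w where w: "P.ok w" "E = enc w" by (rule FskX_ob_tree)
  show "on_arr lift (FskX_Assoc \<X> A B E) = Assoc C (on_ob lift A) (on_ob lift B) (on_ob lift E)"
    using lift_den[of "Node (Node s t) w" "Node s (Node t w)"] P.den_assoc[OF s(1) t(1) w(1)] s t w
    by (simp add: fst_ev lift_ob)
next
  fix a b assume "a \<in> FskX_Arr \<X>" "b \<in> FskX_Arr \<X>"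
  then obtain D B D' B' where "P.den D B (a, on_arr lift a)" "P.den D' B' (b, on_arr lift b)"
    by (metis FskX_arr_den)
  from P.den_tens[OF this] show "on_arr lift (FskX_TensA a b) = TensA C (on_arr lift a) (on_arr lift b)"
    by (intro lift_den) simp
next
  fix A assume "A \<in> FskX_Ob \<X>"
  then obtain t where t: "P.ok t" "A = enc t" by (rule FskX_ob_tree)
  show "on_arr lift (FskX_LUnit \<X> A) = LUnit C (on_ob lift A)"
    using lift_den[of "Node Unt t" t] P.den_lunit[OF t(1)] t by (simp add: fst_ev lift_ob)
  show "on_arr lift (FskX_RUnit \<X> A) = RUnit C (on_ob lift A)"
    using lift_den[of t "Node t Unt"] P.den_runit[OF t(1)] t by (simp add: fst_ev lift_ob)
qed

lemma lift_J: "ftor_comp \<X> lift (FskX_J \<X>) = G"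
proof -
  have "compose (Ob \<X>) (on_ob lift) (on_ob (FskX_J \<X>)) = on_ob G"
  proof (rule extensionalityI[of _ "Ob \<X>"])
    show "on_ob G \<in> extensional (Ob \<X>)" using G by (auto simp: is_functor_def PiE_def)
    fix A assume A: "A \<in> Ob \<X>"
    then show "compose (Ob \<X>) (on_ob lift) (on_ob (FskX_J \<X>)) A = on_ob G A"
      using lift_ob[of "Leaf A"] by (simp add: compose_eq FskX_J_def GP_simps)
  qed (simp add: compose_def)
  moreover have "compose (Arr \<X>) (on_arr lift) (on_arr (FskX_J \<X>)) = on_arr G"
  proof (rule extensionalityI[of _ "Arr \<X>"])
    show "on_arr G \<in> extensional (Arr \<X>)" using G by (auto simp: is_functor_def PiE_def)
    fix f assume f: "f \<in> Arr \<X>"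
    then show "compose (Arr \<X>) (on_arr lift) (on_arr (FskX_J \<X>)) f = on_arr G f"
      using lift_den[of "Leaf (Dom \<X> f)" "Leaf (Cod \<X> f)"] P.den_leaf[of f "Dom \<X> f" "Cod \<X> f"]
      by (simp add: compose_eq GP_simps cat_hom_def)
  qed (simp add: compose_def)
  ultimately show ?thesis by (simp add: ftor_comp_def)
qed

text \<open>Objects are settled by induction on trees. For arrows, the graph of \<open>F\<close>
  contains the generators of the product and is closed under composition and tensor, and every arrow
  of Fsk(X) is the first component of a generated arrow.\<close>

lemma lift_unique:
  assumes F: "strict_skew_functor (FskX \<X>) C F" and J: "ftor_comp \<X> F (FskX_J \<X>) = G"
  shows "F = lift"
proof -
  note S = F[unfolded strict_skew_functor_def FskX_sel]
  have func: "is_functor (FskX \<X>) C F" using S by blast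
  have J_ob: "on_ob F (FskX_J_ob A) = on_ob G A" if "A \<in> Ob \<X>" for A
    using that by (simp add: J[symmetric] ftor_comp_def compose_eq FskX_J_def)
  have J_arr: "on_arr F (on_arr (FskX_J \<X>) f) = on_arr G f" if "f \<in> Arr \<X>" for f
    using that by (simp add: J[symmetric] ftor_comp_def compose_eq)
  have ob: "P.ok t \<Longrightarrow> on_ob F (enc t) = snd (P.ev t)" for t
  proof (induction t)
    case Unt
    then show ?case using S by simp
  next
    case (Leaf A)
    then show ?case using J_ob by (simp add: GP_simps)
  next
    case (Node s t)
    then show ?case using S enc_ok by simp
  qed
  have arr: "P.den D B p \<Longrightarrow> on_arr F (fst p) = snd p" for D B p
  proof (induction rule: P.den.induct)
    case (den_id A)
    then show ?case using is_functor_Ident[OF func, of "enc A"] ob enc_ok fst_ev by simp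
  next
    case (den_comp A B f E g)
    then show ?case
      using is_functor_Comp[OF func den_fhom[OF den_comp.hyps(1)] den_fhom[OF den_comp.hyps(2)]] by simp
  next
    case (den_tens A B f E K g)
    then show ?case using S cat_homD(1)[OF den_fhom[OF den_tens.hyps(1)]] cat_homD(1)[OF den_fhom[OF den_tens.hyps(2)]] by simp
  next
    case (den_assoc A B E)
    then show ?case using S enc_ok ob fst_ev by simp
  next
    case (den_lunit A)
    then show ?case using S enc_ok ob fst_ev by simp
  next
    case (den_runit A)
    then show ?case using S enc_ok ob fst_ev by simp
  next
    case (den_leaf f A B)
    then show ?case using J_arr cat_homD(1)[OF den_leaf] by (simp add: GP_simps)
  qed
  have "on_ob F = on_ob lift"
  proof (rule extensionalityI[of _ "FskX_Ob \<X>"])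
    show "on_ob F \<in> extensional (FskX_Ob \<X>)" "on_ob lift \<in> extensional (FskX_Ob \<X>)"
      using func lift_functor by (auto simp: is_functor_def PiE_def)
    show "on_ob F A = on_ob lift A" if "A \<in> FskX_Ob \<X>" for A
      using FskX_ob_tree[OF that] ob lift_ob by metis
  qed
  moreover have "on_arr F = on_arr lift"
  proof (rule extensionalityI[of _ "FskX_Arr \<X>"])
    show "on_arr F \<in> extensional (FskX_Arr \<X>)" "on_arr lift \<in> extensional (FskX_Arr \<X>)"
      using func lift_functor by (auto simp: is_functor_def PiE_def)
    show "on_arr F a = on_arr lift a" if "a \<in> FskX_Arr \<X>" for a
      using FskX_arr_den[OF that] arr fst_conv snd_conv by metis
  qed
  ultimately show ?thesis by simp
qed

end

theorem theorem12p2: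
  fixes \<X> :: "('o, 'a) cat"
  assumes "category \<X>"
  shows "free_skew_monoidal_on TYPE('c) TYPE('d) \<X> (FskX \<X>) (FskX_J \<X>)"
proof -
  interpret base_category \<X> by (rule base_category.intro) fact
  show ?thesis
    unfolding free_skew_monoidal_on_def
  proof (intro conjI allI impI FskX_skew_monoidal FskX_J_functor)
    fix C :: "('c, 'd) skew_cat" and G
    assume CG: "skew_monoidal_category C \<and> is_functor \<X> C G"
    interpret free_extension \<X> C G
      using CG by (intro free_extension.intro free_extension_axioms.intro base_category_axioms) auto
    show "\<exists>!F. strict_skew_functor (FskX \<X>) C F \<and> ftor_comp \<X> F (FskX_J \<X>) = G"
      using lift_strict lift_J lift_unique by blast
  qed
qed

end
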